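(* Let $n\in\mathbb N$, $n\ge 2$, $1<p<\infty$, and $\alpha\in(0,1)$. There exists a constant $A_{n,p}>0$ (depending only on $n$ and $p$) such that, for every $f\in C_c(\mathbb H^n)\cap \mathrm{Lip}^\alpha_{\mathrm{loc}}(\mathbb H^n)$, $$\lim_{s\to 0^+}(-\Delta_{\mathbb H^n})_p^s f(x)=A_{n,p}\,\Phi_p(f(x)),\qquad x\in\mathbb H^n.$$
   Context: Hyperbolic space: $\mathbb H^n=\{(x_0,\dots,x_n)\in\mathbb R^{n+1}: x_0^2-x_1^2-\cdots-x_n^2=1,\ x_0>0\}$, with the Riemannian metric induced by the Lorentzian metric $-dx_0^2+dx_1^2+\cdots+dx_n^2$. In polar coordinates $x=(\cosh\rho,\omega\sinh\rho)$, $\rho>0$, $\omega\in S^{n-1}$, the metric is $d\rho^2+(\sinh\rho)^2d\omega^2$ and the volume element (written $dy$) is $(\sinh\rho)^{n-1}d\rho\,d\omega$. $d_{\mathbb H^n}(x,y)$ denotes the geodesic distance, i.e. $\cosh d_{\mathbb H^n}(x,y)=x_0y_0-x_1y_1-\cdots-x_ny_n$. Function spaces: $C_c(\mathbb H^n)$ is the space of continuous complex functions with compact support in $\mathbb H^n$. $\mathrm{Lip}^\alpha_{\mathrm{loc}}(\mathbb H^n)$ is the space of complex functions $f$ on $\mathbb H^n$ such that for every $x\in\mathbb H^n$ and $r>0$, $\sup_{y\ne x,\ d_{\mathbb H^n}(x,y)\le r}\frac{|f(x)-f(y)|}{d_{\mathbb H^n}(x,y)^\alpha}<\infty$. $\Phi_p(z)=|z|^{p-2}z$,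 with $\Phi_p(0)=0$. Fractional $p$-Laplacian: for $s\in(0,1)$, $$(-\Delta_{\mathbb H^n})_p^sf(x)=\mathrm{P.V.}\int_{\mathbb H^n}\Phi_p(f(x)-f(y))\,\mathcal K_{n,s,p}(d_{\mathbb H^n}(x,y))\,dy,$$ where P.V. means $\lim_{\varepsilon\to0^+}\int_{d_{\mathbb H^n}(x,y)>\varepsilon}$. The kernel is, for $\rho>0$, $$\mathcal K_{n,s,p}(\rho)=s\,a_{n,s,p}\Big(-\frac1{\sinh\rho}\frac{\partial}{\partial\rho}\Big)^{\frac{n-1}2}\Big[\rho^{-\frac{1+sp}2}K_{\frac{1+sp}2}\big(\tfrac{n-1}2\rho\big)\Big]$$ when $n\ge3$ is odd, and $$\mathcal K_{n,s,p}(\rho)=\frac{s\,a_{n,s,p}}{\sqrt\pi}\int_\rho^\infty\frac{\sinh r}{\sqrt{\cosh r-\cosh\rho}}\Big(-\frac1{\sinh r}\frac{\partial}{\partial r}\Big)^{\frac n2}\Big[r^{-\frac{1+sp}2}K_{\frac{1+sp}2}\big(\tfrac{n-1}2r\big)\Big]dr$$ when $n$ is even, where $K_\nu$ is the modified Bessel function of the second kind of order $\nu$ and $$a_{n,s,p}=\frac{p\,(n-1)^{\frac{1+sp}2}}{2^{s(p-2)+\frac{n+3}2}\,\pi^{\frac{n-1}2}\,\Gamma(\frac{p+1}2)\,\Gamma(1-s)}.$$ *)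

theory Defs
  imports "HOL-Analysis.Analysis"
begin

section \<open>Hyperbolic space\<close>

text \<open>
  The ambient space \<open>\<real>\<^sup>n\<^sup>+\<^sup>1\<close> is \<open>real \<times> (real ^ 'n)\<close> with \<open>n = CARD('n)\<close>: a point
  \<open>(x\<^sub>0, x\<^sub>1, \<dots>, x\<^sub>n)\<close> is the pair of \<open>x\<^sub>0\<close> and the vector \<open>(x\<^sub>1, \<dots>, x\<^sub>n)\<close>.
  Functions on hyperbolic space are functions on the ambient space of which only the
  values on \<open>hyperbolic_space\<close> are ever used.
\<close>

definition hyperbolic_space :: "(real \<times> (real ^ 'n::finite)) set" where
  "hyperbolic_space = {(x0, x'). x0\<^sup>2 - (\<Sum>i\<in>UNIV. (x' $ i)\<^sup>2) = 1 \<and> x0 > 0}"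

definition hyp_dist :: "real \<times> (real ^ 'n::finite) \<Rightarrow> real \<times> (real ^ 'n) \<Rightarrow> real" where
  "hyp_dist x y = arcosh (fst x * fst y - (\<Sum>i\<in>UNIV. snd x $ i * snd y $ i))"

text \<open>
  Surface measure \<open>d\<omega>\<close> on the unit sphere: the measure of a set \<open>B\<close> of directions is
  \<open>n\<close> times the Lebesgue measure of the part over \<open>B\<close> of the unit ball. It is a Borel measure
  on the whole space, concentrated on the sphere (\<open>sgn 0 = 0\<close> only concerns a null set).
\<close>

definition sphere_measure :: "(real ^ 'n::finite) measure" where
  "sphere_measure =
     distr (density lborel (\<lambda>x. of_nat CARD('n) * indicator (ball 0 1) x)) borel sgn"

text \<open>
  The volume \<open>dy = (sinh \<rho>)\<^sup>n\<^sup>-\<^sup>1 d\<rho> d\<omega>\<close> in polar coordinates, as a Borel measure on the ambient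
  space concentrated on \<open>hyperbolic_space\<close>.
\<close>

definition hyp_volume :: "(real \<times> (real ^ 'n::finite)) measure" where
  "hyp_volume =
     distr
       (density lborel (\<lambda>\<rho>. ennreal (sinh \<rho> ^ (CARD('n) - 1)) * indicator {0<..} \<rho>)
          \<Otimes>\<^sub>M sphere_measure)
       borel (\<lambda>(\<rho>, \<omega>). (cosh \<rho>, sinh \<rho> *\<^sub>R \<omega>))"

section \<open>Function spaces\<close>

text \<open>
  The topology of hyperbolic space is the subspace topology; since \<open>hyperbolic_space\<close>
  is closed in the ambient space, the closure below is also the closure inside it.
\<close>

definition hyp_Cc :: "(real \<times> (real ^ 'n::finite) \<Rightarrow> complex) set" where
  "hyp_Cc = {f. continuous_on hyperbolic_space f \<and>
                compact (closure {x \<in> hyperbolic_space. f x \<noteq> 0})}"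

definition hyp_Lip_loc :: "real \<Rightarrow> (real \<times> (real ^ 'n::finite) \<Rightarrow> complex) set" where
  "hyp_Lip_loc \<alpha> = {f. \<forall>x\<in>hyperbolic_space. \<forall>r>0.
      bdd_above ((\<lambda>y. norm (f x - f y) / hyp_dist x y powr \<alpha>) `
                   {y \<in> hyperbolic_space. y \<noteq> x \<and> hyp_dist x y \<le> r})}"

section \<open>The kernel\<close>

text \<open>
  The modified Bessel function of the second kind, for real order and \<open>z > 0\<close>, by its
  classical integral \<open>K\<^sub>\<nu>(z) = \<integral>\<^sub>0\<^sup>\<infinity> exp (- z cosh t) cosh (\<nu> t) dt\<close> (DLMF 10.32.9).
\<close>

definition bessel_K :: "real \<Rightarrow> real \<Rightarrow> real" where
  "bessel_K \<nu> z = (LBINT t:{0<..}. exp (- z * cosh t) * cosh (\<nu> * t))"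

definition kernel_const :: "nat \<Rightarrow> real \<Rightarrow> real \<Rightarrow> real" where
  "kernel_const n s p =
     p * (real n - 1) powr ((1 + s * p) / 2) /
     (2 powr (s * (p - 2) + (real n + 3) / 2) * pi powr ((real n - 1) / 2) *
      Gamma ((p + 1) / 2) * Gamma (1 - s))"

definition kernel_profile :: "nat \<Rightarrow> real \<Rightarrow> real \<Rightarrow> real \<Rightarrow> real" where
  "kernel_profile n s p \<rho> =
     \<rho> powr (- ((1 + s * p) / 2)) * bessel_K ((1 + s * p) / 2) ((real n - 1) / 2 * \<rho>)"

definition sinh_deriv :: "(real \<Rightarrow> real) \<Rightarrow> real \<Rightarrow> real" where
  "sinh_deriv g \<rho> = - (1 / sinh \<rho>) * deriv g \<rho>"

definition frac_kernel :: "nat \<Rightarrow> real \<Rightarrow> real \<Rightarrow> real \<Rightarrow> real" where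
  "frac_kernel n s p \<rho> =
     (if odd n
      then s * kernel_const n s p * (sinh_deriv ^^ ((n - 1) div 2)) (kernel_profile n s p) \<rho>
      else s * kernel_const n s p / sqrt pi *
             (LBINT r:{\<rho><..}. sinh r / sqrt (cosh r - cosh \<rho>) *
                (sinh_deriv ^^ (n div 2)) (kernel_profile n s p) r))"

section \<open>The fractional p-Laplacian\<close>

definition Phi :: "real \<Rightarrow> complex \<Rightarrow> complex" where
  "Phi p z = (if z = 0 then 0 else of_real (norm z powr (p - 2)) * z)"

definition frac_p_integrand ::
    "real \<Rightarrow> real \<Rightarrow> (real \<times> (real ^ 'n::finite) \<Rightarrow> complex) \<Rightarrow>
       real \<times> (real ^ 'n) \<Rightarrow> real \<times> (real ^ 'n) \<Rightarrow> complex" where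
  "frac_p_integrand s p f x y =
     Phi p (f x - f y) * of_real (frac_kernel CARD('n) s p (hyp_dist x y))"

definition truncated_frac_p_laplacian ::
    "real \<Rightarrow> real \<Rightarrow> (real \<times> (real ^ 'n::finite) \<Rightarrow> complex) \<Rightarrow>
       real \<times> (real ^ 'n) \<Rightarrow> real \<Rightarrow> complex" where
  "truncated_frac_p_laplacian s p f x \<epsilon> =
     (LINT y:{y \<in> hyperbolic_space. hyp_dist x y > \<epsilon>}|hyp_volume. frac_p_integrand s p f x y)"

definition frac_p_laplacian ::
    "real \<Rightarrow> real \<Rightarrow> (real \<times> (real ^ 'n::finite) \<Rightarrow> complex) \<Rightarrow> real \<times> (real ^ 'n) \<Rightarrow> complex" where
  "frac_p_laplacian s p f x = Lim (at_right 0) (truncated_frac_p_laplacian s p f x)"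

text \<open>
  Both the integral and \<open>Lim\<close> are total, with a junk value where they do not exist; this
  predicate says that the principal value defining \<open>frac_p_laplacian s p f x\<close> exists.
\<close>

definition frac_p_laplacian_exists ::
    "real \<Rightarrow> real \<Rightarrow> (real \<times> (real ^ 'n::finite) \<Rightarrow> complex) \<Rightarrow> real \<times> (real ^ 'n) \<Rightarrow> bool" where
  "frac_p_laplacian_exists s p f x \<longleftrightarrow>
     (\<forall>\<epsilon>>0. set_integrable hyp_volume {y \<in> hyperbolic_space. hyp_dist x y > \<epsilon>}
               (frac_p_integrand s p f x)) \<and>
     (\<exists>l. (truncated_frac_p_laplacian s p f x \<longlongrightarrow> l) (at_right 0))"

end

theory Submission
  imports Defs "HOL-Real_Asymp.Real_Asymp"
begin

text \<open>
  By invariance of the volume under the Lorentz reflection that moves the origin to \<open>x\<close>, in geodesic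
  polar coordinates around \<open>x\<close> the operator integrates against
  \<open>frac_kernel \<rho> (sinh \<rho>)\<^sup>n\<^sup>-\<^sup>1 d\<rho>\<close>. On a ball containing the support of \<open>f\<close> the H\<ouml>lder bound
  beats the singularity of the kernel at \<open>0\<close>, uniformly in small \<open>s\<close>, and the factor \<open>s\<close>
  of the kernel makes this part vanish. Outside the ball the integrand is
  \<open>\<Phi>\<^sub>p(f(x))\<close> times the kernel, whose density behaves like \<open>s c \<rho>\<^sup>-\<^sup>1\<^sup>-\<^sup>s\<^sup>p\<^sup>/\<^sup>2\<close> uniformly in \<open>s\<close>, and
  \<open>s \<integral>\<^sub>R\<^sup>\<infinity> \<rho>\<^sup>-\<^sup>1\<^sup>-\<^sup>s\<^sup>p\<^sup>/\<^sup>2 d\<rho> \<rightarrow> 2/p\<close>.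

  The kernel is controlled through \<open>(\<rho>\<^sup>-\<^sup>\<nu> K\<^sub>\<nu>(a \<rho>))' = - a \<rho> \<rho>\<^sup>-\<^sup>\<nu>\<^sup>-\<^sup>1 K\<^sub>\<nu>\<^sub>+\<^sub>1(a \<rho>)\<close>: the iterated
  operator produces finite sums of \<open>\<rho>\<^sup>i (cosh \<rho>)\<^sup>l (sinh \<rho>)\<^sup>j \<rho>\<^sup>-\<^sup>\<nu>\<^sup>-\<^sup>k K\<^sub>\<nu>\<^sub>+\<^sub>k(a \<rho>)\<close> whose
  coefficients do not depend on \<open>\<nu>\<close>. For even \<open>n\<close>, Fubini's theorem moves the extra integral onto
  the weight \<open>(sinh \<rho>)\<^sup>n\<^sup>-\<^sup>1\<close>.
\<close>

section \<open>The modified Bessel function\<close>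

text \<open>At \<open>s = 0\<close> the radial density of the kernel decays only like
  \<open>1 / \<rho>\<close>, so the mass that survives in the limit moves off to infinity as
  \<open>s\<close> tends to 0. A limit at fixed \<open>\<rho>\<close> or at fixed \<open>s\<close>
  does not see it; the asymptotics are therefore joint, along
  \<open>at_right 0 \<times>\<^sub>F at_top\<close>. The Bessel order \<open>(1 + s * p) / 2\<close>
  then varies as well, which is harmless because K increases with its order while its leading
  behaviour at infinity is the same for all orders. The exponentials balance as follows. The profile
  decays at rate \<open>(n - 1) / 2\<close> and each \<open>sinh_deriv\<close> adds 1. For odd
  \<open>n\<close> the total is \<open>n - 1\<close>, the growth rate of the volume. For even
  \<open>n\<close> it is \<open>n - 1 / 2\<close>, and the surplus half is matched by the growth
  that the inverse square root adds to the weight. The leading coefficients multiply to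
  \<open>a * (a + 1) * ... * (a + m - 1)\<close> with \<open>a = (n - 1) / 2\<close>; nothing
  cancels, whence the positivity of the limit constant. At the singularity no sharp exponent is
  pursued: an arbitrarily small loss is absorbed by the positive exponent
  \<open>\<alpha> * (p - 1)\<close>, at the price that \<open>s\<close> has to be small.\<close>

lemma borel_measurable_cosh [measurable (raw)]:
  fixes f :: "'a \<Rightarrow> real"
  shows "f \<in> borel_measurable M \<Longrightarrow> (\<lambda>x. cosh (f x)) \<in> borel_measurable M"
  by (erule measurable_compose) (intro borel_measurable_continuous_onI continuous_intros)

lemma borel_measurable_sinh [measurable (raw)]:
  fixes f :: "'a \<Rightarrow> real"
  shows "f \<in> borel_measurable M \<Longrightarrow> (\<lambda>x. sinh (f x)) \<in> borel_measurable M"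
  by (erule measurable_compose) (intro borel_measurable_continuous_onI continuous_intros)

section \<open>Improper integrals from antiderivatives, and exponential decay\<close>

lemma set_integral_FTC_Ioi:
  fixes f F :: "real \<Rightarrow> real"
  assumes F: "\<And>x. a < x \<Longrightarrow> (F has_real_derivative f x) (at x)"
    and f: "\<And>x. a < x \<Longrightarrow> isCont f x" and nonneg: "\<And>x. a < x \<Longrightarrow> 0 \<le> f x"
    and A: "(F \<longlongrightarrow> A) (at_right a)" and B: "(F \<longlongrightarrow> B) at_top"
  shows "set_integrable lborel {a<..} f" "(LBINT x:{a<..}. f x) = B - A"
proof -
  have "((F \<circ> real_of_ereal) \<longlongrightarrow> A) (at_right (ereal a))" 
    using A by (simp add: ereal_tendsto_simps)
  moreover have "((F \<circ> real_of_ereal) \<longlongrightarrow> B) (at_left \<infinity>)"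
    using B by (simp add: ereal_tendsto_simps)
  ultimately have *: "set_integrable lborel (einterval (ereal a) \<infinity>) f"
      "(LBINT x=ereal a..\<infinity>. f x) = B - A"
    using interval_integral_FTC_nonneg[of "ereal a" \<infinity> F f A B] F f nonneg by auto
  from *(1) show "set_integrable lborel {a<..} f" by (simp add: einterval_eq)
  from *(2) show "(LBINT x:{a<..}. f x) = B - A" by (simp add: interval_lebesgue_integral_def einterval_eq)
qed

lemma set_integral_FTC_Ioo:
  fixes f F :: "real \<Rightarrow> real"
  assumes "a < b" and F: "\<And>x. a < x \<Longrightarrow> x < b \<Longrightarrow> (F has_real_derivative f x) (at x)"
    and f: "\<And>x. a < x \<Longrightarrow> x < b \<Longrightarrow> isCont f x" and nonneg: "\<And>x. a < x \<Longrightarrow> x < b \<Longrightarrow> 0 \<le> f x"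
    and A: "(F \<longlongrightarrow> A) (at_right a)" and B: "(F \<longlongrightarrow> B) (at_left b)"
  shows "set_integrable lborel {a<..<b} f" "(LBINT x:{a<..<b}. f x) = B - A"
proof -
  have "((F \<circ> real_of_ereal) \<longlongrightarrow> A) (at_right (ereal a))" 
    using A by (simp add: ereal_tendsto_simps)
  moreover have "((F \<circ> real_of_ereal) \<longlongrightarrow> B) (at_left (ereal b))"
    using B by (simp add: ereal_tendsto_simps)
  ultimately have *: "set_integrable lborel (einterval (ereal a) (ereal b)) f"
      "(LBINT x=ereal a..ereal b. f x) = B - A"
    using interval_integral_FTC_nonneg[of "ereal a" "ereal b" F f A B] F f nonneg \<open>a < b\<close> by auto
  from *(1) show "set_integrable lborel {a<..<b} f" by (simp add: einterval_eq)
  from *(2) \<open>a < b\<close> show "(LBINT x:{a<..<b}. f x) = B - A"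
    by (simp add: interval_lebesgue_integral_def einterval_eq)
qed

lemma set_integral_exp_decay:
  fixes c q :: real
  assumes "q > 0"
  shows "set_integrable lborel {c<..} (\<lambda>t. exp (- (q * t)))"
    "(LBINT t:{c<..}. exp (- (q * t))) = exp (- (q * c)) / q"
proof -
  let ?F = "\<lambda>t. - exp (- (q * t)) / q"
  have d: "(?F has_real_derivative exp (- (q * t))) (at t)" for t
    using assms by (auto intro!: derivative_eq_intros)
  have A: "(?F \<longlongrightarrow> - exp (- (q * c)) / q) (at_right c)"
    by (intro tendsto_intros) (use assms in auto)
  have "filterlim (\<lambda>t. q * t) at_top at_top"
    using assms by (simp add: filterlim_tendsto_pos_mult_at_top[OF tendsto_const _ filterlim_ident])
  then have "((\<lambda>t. exp (- (q * t))) \<longlongrightarrow> 0) at_top"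
    by (intro filterlim_compose[OF exp_at_bot]) (simp add: filterlim_uminus_at_bot)
  from tendsto_divide[OF tendsto_minus[OF this] tendsto_const[of q]] assms
  have B: "(?F \<longlongrightarrow> 0) at_top" by simp
  from set_integral_FTC_Ioi[OF d _ _ A B]
  show "set_integrable lborel {c<..} (\<lambda>t. exp (- (q * t)))"
    "(LBINT t:{c<..}. exp (- (q * t))) = exp (- (q * c)) / q" by auto
qed

lemma set_borel_measurable_continuous_lborel:
  fixes f :: "real \<Rightarrow> real"
  assumes "S \<in> sets borel" "continuous_on S f"
  shows "set_borel_measurable lborel S f"
  using borel_measurable_continuous_on_indicator[OF assms] by (simp add: set_borel_measurable_def)

text \<open>Raise \<open>x / N \<le> exp (x / N)\<close> to the power \<open>N\<close> and invert.
  Exponential decay is traded for a power of any chosen order.\<close>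

lemma exp_minus_le_powr:
  fixes x N :: real
  assumes "x > 0" "N > 0"
  shows "exp (- x) \<le> (N / x) powr N"
proof -
  have "x / N \<le> exp (x / N)" using exp_ge_add_one_self[of "x / N"] by linarith
  then have "(x / N) powr N \<le> exp (x / N) powr N" using assms by (intro powr_mono2) auto
  also have "exp (x / N) powr N = exp x" using assms by (simp add: powr_def)
  finally have "(x / N) powr N \<le> exp x" .
  then have "inverse (exp x) \<le> inverse ((x / N) powr N)"
    using assms by (intro le_imp_inverse_le) auto
  then show ?thesis using assms by (simp add: exp_minus powr_divide)
qed

text \<open>Apply \<open>exp_minus_le_powr\<close> at \<open>x = z * exp t / 2\<close>. The doubly
  exponential decay in \<open>t\<close> becomes a simple exponential of any rate \<open>N\<close>,
  and the price \<open>z powr (- N)\<close> is what later bounds the singularity of K at 0.\<close>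

lemma exp_cosh_le:
  fixes z N t :: real
  assumes "z > 0" "N > 0"
  shows "exp (- (z * cosh t)) \<le> (2 * N / z) powr N * exp (- (N * t))"
proof -
  have "exp t / 2 \<le> cosh t" by (simp add: cosh_def field_simps)
  then have "z * (exp t / 2) \<le> z * cosh t" using assms by simp
  then have "exp (- (z * cosh t)) \<le> exp (- (z * exp t / 2))" by simp
  also have "\<dots> \<le> (N / (z * exp t / 2)) powr N" using assms by (intro exp_minus_le_powr) auto
  also have "N / (z * exp t / 2) = (2 * N / z) * exp (- t)" by (simp add: exp_minus field_simps)
  also have "((2 * N / z) * exp (- t)) powr N = (2 * N / z) powr N * exp (- t) powr N"
    using assms by (intro powr_mult)
  also have "exp (- t) powr N = exp (- (N * t))" by (simp add: powr_def)
  finally show ?thesis .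
qed

lemma cosh_le_exp: "(0::real) \<le> t \<Longrightarrow> cosh t \<le> exp t"
  by (simp add: cosh_def)

lemma set_integrable_exp_cosh:
  fixes z q :: real
  assumes "z > 0"
  shows "set_integrable lborel {0<..} (\<lambda>t. exp (- (z * cosh t)) * exp (q * t))"
proof -
  define N where "N = \<bar>q\<bar> + 1"
  have N: "N > 0" "N - q > 0" by (auto simp: N_def)
  have "set_integrable lborel {0<..} (\<lambda>t. (2 * N / z) powr N * exp (- ((N - q) * t)))"
    by (intro set_integrable_mult_right set_integral_exp_decay N)
  then show ?thesis
  proof (rule set_integrable_bound)
    show "set_borel_measurable lborel {0<..} (\<lambda>t. exp (- (z * cosh t)) * exp (q * t))"
      by (intro set_borel_measurable_continuous_lborel continuous_intros) auto
    show "AE t in lborel. t \<in> {0<..} \<longrightarrow> norm (exp (- (z * cosh t)) * exp (q * t)) \<le>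
         norm ((2 * N / z) powr N * exp (- ((N - q) * t)))"
    proof (intro AE_I2 impI)
      fix t
      have "exp (- (z * cosh t)) * exp (q * t) \<le> (2 * N / z) powr N * exp (- (N * t)) * exp (q * t)"
        by (intro mult_right_mono exp_cosh_le assms N) auto
      also have "\<dots> = (2 * N / z) powr N * exp (- ((N - q) * t))"
        by (simp add: mult.assoc exp_add[symmetric] algebra_simps)
      finally show "norm (exp (- (z * cosh t)) * exp (q * t)) \<le>
         norm ((2 * N / z) powr N * exp (- ((N - q) * t)))" by simp
    qed
  qed
qed

lemma set_integrable_exp_cosh_bound:
  fixes z q C :: real
  assumes "z > 0" "continuous_on {0<..} h" "\<And>t. t > 0 \<Longrightarrow> \<bar>h t\<bar> \<le> C * exp (q * t)"
  shows "set_integrable lborel {0<..} (\<lambda>t. exp (- (z * cosh t)) * h t)"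
proof (rule set_integrable_bound)
  show "set_integrable lborel {0<..} (\<lambda>t. C * (exp (- (z * cosh t)) * exp (q * t)))"
    by (intro set_integrable_mult_right set_integrable_exp_cosh assms)
  show "set_borel_measurable lborel {0<..} (\<lambda>t. exp (- (z * cosh t)) * h t)"
    using assms(2) by (intro set_borel_measurable_continuous_lborel continuous_intros) auto
  show "AE t in lborel. t \<in> {0<..} \<longrightarrow> norm (exp (- (z * cosh t)) * h t) \<le>
         norm (C * (exp (- (z * cosh t)) * exp (q * t)))"
  proof (intro AE_I2 impI)
    fix t :: real assume "t \<in> {0<..}"
    then have h: "\<bar>h t\<bar> \<le> C * exp (q * t)" using assms by auto
    then have "\<bar>h t\<bar> \<le> \<bar>C * exp (q * t)\<bar>" by linarith
    then show "norm (exp (- (z * cosh t)) * h t) \<le> norm (C * (exp (- (z * cosh t)) * exp (q * t)))"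
      by (simp add: abs_mult mult.left_commute)
  qed
qed

section \<open>Convergence, monotonicity in the order and size of the Bessel integral\<close>

lemma cosh_mult_le_exp:
  fixes \<mu> t :: real
  assumes "t > 0" shows "cosh (\<mu> * t) \<le> exp (\<bar>\<mu>\<bar> * t)"
proof -
  have "cosh (\<mu> * t) = cosh (\<bar>\<mu>\<bar> * t)" by (simp add: cosh_def abs_if)
  also have "\<dots> \<le> exp (\<bar>\<mu>\<bar> * t)" using assms by (intro cosh_le_exp) simp
  finally show ?thesis .
qed

lemma bessel_K_integrable:
  fixes z \<mu> :: real
  assumes "z > 0" shows "set_integrable lborel {0<..} (\<lambda>t. exp (- z * cosh t) * cosh (\<mu> * t))"
  using set_integrable_exp_cosh_bound[OF assms, of "\<lambda>t. cosh (\<mu> * t)" 1 "\<bar>\<mu>\<bar>"] cosh_mult_le_exp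
  by (simp add: continuous_intros)

lemma bessel_K_nonneg: "0 \<le> bessel_K \<mu> z"
  unfolding bessel_K_def set_lebesgue_integral_def by (rule integral_nonneg_AE) auto

lemma bessel_K_mono:
  assumes "0 \<le> \<mu>" "\<mu> \<le> \<mu>'" "z > 0"
  shows "bessel_K \<mu> z \<le> bessel_K \<mu>' z"
  unfolding bessel_K_def
proof (rule set_integral_mono[OF bessel_K_integrable bessel_K_integrable])
  fix t :: real assume "t \<in> {0<..}"
  then have "cosh (\<mu> * t) \<le> cosh (\<mu>' * t)" using assms by (simp add: cosh_real_nonneg_le_iff mult_right_mono)
  then show "exp (- z * cosh t) * cosh (\<mu> * t) \<le> exp (- z * cosh t) * cosh (\<mu>' * t)" by simp
qed (use assms in auto)

text \<open>The true singularity is \<open>z powr (- \<mu>)\<close>. Taking \<open>N\<close>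
  slightly above \<open>\<mu>\<close> costs an arbitrarily small power and the factor
  \<open>1 / (N - \<mu>)\<close>, and follows by integrating \<open>exp_cosh_le\<close>.\<close>

lemma bessel_K_le:
  assumes "0 \<le> \<mu>" "\<mu> < N" "z > 0"
  shows "bessel_K \<mu> z \<le> (2 * N / z) powr N / (N - \<mu>)"
proof -
  have "bessel_K \<mu> z \<le> (LBINT t:{0<..}. (2 * N / z) powr N * exp (- ((N - \<mu>) * t)))"
    unfolding bessel_K_def
  proof (rule set_integral_mono[OF bessel_K_integrable])
    show "set_integrable lborel {0<..} (\<lambda>t. (2 * N / z) powr N * exp (- ((N - \<mu>) * t)))"
      by (intro set_integrable_mult_right set_integral_exp_decay) (use assms in auto)
    fix t :: real assume t: "t \<in> {0<..}"
    have "exp (- z * cosh t) * cosh (\<mu> * t) \<le> ((2 * N / z) powr N * exp (- (N * t))) * exp (\<mu> * t)"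
      using exp_cosh_le[of z N t] cosh_mult_le_exp[of t \<mu>] assms t by (intro mult_mono) auto
    also have "\<dots> = (2 * N / z) powr N * exp (- ((N - \<mu>) * t))"
      by (simp add: mult.assoc exp_add[symmetric] algebra_simps)
    finally show "exp (- z * cosh t) * cosh (\<mu> * t) \<le> \<dots>" .
  qed (use assms in auto)
  also have "\<dots> = (2 * N / z) powr N / (N - \<mu>)"
    using set_integral_exp_decay[of "N - \<mu>" 0] assms by simp
  finally show ?thesis .
qed

section \<open>The derivative of the Bessel function in its argument\<close>

text \<open>In contrast to \<open>set_integral_FTC_Ioi\<close>, the integrand may change sign and
  integrability is an assumption; this is the form that the integration by parts in
  \<open>bessel_K_deriv\<close> requires.\<close>

lemma set_integral_FTC_Ioi_integrable:
  fixes f F :: "real \<Rightarrow> real"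
  assumes F: "\<And>x. a < x \<Longrightarrow> (F has_real_derivative f x) (at x)"
    and f: "\<And>x. a < x \<Longrightarrow> isCont f x" and int: "set_integrable lborel {a<..} f"
    and A: "(F \<longlongrightarrow> A) (at_right a)" and B: "(F \<longlongrightarrow> B) at_top"
  shows "(LBINT x:{a<..}. f x) = B - A"
proof -
  have "((F \<circ> real_of_ereal) \<longlongrightarrow> A) (at_right (ereal a))" 
    using A by (simp add: ereal_tendsto_simps)
  moreover have "((F \<circ> real_of_ereal) \<longlongrightarrow> B) (at_left \<infinity>)"
    using B by (simp add: ereal_tendsto_simps)
  ultimately have "(LBINT x=ereal a..\<infinity>. f x) = B - A"
    using interval_integral_FTC_integrable[of "ereal a" \<infinity> F f A B] F f int
    by (auto simp: einterval_eq has_real_derivative_iff_has_vector_derivative)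
  then show "(LBINT x:{a<..}. f x) = B - A" by (simp add: interval_lebesgue_integral_def einterval_eq)
qed

text \<open>Both sides come from \<open>1 + x \<le> exp x\<close>, used at \<open>x\<close> and at
  \<open>- x\<close>. It is the second-order remainder for differentiating under the integral
  sign.\<close>

lemma exp_remainder_le:
  fixes x :: real shows "\<bar>exp x - 1 - x\<bar> \<le> x\<^sup>2 * exp \<bar>x\<bar>"
proof -
  have 1: "exp x - 1 - x \<ge> 0" using exp_ge_add_one_self[of x] by linarith
  have "exp x * (1 - x) \<le> exp x * exp (- x)" using exp_ge_add_one_self[of "- x"] by simp
  then have 2: "exp x - 1 \<le> x * exp x" by (simp add: exp_minus algebra_simps)
  then have 3: "exp x - 1 - x \<le> x * (exp x - 1)" by (simp add: algebra_simps)
  have "x * (exp x - 1) \<le> x\<^sup>2 * exp \<bar>x\<bar>"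
  proof (cases "x \<ge> 0")
    case True
    then have "x * (exp x - 1) \<le> x * (x * exp x)" using 2 by (intro mult_left_mono)
    then show ?thesis using True by (simp add: power2_eq_square mult.assoc)
  next
    case False
    have "x \<le> exp x - 1" using exp_ge_add_one_self[of x] by linarith
    then have "x * (exp x - 1) \<le> x * x" using False by (intro mult_left_mono_neg) auto
    also have "x * x * 1 \<le> x * x * exp \<bar>x\<bar>" by (intro mult_left_mono) auto
    finally show ?thesis by (simp add: power2_eq_square)
  qed
  with 1 3 show ?thesis by linarith
qed

text \<open>Differentiation under the integral sign with an explicit remainder: the increment
  differs from its linear part by at most \<open>h\<^sup>2 * B\<close>, so the difference quotient
  errs by at most \<open>\<bar>h\<bar> * B\<close>.\<close>

lemma bessel_K_shift_integral:
  fixes z \<mu> :: real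
  assumes z: "z > 0"
  defines "J \<equiv> LBINT t:{0<..}. exp (- (z * cosh t)) * (cosh t * cosh (\<mu> * t))"
  shows "(bessel_K \<mu> has_real_derivative - J) (at z)"
proof -
  \<comment> \<open>\<open>B\<close> is the second-derivative integral taken at
    \<open>z / 2\<close>: for \<open>\<bar>h\<bar> \<le> z / 2\<close> the factor
    \<open>exp (\<bar>h\<bar> * cosh t)\<close> of the remainder uses up at most half of the decay
    \<open>exp (- z * cosh t)\<close>.\<close>
  define B where "B = (LBINT t:{0<..}. exp (- (z / 2 * cosh t)) * ((cosh t)\<^sup>2 * cosh (\<mu> * t)))"
  have c1: "\<bar>cosh t * cosh (\<mu> * t)\<bar> \<le> 1 * exp ((1 + \<bar>\<mu>\<bar>) * t)" if "t > 0" for t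
    using mult_mono[OF cosh_le_exp[of t] cosh_mult_le_exp[of t \<mu>]] that
    by (simp add: abs_mult exp_add[symmetric] algebra_simps)
  have c2: "\<bar>(cosh t)\<^sup>2 * cosh (\<mu> * t)\<bar> \<le> 1 * exp ((2 + \<bar>\<mu>\<bar>) * t)" if "t > 0" for t
  proof -
    have "(cosh t)\<^sup>2 \<le> (exp t)\<^sup>2" using that by (intro power_mono cosh_le_exp) auto
    from mult_mono[OF this cosh_mult_le_exp[OF that, of \<mu>]] show ?thesis
      by (simp add: abs_mult exp_add[symmetric] algebra_simps flip: exp_of_nat_mult power_mult_distrib)
  qed
  have iJ: "set_integrable lborel {0<..} (\<lambda>t. exp (- (z * cosh t)) * (cosh t * cosh (\<mu> * t)))"
    by (rule set_integrable_exp_cosh_bound[OF z _ c1]) (auto intro!: continuous_intros)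
  have iB: "set_integrable lborel {0<..} (\<lambda>t. exp (- (z / 2 * cosh t)) * ((cosh t)\<^sup>2 * cosh (\<mu> * t)))"
    by (rule set_integrable_exp_cosh_bound[OF _ _ c2]) (use z in \<open>auto intro!: continuous_intros\<close>)
  have key: "\<bar>bessel_K \<mu> (z + h) - bessel_K \<mu> z + h * J\<bar> \<le> h\<^sup>2 * B" if h: "\<bar>h\<bar> \<le> z / 2" for h
  proof -
    have zh: "z + h > 0" using h z by (simp add: abs_le_iff)
    define g where "g = (\<lambda>t. exp (- (z + h) * cosh t) * cosh (\<mu> * t) - exp (- z * cosh t) * cosh (\<mu> * t)
                + h * (exp (- (z * cosh t)) * (cosh t * cosh (\<mu> * t))))"
    have ig: "set_integrable lborel {0<..} g" unfolding g_def
      by (intro set_integral_add set_integral_diff bessel_K_integrable set_integrable_mult_right iJ z zh)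
    have g_le: "\<bar>g t\<bar> \<le> h\<^sup>2 * (exp (- (z / 2 * cosh t)) * ((cosh t)\<^sup>2 * cosh (\<mu> * t)))" for t
    proof -
      let ?c = "cosh t"
      have "- (z + h) * ?c = - (z * ?c) + - (h * ?c)" by (simp add: algebra_simps)
      then have "exp (- (z + h) * ?c) = exp (- (z * ?c)) * exp (- (h * ?c))" by (simp only: exp_add)
      then have "g t = exp (- (z * ?c)) * (exp (- (h * ?c)) - 1 - (- (h * ?c))) * cosh (\<mu> * t)"
        by (simp add: g_def algebra_simps)
      then have "\<bar>g t\<bar> = exp (- (z * ?c)) * \<bar>exp (- (h * ?c)) - 1 - (- (h * ?c))\<bar> * cosh (\<mu> * t)"
        by (simp only: abs_mult abs_exp_cancel cosh_real_nonneg abs_of_nonneg)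
      also have "\<dots> \<le> exp (- (z * ?c)) * ((- (h * ?c))\<^sup>2 * exp \<bar>- (h * ?c)\<bar>) * cosh (\<mu> * t)"
        by (intro mult_right_mono mult_left_mono exp_remainder_le) auto
      also have "\<dots> = h\<^sup>2 * (exp (- (z * ?c) + \<bar>h\<bar> * ?c) * (?c\<^sup>2 * cosh (\<mu> * t)))"
        unfolding exp_add by (simp add: abs_mult power_mult_distrib)
      also have "\<dots> \<le> h\<^sup>2 * (exp (- (z / 2 * ?c)) * (?c\<^sup>2 * cosh (\<mu> * t)))"
      proof (intro mult_left_mono mult_right_mono)
        have "\<bar>h\<bar> * ?c \<le> z / 2 * ?c" using h by (intro mult_right_mono) auto
        then have "- (z * ?c) + \<bar>h\<bar> * ?c \<le> - (z / 2 * ?c)" by (simp add: field_simps)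
        then show "exp (- (z * ?c) + \<bar>h\<bar> * ?c) \<le> exp (- (z / 2 * ?c))" by (simp only: exp_le_cancel_iff)
      qed auto
      finally show ?thesis .
    qed
    have "bessel_K \<mu> (z + h) - bessel_K \<mu> z + h * J = set_lebesgue_integral lborel {0<..} g"
      unfolding bessel_K_def J_def g_def
      by (subst set_integral_add set_integral_diff,
          intro set_integral_diff bessel_K_integrable z zh,
          intro set_integrable_mult_right iJ,
          subst set_integral_diff, intro bessel_K_integrable zh, intro bessel_K_integrable z, simp)
    also have "\<bar>\<dots>\<bar> \<le> (LBINT t:{0<..}. norm (g t))"
      using set_integral_norm_bound[OF ig] by simp
    also have "\<dots> \<le> (LBINT t:{0<..}. h\<^sup>2 * (exp (- (z / 2 * cosh t)) * ((cosh t)\<^sup>2 * cosh (\<mu> * t))))"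
      by (rule set_integral_mono[OF set_integrable_norm[OF ig] set_integrable_mult_right[OF iB]])
        (use g_le in simp)
    also have "\<dots> = h\<^sup>2 * B" by (simp add: B_def)
    finally show ?thesis .
  qed
  have "((\<lambda>h. (bessel_K \<mu> (z + h) - bessel_K \<mu> z) / h - (- J)) \<longlongrightarrow> 0) (at 0)"
  proof (rule Lim_null_comparison)
    show "((\<lambda>h. \<bar>h\<bar> * B) \<longlongrightarrow> 0) (at 0)" by (rule tendsto_eq_intros refl | simp)+
    have "eventually (\<lambda>h::real. \<bar>h\<bar> < z / 2) (at 0)"
      using z by (auto simp: eventually_at dist_real_def intro!: exI[of _ "z/2"])
    moreover have "eventually (\<lambda>h::real. h \<noteq> 0) (at 0)" by (simp add: eventually_at_filter)
    ultimately show "eventually (\<lambda>h. norm ((bessel_K \<mu> (z + h) - bessel_K \<mu> z) / h - (- J)) \<le> \<bar>h\<bar> * B) (at 0)"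
    proof eventually_elim
      case (elim h)
      have "(bessel_K \<mu> (z + h) - bessel_K \<mu> z) / h - (- J) = (bessel_K \<mu> (z + h) - bessel_K \<mu> z + h * J) / h"
        using elim by (simp add: field_simps)
      also have "\<bar>\<dots>\<bar> \<le> h\<^sup>2 * B / \<bar>h\<bar>"
        using key[of h] elim by (simp add: divide_right_mono)
      also have "\<dots> = \<bar>h\<bar> * B" using elim by (simp add: power2_eq_square field_simps abs_if)
      finally show ?case by simp
    qed
  qed
  then show ?thesis unfolding DERIV_def by (rule LIM_zero_cancel)
qed

text \<open>The addition formula for \<open>cosh ((\<mu> + 1) * t)\<close> gives
  \<open>bessel_K (\<mu> + 1) z = J + S\<close>, where \<open>- J\<close> is the derivative by
  \<open>bessel_K_shift_integral\<close>. Integration by parts gives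
  \<open>z * S = \<mu> * bessel_K \<mu> z\<close>; eliminating \<open>S\<close> leaves the classical
  recurrence.\<close>

lemma bessel_K_deriv:
  fixes z \<mu> :: real
  assumes z: "z > 0"
  shows "(bessel_K \<mu> has_real_derivative (\<mu> / z * bessel_K \<mu> z - bessel_K (\<mu> + 1) z)) (at z)"
proof -
  define J where "J = (LBINT t:{0<..}. exp (- (z * cosh t)) * (cosh t * cosh (\<mu> * t)))"
  define S where "S = (LBINT t:{0<..}. exp (- (z * cosh t)) * (sinh t * sinh (\<mu> * t)))"
  have c1: "\<bar>cosh t * cosh (\<mu> * t)\<bar> \<le> 1 * exp ((1 + \<bar>\<mu>\<bar>) * t)" if "t > 0" for t
    using mult_mono[OF cosh_le_exp[of t] cosh_mult_le_exp[of t \<mu>]] that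
    by (simp add: abs_mult exp_add[symmetric] algebra_simps)
  have sc: "\<bar>sinh x\<bar> \<le> cosh x" for x :: real by (simp add: sinh_def cosh_def abs_le_iff)
  have c2: "\<bar>sinh t * sinh (\<mu> * t)\<bar> \<le> 1 * exp ((1 + \<bar>\<mu>\<bar>) * t)" if "t > 0" for t
    using order_trans[OF mult_mono[OF sc[of t] sc[of "\<mu> * t"]], of "1 * exp ((1 + \<bar>\<mu>\<bar>) * t)"] c1[OF that]
    by (simp add: abs_mult)
  have iJ: "set_integrable lborel {0<..} (\<lambda>t. exp (- (z * cosh t)) * (cosh t * cosh (\<mu> * t)))"
    by (rule set_integrable_exp_cosh_bound[OF z _ c1]) (auto intro!: continuous_intros)
  have iS: "set_integrable lborel {0<..} (\<lambda>t. exp (- (z * cosh t)) * (sinh t * sinh (\<mu> * t)))"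
    by (rule set_integrable_exp_cosh_bound[OF z _ c2]) (auto intro!: continuous_intros)
  have iK: "set_integrable lborel {0<..} (\<lambda>t. exp (- (z * cosh t)) * cosh (\<mu> * t))"
    using bessel_K_integrable[OF z] by simp
  have "cosh ((\<mu> + 1) * t) = cosh t * cosh (\<mu> * t) + sinh t * sinh (\<mu> * t)" for t
    by (simp add: ring_distribs cosh_add mult.commute)
  then have "bessel_K (\<mu> + 1) z = (LBINT t:{0<..}. exp (- (z * cosh t)) * (cosh t * cosh (\<mu> * t)) +
      exp (- (z * cosh t)) * (sinh t * sinh (\<mu> * t)))"
    unfolding bessel_K_def by (simp add: ring_distribs)
  also have "\<dots> = J + S" unfolding J_def S_def by (rule set_integral_add[OF iJ iS])
  finally have KJS: "bessel_K (\<mu> + 1) z = J + S" .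
  \<comment> \<open>\<open>?f\<close> is the derivative of \<open>?F\<close>, and \<open>?F\<close>
    vanishes at both ends: at 0 through \<open>sinh\<close>, at infinity through
    \<open>exp_cosh_le\<close> with a rate one above \<open>\<bar>\<mu>\<bar>\<close>.\<close>
  let ?F = "\<lambda>t. - (exp (- (z * cosh t)) * sinh (\<mu> * t))"
  let ?f = "\<lambda>t. z * (exp (- (z * cosh t)) * (sinh t * sinh (\<mu> * t))) - \<mu> * (exp (- (z * cosh t)) * cosh (\<mu> * t))"
  have "(LBINT t:{0<..}. ?f t) = 0 - 0"
  proof (rule set_integral_FTC_Ioi_integrable)
    show "(?F has_real_derivative ?f t) (at t)" for t
      by (auto intro!: derivative_eq_intros simp: algebra_simps)
    show "isCont ?f t" for t by (intro continuous_intros)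
    show "set_integrable lborel {0<..} ?f"
      by (intro set_integral_diff set_integrable_mult_right iS iK)
    have "(?F \<longlongrightarrow> - (exp (- (z * cosh 0)) * sinh (\<mu> * 0))) (at_right 0)" by (intro tendsto_intros)
    then show "(?F \<longlongrightarrow> 0) (at_right 0)" by simp
    define N where "N = \<bar>\<mu>\<bar> + 1"
    show "(?F \<longlongrightarrow> 0) at_top"
    proof (rule Lim_null_comparison)
      show "((\<lambda>t. (2 * N / z) powr N * exp (- t)) \<longlongrightarrow> 0) at_top" by real_asymp
      show "eventually (\<lambda>t. norm (?F t) \<le> (2 * N / z) powr N * exp (- t)) at_top"
        using eventually_gt_at_top[of 0]
      proof eventually_elim
        case (elim t)
        have "norm (?F t) \<le> exp (- (z * cosh t)) * cosh (\<mu> * t)" using sc by (simp add: abs_mult)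
        also have "\<dots> \<le> ((2 * N / z) powr N * exp (- (N * t))) * exp (\<bar>\<mu>\<bar> * t)"
          using elim z by (intro mult_mono exp_cosh_le cosh_mult_le_exp) (auto simp: N_def)
        also have "\<dots> = (2 * N / z) powr N * exp (- t)"
          by (simp add: mult.assoc exp_add[symmetric]) (simp add: N_def algebra_simps)
        finally show ?case .
      qed
    qed
  qed
  moreover have "(LBINT t:{0<..}. ?f t) = z * S - \<mu> * bessel_K \<mu> z"
    by (subst set_integral_diff, intro set_integrable_mult_right iS, intro set_integrable_mult_right iK)
      (simp add: S_def bessel_K_def)
  ultimately have "S = \<mu> / z * bessel_K \<mu> z" using z by (simp add: field_simps)
  with KJS have "- J = \<mu> / z * bessel_K \<mu> z - bessel_K (\<mu> + 1) z" by simp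
  with bessel_K_shift_integral[OF z, of \<mu>] show ?thesis by (simp add: J_def)
qed

section \<open>Asymptotics of the Bessel function for large argument\<close>

text \<open>This is \<open>sqrt (pi / 2)\<close>, the constant in the classical law that K at
  \<open>z\<close> behaves like \<open>sqrt (pi / (2 * z)) * exp (- z)\<close>. It enters the final
  constant as a positive factor.\<close>

definition gauss_const :: real where "gauss_const = (LBINT t:{0<..}. exp (- (t\<^sup>2 / 2)))"

text \<open>Completing the square, \<open>(t - (q + 1))\<^sup>2 \<ge> 0\<close>, leaves the majorant
  \<open>exp (- t)\<close> up to a constant.\<close>

lemma gauss_integrable: "set_integrable lborel {0<..} (\<lambda>t. exp (- (t\<^sup>2 / 2)) * exp (q * t))" for q :: real
proof (rule set_integrable_bound)
  show "set_integrable lborel {0<..} (\<lambda>t. exp ((q + 1)\<^sup>2 / 2) * exp (- (1 * t)))"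
    by (intro set_integrable_mult_right set_integral_exp_decay) auto
  show "set_borel_measurable lborel {0<..} (\<lambda>t. exp (- (t\<^sup>2 / 2)) * exp (q * t))"
    by (intro set_borel_measurable_continuous_lborel continuous_intros) auto
  have "- (t\<^sup>2 / 2) + q * t \<le> (q + 1)\<^sup>2 / 2 + - t" for t :: real
    using zero_le_power2[of "t - (q + 1)"] by (simp add: power2_eq_square field_simps)
  then show "AE t in lborel. t \<in> {0<..} \<longrightarrow> norm (exp (- (t\<^sup>2 / 2)) * exp (q * t)) \<le>
      norm (exp ((q + 1)\<^sup>2 / 2) * exp (- (1 * t)))"
    by (auto simp: exp_add[symmetric])
qed

lemma gauss_const_pos: "gauss_const > 0"
proof -
  have int: "set_integrable lborel {0<..<1::real} (\<lambda>t. exp (- (t\<^sup>2 / 2)))"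
    by (rule set_integrable_subset[of _ "{0<..}"]) (use gauss_integrable[of 0] in auto)
  have "0 < (LBINT t:{0<..<1::real}. exp (- 1 / 2 :: real))" by (simp add: set_lebesgue_integral_def)
  also have "\<dots> \<le> (LBINT t:{0<..<1::real}. exp (- (t\<^sup>2 / 2)))"
  proof (rule set_integral_mono)
    show "set_integrable lborel {0<..<1::real} (\<lambda>t. exp (- (t\<^sup>2 / 2)))" by (rule int)
    fix t :: real assume "t \<in> {0<..<1}"
    then have "t\<^sup>2 \<le> 1\<^sup>2" by (intro power_mono) auto
    then show "exp (- 1 / 2) \<le> exp (- (t\<^sup>2 / 2))" by simp
  qed (simp add: set_integrable_def)
  also have "\<dots> \<le> gauss_const"
    unfolding gauss_const_def set_lebesgue_integral_def
    using int gauss_integrable[of 0]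
    by (intro integral_mono) (auto simp: set_integrable_def indicator_def)
  finally show ?thesis .
qed

lemma le_sinh:
  fixes x :: real assumes "x \<ge> 0" shows "x \<le> sinh x"
proof -
  have "sinh 0 - 0 \<le> sinh x - x"
  proof (rule DERIV_nonneg_imp_nondecreasing[OF assms])
    fix y :: real
    have "((\<lambda>x. sinh x - x) has_real_derivative cosh y - 1) (at y)"
      by (auto intro!: derivative_eq_intros)
    then show "\<exists>d. ((\<lambda>x. sinh x - x) has_real_derivative d) (at y) \<and> 0 \<le> d"
      using cosh_real_ge_1[of y] by (intro exI[of _ "cosh y - 1"]) auto
  qed
  then show ?thesis by simp
qed

lemma cosh_minus_one_eq: "cosh x - 1 = 2 * (sinh (x / 2))\<^sup>2" for x :: real
  using cosh_add[of "x / 2" "x / 2"] cosh_square_eq[of "x / 2"] by (simp add: power2_eq_square)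

text \<open>The half-angle formula combined with \<open>le_sinh\<close>. This is what dominates the
  rescaled integrand of \<open>bessel_K_asymp\<close> by a Gaussian.\<close>

lemma cosh_ge_quadratic: "1 + x\<^sup>2 / 2 \<le> cosh x" for x :: real
proof -
  have "(\<bar>x\<bar> / 2)\<^sup>2 \<le> (sinh (\<bar>x\<bar> / 2))\<^sup>2" by (intro power_mono le_sinh) auto
  then show ?thesis using cosh_minus_one_eq[of "\<bar>x\<bar>"] by (simp add: power_divide)
qed

text \<open>Laplace's method: after the substitution of \<open>t / sqrt z\<close> for
  \<open>t\<close>, the exponent \<open>z * (cosh (t / sqrt z) - 1)\<close> tends to
  \<open>t\<^sup>2 / 2\<close> and is bounded below by it, so dominated convergence applies with the
  majorant of \<open>gauss_integrable\<close>. The order enters only through a factor tending to 1,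
  hence the limit does not depend on \<open>\<mu>\<close>.\<close>

lemma bessel_K_asymp:
  fixes \<mu> :: real
  shows "((\<lambda>z. sqrt z * exp z * bessel_K \<mu> z) \<longlongrightarrow> gauss_const) at_top"
proof -
  let ?s = "\<lambda>z t. indicator {0<..} t * (exp (- (z * (cosh (t / sqrt z) - 1))) * cosh (\<mu> * t / sqrt z)) :: real"
  have "((\<lambda>z. LINT t|lborel. ?s z t) \<longlongrightarrow> (LINT t|lborel. indicator {0<..} t * exp (- (t\<^sup>2 / 2)))) at_top"
  proof (rule integral_dominated_convergence_at_top)
    show "integrable lborel (\<lambda>t. indicator {0<..} t * (exp (- (t\<^sup>2 / 2)) * exp (\<bar>\<mu>\<bar> * t)))"
      using gauss_integrable[of "\<bar>\<mu>\<bar>"] by (simp add: set_integrable_def)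
    show "AE t in lborel. ((\<lambda>z. ?s z t) \<longlongrightarrow> indicator {0<..} t * exp (- (t\<^sup>2 / 2))) at_top"
    proof (intro AE_I2)
      fix t :: real
      have "((\<lambda>z. z * (cosh (t / sqrt z) - 1)) \<longlongrightarrow> t\<^sup>2 / 2) at_top"
        unfolding cosh_field_def by (real_asymp simp: power2_eq_square)
      moreover have "((\<lambda>z. cosh (\<mu> * t / sqrt z)) \<longlongrightarrow> 1) at_top"
        unfolding cosh_field_def by real_asymp
      ultimately have "((\<lambda>z. ?s z t) \<longlongrightarrow> indicator {0<..} t * (exp (- (t\<^sup>2 / 2)) * 1)) at_top"
        by (intro tendsto_intros)
      then show "((\<lambda>z. ?s z t) \<longlongrightarrow> indicator {0<..} t * exp (- (t\<^sup>2 / 2))) at_top" by simp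
    qed
    show "eventually (\<lambda>z. AE t in lborel. norm (?s z t) \<le>
        indicator {0<..} t * (exp (- (t\<^sup>2 / 2)) * exp (\<bar>\<mu>\<bar> * t))) at_top"
      using eventually_ge_at_top[of 1]
    proof eventually_elim
      case (elim z)
      show ?case
      proof (intro AE_I2)
        fix t :: real
        show "norm (?s z t) \<le> indicator {0<..} t * (exp (- (t\<^sup>2 / 2)) * exp (\<bar>\<mu>\<bar> * t))"
        proof (cases "t > 0")
          case True
          let ?x = "t / sqrt z"
          have x: "?x > 0" using True elim by simp
          have "1 + ?x\<^sup>2 / 2 \<le> cosh ?x" by (rule cosh_ge_quadratic)
          then have "t\<^sup>2 / 2 \<le> z * (cosh ?x - 1)"
            using elim by (simp add: power_divide field_simps)
          moreover have "cosh (\<mu> * ?x) \<le> exp (\<bar>\<mu>\<bar> * t)"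
          proof -
            have "cosh (\<mu> * ?x) \<le> exp (\<bar>\<mu>\<bar> * ?x)" by (rule cosh_mult_le_exp[OF x])
            also have "t / sqrt z \<le> t / 1" using elim True by (intro divide_left_mono) auto
            then have "\<bar>\<mu>\<bar> * ?x \<le> \<bar>\<mu>\<bar> * t" by (intro mult_left_mono) auto
            then have "exp (\<bar>\<mu>\<bar> * ?x) \<le> exp (\<bar>\<mu>\<bar> * t)" by simp
            finally show ?thesis .
          qed
          ultimately show ?thesis using True by (auto simp: indicator_def intro!: mult_mono)
        qed auto
      qed
    qed
  qed auto
  then have L: "((\<lambda>z. LINT t|lborel. ?s z t) \<longlongrightarrow> gauss_const) at_top"
    by (simp add: gauss_const_def set_lebesgue_integral_def)
  show ?thesis
  proof (rule Lim_transform_eventually[OF L])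
    show "eventually (\<lambda>z. (LINT t|lborel. ?s z t) = sqrt z * exp z * bessel_K \<mu> z) at_top"
      using eventually_gt_at_top[of 0]
    proof eventually_elim
      case (elim z)
      have "bessel_K \<mu> z = (LINT t|lborel. indicator {0<..} t * (exp (- z * cosh t) * cosh (\<mu> * t)))"
        by (simp add: bessel_K_def set_lebesgue_integral_def)
      also have "\<dots> = \<bar>1 / sqrt z\<bar> *\<^sub>R (LINT t|lborel. indicator {0<..} (0 + 1 / sqrt z * t) *
          (exp (- z * cosh (0 + 1 / sqrt z * t)) * cosh (\<mu> * (0 + 1 / sqrt z * t))))"
        by (rule lborel_integral_real_affine) (use elim in auto)
      also have "(LINT t|lborel. indicator {0<..} (0 + 1 / sqrt z * t) *
          (exp (- z * cosh (0 + 1 / sqrt z * t)) * cosh (\<mu> * (0 + 1 / sqrt z * t)))) =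
          (LINT t|lborel. exp (- z) * ?s z t)"
      proof (intro Bochner_Integration.integral_cong refl)
        fix t
        have "exp (- z * cosh (t / sqrt z)) = exp (- z) * exp (- (z * (cosh (t / sqrt z) - 1)))"
          by (simp add: exp_add[symmetric] right_diff_distrib)
        then show "indicator {0<..} (0 + 1 / sqrt z * t) *
          (exp (- z * cosh (0 + 1 / sqrt z * t)) * cosh (\<mu> * (0 + 1 / sqrt z * t))) = exp (- z) * ?s z t"
          using elim by (simp add: indicator_def zero_less_divide_iff)
      qed
      finally show ?case using elim by (simp add: exp_minus field_simps)
    qed
  qed
qed

section \<open>Iterated derivatives of the kernel profile\<close>

text \<open>\<open>kernel_profile n s p\<close> is the instance \<open>a = (n - 1) / 2\<close>,
  \<open>\<mu> = (1 + s * p) / 2\<close>. With the order as a free parameter the family is closed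
  under differentiation, up to the factor \<open>- a * \<rho>\<close>.\<close>

definition bessel_profile :: "real \<Rightarrow> real \<Rightarrow> real \<Rightarrow> real" where
  "bessel_profile a \<mu> \<rho> = \<rho> powr (- \<mu>) * bessel_K \<mu> (a * \<rho>)"

text \<open>In the product rule the term \<open>\<mu> / z * bessel_K \<mu> z\<close> of
  \<open>bessel_K_deriv\<close> cancels the derivative of the power, so a single term of the next
  order remains.\<close>

lemma bessel_profile_deriv:
  assumes "a > 0" "\<rho> > 0"
  shows "(bessel_profile a \<mu> has_real_derivative - (a * \<rho> * bessel_profile a (\<mu> + 1) \<rho>)) (at \<rho>)"
proof -
  have "((\<lambda>\<rho>. bessel_K \<mu> (a * \<rho>)) has_real_derivative
      (\<mu> / (a * \<rho>) * bessel_K \<mu> (a * \<rho>) - bessel_K (\<mu> + 1) (a * \<rho>)) * a) (at \<rho>)"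
    by (rule DERIV_chain2[OF bessel_K_deriv]) (use assms in \<open>auto intro!: derivative_eq_intros\<close>)
  moreover have "((\<lambda>\<rho>. \<rho> powr (- \<mu>)) has_real_derivative (- \<mu> * \<rho> powr (- \<mu> - 1))) (at \<rho>)"
    using assms by (auto intro!: derivative_eq_intros)
  ultimately have D: "((\<lambda>\<rho>. \<rho> powr (- \<mu>) * bessel_K \<mu> (a * \<rho>)) has_real_derivative
      (- \<mu> * \<rho> powr (- \<mu> - 1)) * bessel_K \<mu> (a * \<rho>) +
      ((\<mu> / (a * \<rho>) * bessel_K \<mu> (a * \<rho>) - bessel_K (\<mu> + 1) (a * \<rho>)) * a) * \<rho> powr (- \<mu>)) (at \<rho>)"
    by (rule DERIV_mult[rotated])
  have p: "\<rho> powr (- \<mu> - 1) = \<rho> powr (- \<mu>) / \<rho>" "\<rho> powr (- (\<mu> + 1)) = \<rho> powr (- \<mu>) / \<rho>"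
    using assms by (simp_all add: powr_diff)
  show ?thesis
    unfolding bessel_profile_def[abs_def] p
    by (rule DERIV_cong[OF D], unfold p) (use assms in \<open>simp add: field_simps\<close>)
qed

lemma bessel_profile_nonneg: "0 \<le> bessel_profile a \<mu> \<rho>"
  by (simp add: bessel_profile_def bessel_K_nonneg)

text \<open>
  The exponents \<open>i, l, j\<close> are real, although only integers occur: this way the derivative formula
  needs no case distinction at exponent \<open>0\<close>.
\<close>

definition kmono :: "real \<Rightarrow> real \<Rightarrow> real \<times> real \<times> real \<times> nat \<Rightarrow> real \<Rightarrow> real" where
  "kmono a \<nu> = (\<lambda>(i, l, j, k) \<rho>.
     \<rho> powr i * cosh \<rho> powr l * sinh \<rho> powr j * bessel_profile a (\<nu> + real k) \<rho>)"

text \<open>Linear combinations of monomials are stored as lists of coefficients and exponents, so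
  that differentiation becomes an operation on these data in which \<open>\<nu>\<close> does not
  occur.\<close>

definition kval :: "real \<Rightarrow> real \<Rightarrow> (real \<times> real \<times> real \<times> real \<times> nat) list \<Rightarrow> real \<Rightarrow> real" where
  "kval a \<nu> ts \<rho> = (\<Sum>(c, e) \<leftarrow> ts. c * kmono a \<nu> e \<rho>)"

text \<open>The product rule for \<open>- 1 / sinh\<close> times the derivative, one entry for each
  of the four factors. The factor \<open>sinh\<close> produced by differentiating
  \<open>cosh\<close> cancels the denominator, whereas differentiating \<open>sinh\<close> costs two
  powers of it. The last sign is positive because \<open>bessel_profile_deriv\<close> supplies a
  second minus.\<close>

fun dstep :: "real \<Rightarrow> real \<times> real \<times> real \<times> real \<times> nat \<Rightarrow> (real \<times> real \<times> real \<times> real \<times> nat) list" where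
  "dstep a (c, i, l, j, k) =
     [(- c * i, i - 1, l, j - 1, k), (- c * l, i, l - 1, j, k),
      (- c * j, i, l + 1, j - 2, k), (c * a, i + 1, l, j - 1, k + 1)]"

fun kterms :: "real \<Rightarrow> nat \<Rightarrow> (real \<times> real \<times> real \<times> real \<times> nat) list" where
  "kterms a 0 = [(1, 0, 0, 0, 0)]"
| "kterms a (Suc m) = concat (map (dstep a) (kterms a m))"

lemma kval_simps [simp]:
  "kval a \<nu> [] \<rho> = 0"
  "kval a \<nu> ((c, e) # ts) \<rho> = c * kmono a \<nu> e \<rho> + kval a \<nu> ts \<rho>"
  "kval a \<nu> (ts @ us) \<rho> = kval a \<nu> ts \<rho> + kval a \<nu> us \<rho>"
  by (simp_all add: kval_def)

lemma kmono_deriv: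
  assumes "a > 0" "\<rho> > 0"
  shows "(kmono a \<nu> (i, l, j, k) has_real_derivative - (sinh \<rho> * kval a \<nu> (dstep a (1, i, l, j, k)) \<rho>)) (at \<rho>)"
proof -
  have s: "sinh \<rho> > 0" using assms by simp
  have c: "cosh \<rho> > 0" by (rule cosh_real_pos)
  have 1: "((\<lambda>\<rho>. \<rho> powr i) has_real_derivative i * \<rho> powr (i - 1)) (at \<rho>)"
    using assms by (auto intro!: derivative_eq_intros)
  have 2: "((\<lambda>\<rho>. cosh \<rho> powr l) has_real_derivative (l * cosh \<rho> powr (l - 1)) * sinh \<rho>) (at \<rho>)"
    by (rule DERIV_chain2[where g = cosh]) (use c in \<open>auto intro!: derivative_eq_intros\<close>)
  have 3: "((\<lambda>\<rho>. sinh \<rho> powr j) has_real_derivative (j * sinh \<rho> powr (j - 1)) * cosh \<rho>) (at \<rho>)"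
    by (rule DERIV_chain2[where g = sinh]) (use s in \<open>auto intro!: derivative_eq_intros\<close>)
  \<comment> \<open>Rewriting all powers of \<open>sinh\<close> over the lowest one,
    \<open>j - 2\<close>, makes the comparison of both derivatives a polynomial identity without
    division.\<close>
  have 4: "sinh \<rho> powr (j - 1) = sinh \<rho> powr (j - 2) * sinh \<rho>"
    using s by (simp add: powr_diff powr_numeral power2_eq_square)
  have 5: "sinh \<rho> powr j = sinh \<rho> powr (j - 2) * (sinh \<rho> * sinh \<rho>)"
    using s by (simp add: powr_diff powr_numeral power2_eq_square)
  have 6: "cosh \<rho> powr (l + 1) = cosh \<rho> powr l * cosh \<rho>" using c by (simp add: powr_add)
  have 7: "\<rho> powr (i + 1) = \<rho> powr i * \<rho>" using assms by (simp add: powr_add)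
  show ?thesis unfolding kmono_def prod.case
    by (rule DERIV_cong[OF DERIV_mult[OF DERIV_mult[OF DERIV_mult[OF 1 2] 3] bessel_profile_deriv[OF assms]]])
      (simp only: kval_simps dstep.simps kmono_def prod.case 4 5 6 7 of_nat_add of_nat_1 add.assoc,
       simp add: algebra_simps)
qed

lemma kval_dstep: "kval a \<nu> (dstep a (c, e)) \<rho> = c * kval a \<nu> (dstep a (1, e)) \<rho>"
  by (cases e) (simp add: algebra_simps)

lemma kval_deriv:
  assumes "a > 0" "\<rho> > 0"
  shows "(kval a \<nu> ts has_real_derivative - (sinh \<rho> * kval a \<nu> (concat (map (dstep a) ts)) \<rho>)) (at \<rho>)"
proof (induction ts)
  case Nil
  then show ?case by (simp add: kval_def[abs_def])
next
  case (Cons t ts)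
  obtain c i l j k where t: "t = (c, i, l, j, k)" by (cases t)
  have "((\<lambda>\<rho>. c * kmono a \<nu> (i, l, j, k) \<rho> + kval a \<nu> ts \<rho>) has_real_derivative
     c * - (sinh \<rho> * kval a \<nu> (dstep a (1, i, l, j, k)) \<rho>) +
      - (sinh \<rho> * kval a \<nu> (concat (map (dstep a) ts)) \<rho>)) (at \<rho>)"
    by (intro DERIV_add DERIV_cmult kmono_deriv assms Cons.IH)
  moreover have "c * - (sinh \<rho> * kval a \<nu> (dstep a (1, i, l, j, k)) \<rho>) +
      - (sinh \<rho> * kval a \<nu> (concat (map (dstep a) ts)) \<rho>) =
      - (sinh \<rho> * kval a \<nu> (concat (map (dstep a) (t # ts))) \<rho>)"
    unfolding t list.map concat.simps kval_simps kval_dstep[of a \<nu> c]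
    by (simp add: algebra_simps del: dstep.simps)
  moreover have "(\<lambda>\<rho>. c * kmono a \<nu> (i, l, j, k) \<rho> + kval a \<nu> ts \<rho>) = kval a \<nu> (t # ts)"
    by (simp add: t fun_eq_iff)
  ultimately show ?case by simp
qed

lemma sinh_deriv_iterate:
  assumes "a > 0" "\<rho> > 0"
  shows "(sinh_deriv ^^ m) (bessel_profile a \<nu>) \<rho> = kval a \<nu> (kterms a m) \<rho>"
  using assms(2)
proof (induction m arbitrary: \<rho>)
  case 0
  then show ?case by (simp add: kmono_def)
next
  case (Suc m)
  \<comment> \<open>\<open>deriv\<close> sees only the germ at \<open>\<rho>\<close>, so the
    induction hypothesis is needed on a neighbourhood; the open half-line provides it.\<close>
  have "eventually (\<lambda>x. x > 0) (nhds \<rho>)"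
    using eventually_nhds_in_open[of "{0<..}" \<rho>] Suc.prems by simp
  then have "eventually (\<lambda>x. (sinh_deriv ^^ m) (bessel_profile a \<nu>) x = kval a \<nu> (kterms a m) x) (nhds \<rho>)"
    by (rule eventually_mono) (rule Suc.IH)
  then have "deriv ((sinh_deriv ^^ m) (bessel_profile a \<nu>)) \<rho> = deriv (kval a \<nu> (kterms a m)) \<rho>"
    by (rule deriv_cong_ev) simp
  also have "\<dots> = - (sinh \<rho> * kval a \<nu> (kterms a (Suc m)) \<rho>)"
    using kval_deriv[OF assms(1) Suc.prems, of \<nu> "kterms a m"] by (simp only: DERIV_imp_deriv kterms.simps)
  finally have "sinh_deriv ((sinh_deriv ^^ m) (bessel_profile a \<nu>)) \<rho> = kval a \<nu> (kterms a (Suc m)) \<rho>"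
    using Suc.prems unfolding sinh_deriv_def by (simp del: kterms.simps)
  then show ?case by simp
qed

lemma kval_continuous_on:
  assumes "a > 0" shows "continuous_on {0<..} (kval a \<nu> ts)"
proof (rule continuous_at_imp_continuous_on, rule ballI)
  fix \<rho> :: real assume "\<rho> \<in> {0<..}"
  then show "isCont (kval a \<nu> ts) \<rho>" using DERIV_isCont[OF kval_deriv[OF assms]] by auto
qed

text \<open>Three invariants of \<open>dstep\<close>, one for each regime: \<open>i \<le> k\<close>
  limits the polynomial order at infinity, \<open>j + l = - m\<close> fixes the exponential rate
  there, and the third says that each step costs at most two powers of \<open>\<rho>\<close> at
  0.\<close>

lemma kterms_exponents:
  "(c, i, l, j, k) \<in> set (kterms a m) \<Longrightarrow> i \<le> real k \<and> j + l = - real m \<and> - 2 * real m \<le> i + j - 2 * real k"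
proof (induction m arbitrary: c i l j k)
  case (Suc m)
  from Suc.prems obtain t where "t \<in> set (kterms a m)" "(c, i, l, j, k) \<in> set (dstep a t)" by auto
  moreover obtain c' i' l' j' k' where t: "t = (c', i', l', j', k')" by (cases t)
  ultimately have IH: "i' \<le> real k'" "j' + l' = - real m" "- 2 * real m \<le> i' + j' - 2 * real k'"
    and "(i, l, j, k) \<in> {(i' - 1, l', j' - 1, k'), (i', l' - 1, j', k'), (i', l' + 1, j' - 2, k'), (i' + 1, l', j' - 1, k' + 1)}"
    using Suc.IH[of c' i' l' j' k'] by auto
  from this(4) show ?case unfolding insert_iff prod.inject empty_iff
    by (elim disjE conjE FalseE) (use IH in simp_all)
qed simp

text \<open>A monomial decays at infinity like \<open>\<rho> powr (i - k - \<nu> - 1 / 2)\<close>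
  times an exponential common to all of them, so the terms with \<open>i = k\<close> dominate; this
  is their total coefficient.\<close>

definition klead :: "(real \<times> real \<times> real \<times> real \<times> nat) list \<Rightarrow> real" where
  "klead ts = (\<Sum>(c, i, l, j, k) \<leftarrow> ts. if i = real k then c else 0)"

text \<open>A leading term \<open>c\<close> passes on \<open>- c * l\<close> and
  \<open>- c * j\<close> with \<open>i\<close> unchanged, together \<open>c * b\<close>, and
  \<open>c * a\<close> with both \<open>i\<close> and \<open>k\<close> raised; its first entry drops
  out. A term with \<open>i < k\<close> never becomes leading, since no entry of
  \<open>dstep\<close> raises \<open>i - k\<close>.\<close>

lemma klead_step:
  assumes "\<And>c i l j k. (c, i, l, j, k) \<in> set ts \<Longrightarrow> i \<le> real k \<and> j + l = - b"
  shows "klead (concat (map (dstep a) ts)) = (a + b) * klead ts"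
  using assms
proof (induction ts)
  case (Cons t ts)
  obtain c i l j k where t: "t = (c, i, l, j, k)" by (cases t)
  have "i \<le> real k" and jl: "b = - j - l" using Cons.prems[of c i l j k] by (auto simp: t)
  have "klead (dstep a t) = (if i = real k then (a + b) * c else 0)"
  proof (cases "i = real k")
    case True
    then show ?thesis unfolding jl by (simp add: klead_def t) (simp add: algebra_simps)
  next
    case False
    with \<open>i \<le> real k\<close> have "i - 1 \<noteq> real k" by simp
    with False show ?thesis by (simp add: klead_def t)
  qed
  moreover have "klead (concat (map (dstep a) ts)) = (a + b) * klead ts"
  proof (rule Cons.IH)
    show "i \<le> real k \<and> j + l = - b" if "(c, i, l, j, k) \<in> set ts" for c i l j k
      using Cons.prems[of c i l j k] that by simp
  qed
  moreover have "klead (xs @ ys) = klead xs + klead ys" for xs ys by (simp add: klead_def)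
  moreover have "klead (t # ts) = (if i = real k then c else 0) + klead ts" by (simp add: klead_def t)
  ultimately show ?case by (simp add: algebra_simps)
qed (simp add: klead_def)

text \<open>By \<open>klead_step\<close> the value is the product of \<open>a + j\<close> over
  \<open>j < m\<close>: the leading terms cannot cancel.\<close>

lemma klead_kterms_pos:
  assumes "a > 0" shows "klead (kterms a m) > 0"
proof (induction m)
  case 0 show ?case by (simp add: klead_def)
next
  case (Suc m)
  have "klead (kterms a (Suc m)) = (a + real m) * klead (kterms a m)"
    unfolding kterms.simps by (rule klead_step) (use kterms_exponents in blast)
  then show ?case using Suc assms by simp
qed

text \<open>The order moves along the filter. Monotonicity in the order encloses the expression
  between the fixed orders \<open>k\<close> and \<open>B + k\<close>, and both bounds have the same
  limit by \<open>bessel_K_asymp\<close>.\<close>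

lemma bessel_profile_asymp:
  fixes \<nu> r :: "'x \<Rightarrow> real"
  assumes a: "a > 0" and \<nu>: "eventually (\<lambda>x. 0 \<le> \<nu> x \<and> \<nu> x \<le> B) F" and r: "filterlim r at_top F"
  shows "((\<lambda>x. bessel_profile a (\<nu> x + real k) (r x) * r x powr (\<nu> x + real k + 1 / 2) * exp (a * r x))
            \<longlongrightarrow> gauss_const / sqrt a) F"
proof -
  have lim: "((\<lambda>x. sqrt (a * r x) * exp (a * r x) * bessel_K \<mu> (a * r x) / sqrt a) \<longlongrightarrow> gauss_const / sqrt a) F" for \<mu>
  proof -
    have "filterlim (\<lambda>x. a * r x) at_top F"
      using a by (intro filterlim_tendsto_pos_mult_at_top[OF tendsto_const _ r])
    from filterlim_compose[OF bessel_K_asymp[of \<mu>] this]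
    show ?thesis using a by (intro tendsto_divide tendsto_const) auto
  qed
  have pos: "eventually (\<lambda>x. r x > 0) F"
    using filterlim_at_top_dense[of r F] r by blast
  have eq: "bessel_profile a \<mu> \<rho> * \<rho> powr (\<mu> + 1 / 2) * exp (a * \<rho>) =
      sqrt (a * \<rho>) * exp (a * \<rho>) * bessel_K \<mu> (a * \<rho>) / sqrt a" if "\<rho> > 0" for \<mu> \<rho>
  proof -
    have "\<rho> powr (\<mu> + 1 / 2) = \<rho> powr \<mu> * sqrt \<rho>" "\<rho> powr (- \<mu>) = 1 / \<rho> powr \<mu>"
      using that by (simp_all only: powr_add powr_minus_divide, simp add: powr_half_sqrt)
    then show ?thesis
      using that a by (simp add: bessel_profile_def real_sqrt_mult)
  qed
  show ?thesis
  proof (rule tendsto_sandwich[OF _ _ lim[of "real k"] lim[of "B + real k"]])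
    show "eventually (\<lambda>x. sqrt (a * r x) * exp (a * r x) * bessel_K (real k) (a * r x) / sqrt a \<le>
      bessel_profile a (\<nu> x + real k) (r x) * r x powr (\<nu> x + real k + 1 / 2) * exp (a * r x)) F"
      using \<nu> pos
    proof eventually_elim
      case (elim x)
      then show ?case unfolding eq[OF elim(2)]
        using a by (intro divide_right_mono mult_left_mono bessel_K_mono) auto
    qed
    show "eventually (\<lambda>x. bessel_profile a (\<nu> x + real k) (r x) * r x powr (\<nu> x + real k + 1 / 2) * exp (a * r x)
      \<le> sqrt (a * r x) * exp (a * r x) * bessel_K (B + real k) (a * r x) / sqrt a) F"
      using \<nu> pos
    proof eventually_elim
      case (elim x)
      then show ?case unfolding eq[OF elim(2)]
        using a by (intro divide_right_mono mult_left_mono bessel_K_mono) auto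
    qed
  qed
qed

text \<open>The expression splits into three factors with separate limits:
  \<open>r powr (i - k)\<close> tends to 1 or 0; the powers of \<open>cosh\<close> and
  \<open>sinh\<close>, normalised by \<open>exp (- r)\<close>, tend to
  \<open>(1 / 2) powr (l + j) = 2 ^ m\<close>; the rest is
  \<open>bessel_profile_asymp\<close>.\<close>

lemma kmono_asymp:
  fixes \<nu> r :: "'x \<Rightarrow> real"
  assumes a: "a > 0" and \<nu>: "eventually (\<lambda>x. 0 \<le> \<nu> x \<and> \<nu> x \<le> B) F" and r: "filterlim r at_top F"
    and e: "i \<le> real k" "j + l = - real m"
  shows "((\<lambda>x. kmono a (\<nu> x) (i, l, j, k) (r x) * r x powr (\<nu> x + 1 / 2) * exp ((a + real m) * r x))
            \<longlongrightarrow> (if i = real k then 2 ^ m * gauss_const / sqrt a else 0)) F"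
proof -
  have pos: "eventually (\<lambda>x. r x > 0) F"
    using filterlim_at_top_dense[of r F] r by blast
  have "((\<lambda>\<rho>::real. cosh \<rho> * exp (- \<rho>)) \<longlongrightarrow> 1 / 2) at_top" "((\<lambda>\<rho>::real. sinh \<rho> * exp (- \<rho>)) \<longlongrightarrow> 1 / 2) at_top"
    unfolding cosh_field_def sinh_field_def by real_asymp+
  then have "((\<lambda>x. (cosh (r x) * exp (- r x)) powr l * (sinh (r x) * exp (- r x)) powr j) \<longlongrightarrow>
     (1 / 2) powr l * (1 / 2) powr j) F"
    by (intro tendsto_mult tendsto_powr filterlim_compose[OF _ r] tendsto_const) auto
  also have "(1 / 2) powr l * (1 / 2) powr j = (2::real) ^ m"
    using e by (simp add: powr_add[symmetric] add.commute powr_minus powr_realpow power_one_over)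
  finally have 1: "((\<lambda>x. (cosh (r x) * exp (- r x)) powr l * (sinh (r x) * exp (- r x)) powr j) \<longlongrightarrow> 2 ^ m) F" .
  have 2: "((\<lambda>x. r x powr (i - real k)) \<longlongrightarrow> (if i = real k then 1 else 0)) F"
  proof (cases "i = real k")
    case True
    have "((\<lambda>x. 1) \<longlongrightarrow> 1) F" by simp
    then have "((\<lambda>x. r x powr 0) \<longlongrightarrow> 1) F"
      by (rule Lim_transform_eventually) (use pos in eventually_elim, simp)
    then show ?thesis using True by simp
  next
    case False
    then have "i - real k < 0" using e by simp
    from tendsto_neg_powr[OF this r] show ?thesis using False by simp
  qed
  have lim: "((\<lambda>x. r x powr (i - real k) *
      ((cosh (r x) * exp (- r x)) powr l * (sinh (r x) * exp (- r x)) powr j) *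
      (bessel_profile a (\<nu> x + real k) (r x) * r x powr (\<nu> x + real k + 1 / 2) * exp (a * r x))) \<longlongrightarrow>
      (if i = real k then 1 else 0) * 2 ^ m * (gauss_const / sqrt a)) F"
    by (intro tendsto_mult 1 2 bessel_profile_asymp[OF a \<nu> r])
  show ?thesis
  proof (rule Lim_transform_eventually[OF tendsto_eq_rhs[OF lim]])
    show "(if i = real k then 1 else 0) * 2 ^ m * (gauss_const / sqrt a) =
      (if i = real k then 2 ^ m * gauss_const / sqrt a else 0)" by simp
    show "eventually (\<lambda>x. r x powr (i - real k) *
      ((cosh (r x) * exp (- r x)) powr l * (sinh (r x) * exp (- r x)) powr j) *
      (bessel_profile a (\<nu> x + real k) (r x) * r x powr (\<nu> x + real k + 1 / 2) * exp (a * r x)) =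
      kmono a (\<nu> x) (i, l, j, k) (r x) * r x powr (\<nu> x + 1 / 2) * exp ((a + real m) * r x)) F"
      using pos
    proof eventually_elim
      case (elim x)
      have E: "exp (- r x) powr l * exp (- r x) powr j = exp (real m * r x)"
        using e by (simp add: powr_add[symmetric] add.commute) (simp add: powr_def)
      have "(cosh (r x) * exp (- r x)) powr l * (sinh (r x) * exp (- r x)) powr j =
          cosh (r x) powr l * sinh (r x) powr j * (exp (- r x) powr l * exp (- r x) powr j)"
        using elim by (simp add: powr_mult)
      then have A: "(cosh (r x) * exp (- r x)) powr l * (sinh (r x) * exp (- r x)) powr j =
          cosh (r x) powr l * sinh (r x) powr j * exp (real m * r x)" by (simp only: E)
      have "r x powr (i - real k) * r x powr (\<nu> x + real k + 1 / 2) = r x powr i * r x powr (\<nu> x + 1 / 2)"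
        using elim by (simp add: powr_add[symmetric])
      then show ?case unfolding A
        by (simp add: kmono_def distrib_right exp_add)
    qed
  qed
qed

lemma kval_asymp:
  fixes \<nu> r :: "'x \<Rightarrow> real"
  assumes a: "a > 0" and \<nu>: "eventually (\<lambda>x. 0 \<le> \<nu> x \<and> \<nu> x \<le> B) F" and r: "filterlim r at_top F"
    and ts: "\<And>c i l j k. (c, i, l, j, k) \<in> set ts \<Longrightarrow> i \<le> real k \<and> j + l = - real m"
  shows "((\<lambda>x. kval a (\<nu> x) ts (r x) * r x powr (\<nu> x + 1 / 2) * exp ((a + real m) * r x))
            \<longlongrightarrow> klead ts * (2 ^ m * gauss_const / sqrt a)) F"
  using ts
proof (induction ts)
  case (Cons t ts)
  obtain c i l j k where t: "t = (c, i, l, j, k)" by (cases t)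
  have "((\<lambda>x. c * (kmono a (\<nu> x) (i, l, j, k) (r x) * r x powr (\<nu> x + 1 / 2) * exp ((a + real m) * r x)) +
     kval a (\<nu> x) ts (r x) * r x powr (\<nu> x + 1 / 2) * exp ((a + real m) * r x)) \<longlongrightarrow>
     c * (if i = real k then 2 ^ m * gauss_const / sqrt a else 0) + klead ts * (2 ^ m * gauss_const / sqrt a)) F"
    by (intro tendsto_add tendsto_mult[OF tendsto_const] kmono_asymp[OF a \<nu> r] Cons.IH)
      (use Cons.prems in \<open>fastforce simp: t\<close>)+
  then show ?case by (cases "i = real k") (simp_all add: t klead_def distrib_right mult.assoc add_divide_distrib)
qed (simp add: klead_def)

section \<open>Size of the iterated derivatives near 0, uniformly in the order\<close>

lemma sinh_le_mult_cosh:
  fixes x :: real assumes "x \<ge> 0" shows "sinh x \<le> x * cosh x"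
proof -
  have "0 * cosh 0 - sinh 0 \<le> x * cosh x - sinh x"
  proof (rule DERIV_nonneg_imp_nondecreasing[OF assms])
    fix y :: real assume "0 \<le> y"
    have "((\<lambda>x. x * cosh x - sinh x) has_real_derivative y * sinh y) (at y)"
      by (auto intro!: derivative_eq_intros)
    then show "\<exists>d. ((\<lambda>x. x * cosh x - sinh x) has_real_derivative d) (at y) \<and> 0 \<le> d"
      using \<open>0 \<le> y\<close> by (intro exI[of _ "y * sinh y"]) auto
  qed
  then show ?thesis by simp
qed

lemma powr_le_powr_abs:
  fixes x H e :: real
  assumes "1 \<le> x" "x \<le> H" shows "x powr e \<le> H powr \<bar>e\<bar>"
proof -
  have "x powr e \<le> x powr \<bar>e\<bar>" using assms by (intro powr_mono) auto
  also have "\<dots> \<le> H powr \<bar>e\<bar>" using assms by (intro powr_mono2) auto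
  finally show ?thesis .
qed

text \<open>The surplus exponent \<open>e - e0\<close> is paid by a power of
  \<open>R \<ge> 1\<close>. Bounding it by \<open>e1 - e0\<close> keeps the constant free of
  \<open>e\<close>, which depends on \<open>s\<close> in the applications.\<close>

lemma powr_le_lower_powr:
  fixes \<rho> R :: real
  assumes "0 < \<rho>" "\<rho> \<le> R" "1 \<le> R" "e0 \<le> e" "e \<le> e1"
  shows "\<rho> powr e \<le> R powr (e1 - e0) * \<rho> powr e0"
proof -
  have "\<rho> powr e = \<rho> powr (e - e0) * \<rho> powr e0" using assms by (simp add: powr_add[symmetric])
  also have "\<rho> powr (e - e0) \<le> R powr (e - e0)" using assms by (intro powr_mono2) auto
  also have "\<dots> \<le> R powr (e1 - e0)" using assms by (intro powr_mono) auto
  finally show ?thesis using assms by (simp add: mult_right_mono)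
qed

text \<open>Choose \<open>N\<close> above the largest order \<open>1 / 2 + b + k\<close> by
  \<open>b\<close>. Then \<open>bessel_K_le\<close> contributes the exponent
  \<open>- (1 / 2 + 2 * b + k)\<close> and the power in the profile contributes
  \<open>- (1 / 2 + b + k)\<close>, which is a loss of \<open>3 * b\<close> in all.\<close>

lemma bessel_profile_bound:
  assumes a: "a > 0" and R: "1 \<le> R" and b: "0 < b" and \<nu>: "0 \<le> \<nu>" "1 / 2 \<le> \<nu>" "\<nu> \<le> 1 / 2 + b"
    and \<rho>: "0 < \<rho>" "\<rho> \<le> R"
  shows "bessel_profile a (\<nu> + real k) \<rho> \<le>
    (R powr b * ((2 * (1 / 2 + 2 * b + real k) / a) powr (1 / 2 + 2 * b + real k) / b)) * \<rho> powr (- 1 - 2 * real k - 3 * b)"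
proof -
  define N where "N = 1 / 2 + 2 * b + real k"
  have "bessel_K (\<nu> + real k) (a * \<rho>) \<le> bessel_K (1 / 2 + b + real k) (a * \<rho>)"
    using a \<nu> \<rho> by (intro bessel_K_mono) auto
  also have "\<dots> \<le> (2 * N / (a * \<rho>)) powr N / (N - (1 / 2 + b + real k))"
    using a b \<rho> by (intro bessel_K_le) (auto simp: N_def)
  also have "2 * N / (a * \<rho>) = (2 * N / a) * (1 / \<rho>)" by simp
  also have "((2 * N / a) * (1 / \<rho>)) powr N = (2 * N / a) powr N * \<rho> powr (- N)"
    using \<rho> by (subst powr_mult) (simp add: powr_divide powr_minus_divide)
  finally have 1: "bessel_K (\<nu> + real k) (a * \<rho>) \<le> (2 * N / a) powr N / b * \<rho> powr (- N)"
    by (simp add: N_def)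
  have 2: "\<rho> powr (- (\<nu> + real k)) \<le> R powr b * \<rho> powr (- (1 / 2 + b + real k))"
    using powr_le_lower_powr[OF \<rho> R, of "- (1 / 2 + b + real k)" "- (\<nu> + real k)" "- (1 / 2 + real k)"] \<nu> by simp
  have "bessel_profile a (\<nu> + real k) \<rho> \<le>
     (R powr b * \<rho> powr (- (1 / 2 + b + real k))) * ((2 * N / a) powr N / b * \<rho> powr (- N))"
    unfolding bessel_profile_def using 1 2 \<rho> by (intro mult_mono) (auto simp: bessel_K_nonneg)
  also have "\<dots> = (R powr b * ((2 * N / a) powr N / b)) * (\<rho> powr (- (1 / 2 + b + real k)) * \<rho> powr (- N))"
    by simp
  also have "\<rho> powr (- (1 / 2 + b + real k)) * \<rho> powr (- N) = \<rho> powr (- 1 - 2 * real k - 3 * b)"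
    by (subst powr_add[symmetric]) (simp add: N_def algebra_simps)
  finally show ?thesis by (simp add: N_def)
qed

text \<open>Writing \<open>sinh \<rho>\<close> as \<open>\<rho>\<close> times a quotient between 1
  and \<open>cosh R\<close> turns the powers of \<open>cosh\<close> and \<open>sinh\<close>,
  whatever their signs, into \<open>\<rho> powr j\<close> and constants. The condition on the
  exponents is the third invariant of \<open>kterms_exponents\<close>.\<close>

lemma kmono_bound:
  assumes a: "a > 0" and R: "1 \<le> R" and b: "0 < b" and e: "- 2 * real m \<le> i + j - 2 * real k"
  shows "\<exists>C\<ge>0. \<forall>\<nu> \<rho>. 1 / 2 \<le> \<nu> \<and> \<nu> \<le> 1 / 2 + b \<and> 0 < \<rho> \<and> \<rho> \<le> R \<longrightarrow>
    \<bar>kmono a \<nu> (i, l, j, k) \<rho>\<bar> \<le> C * \<rho> powr (- 1 - 2 * real m - 3 * b)"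
proof -
  define A where "A = R powr b * ((2 * (1 / 2 + 2 * b + real k) / a) powr (1 / 2 + 2 * b + real k) / b)"
  define H where "H = cosh R"
  define E where "E = i + j - 2 * real k + 2 * real m"
  define C where "C = H powr \<bar>l\<bar> * H powr \<bar>j\<bar> * A * R powr E"
  have A0: "A \<ge> 0" using b by (simp add: A_def)
  have "C \<ge> 0" using A0 by (simp add: C_def)
  moreover have "\<bar>kmono a \<nu> (i, l, j, k) \<rho>\<bar> \<le> C * \<rho> powr (- 1 - 2 * real m - 3 * b)"
    if \<nu>: "1 / 2 \<le> \<nu>" "\<nu> \<le> 1 / 2 + b" and \<rho>: "0 < \<rho>" "\<rho> \<le> R" for \<nu> \<rho>
  proof -
    have cH: "cosh \<rho> \<le> H" using \<rho> by (simp add: H_def cosh_real_nonneg_le_iff)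
    have 1: "cosh \<rho> powr l \<le> H powr \<bar>l\<bar>" by (intro powr_le_powr_abs cosh_real_ge_1 cH)
    have q: "sinh \<rho> = \<rho> * (sinh \<rho> / \<rho>)" using \<rho> by simp
    have "1 \<le> sinh \<rho> / \<rho>" using le_sinh[of \<rho>] \<rho> by (simp add: field_simps)
    moreover have "sinh \<rho> / \<rho> \<le> H" 
    proof -
      have "sinh \<rho> / \<rho> \<le> cosh \<rho>" using sinh_le_mult_cosh[of \<rho>] \<rho> by (simp add: pos_divide_le_eq mult.commute)
      then show ?thesis using cH by linarith
    qed
    ultimately have "(sinh \<rho> / \<rho>) powr j \<le> H powr \<bar>j\<bar>" by (rule powr_le_powr_abs)
    moreover have "sinh \<rho> powr j = \<rho> powr j * (sinh \<rho> / \<rho>) powr j"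
      using \<rho> by (subst q, subst powr_mult) auto
    ultimately have 2: "sinh \<rho> powr j \<le> \<rho> powr j * H powr \<bar>j\<bar>" by (simp add: mult_left_mono)
    have 3: "bessel_profile a (\<nu> + real k) \<rho> \<le> A * \<rho> powr (- 1 - 2 * real k - 3 * b)"
      unfolding A_def by (rule bessel_profile_bound) (use assms \<nu> \<rho> in auto)
    have "\<bar>kmono a \<nu> (i, l, j, k) \<rho>\<bar> = \<rho> powr i * cosh \<rho> powr l * sinh \<rho> powr j * bessel_profile a (\<nu> + real k) \<rho>"
      by (simp add: kmono_def bessel_profile_nonneg)
    also have "\<dots> \<le> \<rho> powr i * H powr \<bar>l\<bar> * (\<rho> powr j * H powr \<bar>j\<bar>) * (A * \<rho> powr (- 1 - 2 * real k - 3 * b))"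
      by (intro mult_mono 1 2 3) (auto simp: bessel_profile_nonneg)
    also have "\<dots> = H powr \<bar>l\<bar> * H powr \<bar>j\<bar> * A * (\<rho> powr i * \<rho> powr j * \<rho> powr (- 1 - 2 * real k - 3 * b))"
      by simp
    also have "\<rho> powr i * \<rho> powr j * \<rho> powr (- 1 - 2 * real k - 3 * b) = \<rho> powr (i + j - 1 - 2 * real k - 3 * b)"
      by (simp add: powr_add[symmetric] add_diff_eq)
    also have "\<dots> \<le> R powr E * \<rho> powr (- 1 - 2 * real m - 3 * b)"
    proof -
      have "(i + j - 1 - 2 * real k - 3 * b) - (- 1 - 2 * real m - 3 * b) = E" by (simp add: E_def)
      then show ?thesis
        using powr_le_lower_powr[OF \<rho> R, of "- 1 - 2 * real m - 3 * b" "i + j - 1 - 2 * real k - 3 * b" "i + j - 1 - 2 * real k - 3 * b"] e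
        by simp
    qed
    finally show ?thesis using A0 by (simp add: C_def mult_left_mono mult.assoc)
  qed
  ultimately show ?thesis by blast
qed

lemma kval_bound:
  assumes a: "a > 0" and R: "1 \<le> R" and b: "0 < b"
    and ts: "\<And>c i l j k. (c, i, l, j, k) \<in> set ts \<Longrightarrow> - 2 * real m \<le> i + j - 2 * real k"
  shows "\<exists>C\<ge>0. \<forall>\<nu> \<rho>. 1 / 2 \<le> \<nu> \<and> \<nu> \<le> 1 / 2 + b \<and> 0 < \<rho> \<and> \<rho> \<le> R \<longrightarrow>
    \<bar>kval a \<nu> ts \<rho>\<bar> \<le> C * \<rho> powr (- 1 - 2 * real m - 3 * b)"
  using ts
proof (induction ts)
  case Nil
  show ?case by (intro exI[of _ 0]) simp
next
  case (Cons t ts)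
  obtain c i l j k where t: "t = (c, i, l, j, k)" by (cases t)
  have "\<exists>C\<ge>0. \<forall>\<nu> \<rho>. 1 / 2 \<le> \<nu> \<and> \<nu> \<le> 1 / 2 + b \<and> 0 < \<rho> \<and> \<rho> \<le> R \<longrightarrow>
    \<bar>kval a \<nu> ts \<rho>\<bar> \<le> C * \<rho> powr (- 1 - 2 * real m - 3 * b)"
  proof (rule Cons.IH)
    show "- 2 * real m \<le> i + j - 2 * real k" if "(c, i, l, j, k) \<in> set ts" for c i l j k
      using Cons.prems[of c i l j k] that by simp
  qed
  then obtain C1 where C1: "C1 \<ge> 0" "\<And>\<nu> \<rho>. 1 / 2 \<le> \<nu> \<Longrightarrow> \<nu> \<le> 1 / 2 + b \<Longrightarrow> 0 < \<rho> \<Longrightarrow> \<rho> \<le> R \<Longrightarrow>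
    \<bar>kval a \<nu> ts \<rho>\<bar> \<le> C1 * \<rho> powr (- 1 - 2 * real m - 3 * b)" by blast
  have "- 2 * real m \<le> i + j - 2 * real k" using Cons.prems[of c i l j k] by (simp add: t)
  from kmono_bound[OF a R b this, of l] obtain C2 where C2: "C2 \<ge> 0" "\<And>\<nu> \<rho>. 1 / 2 \<le> \<nu> \<Longrightarrow> \<nu> \<le> 1 / 2 + b \<Longrightarrow> 0 < \<rho> \<Longrightarrow> \<rho> \<le> R \<Longrightarrow>
    \<bar>kmono a \<nu> (i, l, j, k) \<rho>\<bar> \<le> C2 * \<rho> powr (- 1 - 2 * real m - 3 * b)" by blast
  show ?case
  proof (intro exI[of _ "\<bar>c\<bar> * C2 + C1"] conjI allI impI; (elim conjE)?)
    show "0 \<le> \<bar>c\<bar> * C2 + C1" using C1 C2 by simp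
    fix \<nu> \<rho> assume A: "1 / 2 \<le> \<nu>" "\<nu> \<le> 1 / 2 + b" "0 < \<rho>" "\<rho> \<le> R"
    have "\<bar>kval a \<nu> (t # ts) \<rho>\<bar> \<le> \<bar>c\<bar> * \<bar>kmono a \<nu> (i, l, j, k) \<rho>\<bar> + \<bar>kval a \<nu> ts \<rho>\<bar>"
      unfolding t kval_simps abs_mult[symmetric] by (rule abs_triangle_ineq)
    also have "\<dots> \<le> \<bar>c\<bar> * (C2 * \<rho> powr (- 1 - 2 * real m - 3 * b)) + C1 * \<rho> powr (- 1 - 2 * real m - 3 * b)"
      by (intro add_mono mult_left_mono C1(2) C2(2) A) auto
    finally show "\<bar>kval a \<nu> (t # ts) \<rho>\<bar> \<le> (\<bar>c\<bar> * C2 + C1) * \<rho> powr (- 1 - 2 * real m - 3 * b)"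
      by (simp add: algebra_simps)
  qed
qed

section \<open>The iterated derivatives of the kernel profile as functions of s and r\<close>

definition kder :: "nat \<Rightarrow> real \<Rightarrow> nat \<Rightarrow> real \<Rightarrow> real \<Rightarrow> real" where
  "kder n p m s r = (sinh_deriv ^^ m) (kernel_profile n s p) r"

lemma kder_eq:
  assumes "n \<ge> 2" "r > 0"
  shows "kder n p m s r = kval ((real n - 1) / 2) ((1 + s * p) / 2) (kterms ((real n - 1) / 2) m) r"
proof -
  have "kernel_profile n s p = bessel_profile ((real n - 1) / 2) ((1 + s * p) / 2)"
    by (simp add: fun_eq_iff kernel_profile_def bessel_profile_def)
  then show ?thesis using sinh_deriv_iterate[of "(real n - 1) / 2" r m "(1 + s * p) / 2"] assms
    by (simp add: kder_def)
qed

lemma kder_continuous_on: "n \<ge> 2 \<Longrightarrow> continuous_on {0<..} (kder n p m s)"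
  using kval_continuous_on[of "(real n - 1) / 2"]
  by (subst continuous_on_cong[OF refl kder_eq]) auto

lemma kder_bound:
  assumes n: "n \<ge> 2" and p: "p > 0" and "\<beta> > 0"
  shows "\<exists>C\<ge>0. \<exists>s0>0. \<forall>s r. 0 < s \<and> s < s0 \<and> 0 < r \<and> r \<le> R \<longrightarrow> \<bar>kder n p m s r\<bar> \<le> C * r powr (- 1 - 2 * real m - \<beta>)"
proof -
  define R' where "R' = max 1 R"
  define a where "a = (real n - 1) / 2"
  have "\<exists>C\<ge>0. \<forall>\<nu> \<rho>. 1 / 2 \<le> \<nu> \<and> \<nu> \<le> 1 / 2 + \<beta> / 3 \<and> 0 < \<rho> \<and> \<rho> \<le> R' \<longrightarrow>
    \<bar>kval a \<nu> (kterms a m) \<rho>\<bar> \<le> C * \<rho> powr (- 1 - 2 * real m - 3 * (\<beta> / 3))"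
    by (rule kval_bound) (use assms kterms_exponents in \<open>auto simp: a_def R'_def\<close>)
  then obtain C where C: "C \<ge> 0" "\<And>\<nu> \<rho>. 1 / 2 \<le> \<nu> \<Longrightarrow> \<nu> \<le> 1 / 2 + \<beta> / 3 \<Longrightarrow> 0 < \<rho> \<Longrightarrow> \<rho> \<le> R' \<Longrightarrow>
    \<bar>kval a \<nu> (kterms a m) \<rho>\<bar> \<le> C * \<rho> powr (- 1 - 2 * real m - \<beta>)" by auto
  \<comment> \<open>The threshold \<open>2 * \<beta> / (3 * p)\<close> is the condition
    \<open>(1 + s * p) / 2 \<le> 1 / 2 + \<beta> / 3\<close>, under which the loss
    \<open>3 * (\<beta> / 3)\<close> of \<open>kval_bound\<close> is \<open>\<beta>\<close>.\<close>
  have "\<bar>kder n p m s r\<bar> \<le> C * r powr (- 1 - 2 * real m - \<beta>)"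
    if "0 < s" "s < 2 * \<beta> / (3 * p)" "0 < r" "r \<le> R" for s r
  proof -
    have "s * p \<le> 2 * \<beta> / 3" using that p by (simp add: field_simps)
    then show ?thesis using that p n unfolding kder_eq[OF n \<open>0 < r\<close>] a_def[symmetric]
      by (intro C(2)) (auto simp: R'_def)
  qed
  moreover have "2 * \<beta> / (3 * p) > 0" using assms by simp
  ultimately show ?thesis using C(1) by blast
qed

definition kder_lim :: "nat \<Rightarrow> nat \<Rightarrow> real" where
  "kder_lim n m = klead (kterms ((real n - 1) / 2) m) * (2 ^ m * gauss_const / sqrt ((real n - 1) / 2))"

lemma kder_lim_pos: "n \<ge> 2 \<Longrightarrow> kder_lim n m > 0"
  by (simp add: kder_lim_def klead_kterms_pos gauss_const_pos)

text \<open>The instance \<open>\<nu> = (1 + s * p) / 2\<close> of \<open>kval_asymp\<close>, where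
  \<open>\<nu> + 1 / 2 = 1 + s * p / 2\<close>. Convergence along the product filter is uniformity
  in small \<open>s\<close>, as \<open>tail_limit\<close> requires.\<close>

lemma kder_asymp:
  assumes n: "n \<ge> 2" and p: "p > 0"
  shows "((\<lambda>(s, r). kder n p m s r * r powr (1 + s * p / 2) * exp (((real n - 1) / 2 + real m) * r))
            \<longlongrightarrow> kder_lim n m) (at_right 0 \<times>\<^sub>F at_top)"
proof -
  let ?F = "at_right 0 \<times>\<^sub>F at_top :: (real \<times> real) filter"
  define a where "a = (real n - 1) / 2"
  have a: "a > 0" using n by (simp add: a_def)
  have snd: "filterlim snd at_top ?F" by (rule filterlim_snd)
  have ev: "eventually (\<lambda>s::real. 0 < s \<and> s < 1 / p) (at_right 0)"
    using p eventually_at_right_less[of 0] eventually_at_right_real[of 0 "1 / p"] by simp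
  then have evF: "eventually (\<lambda>x. 0 < fst x \<and> fst x < 1 / p) ?F"
    by (rule eventually_compose_filterlim[OF _ filterlim_fst])
  have "((\<lambda>x. kval a ((1 + fst x * p) / 2) (kterms a m) (snd x) * snd x powr ((1 + fst x * p) / 2 + 1 / 2) * exp ((a + real m) * snd x))
      \<longlongrightarrow> klead (kterms a m) * (2 ^ m * gauss_const / sqrt a)) ?F"
  proof (rule kval_asymp[OF a _ snd])
    show "eventually (\<lambda>x. 0 \<le> (1 + fst x * p) / 2 \<and> (1 + fst x * p) / 2 \<le> 1) ?F"
      using evF by eventually_elim (use p in \<open>auto simp: field_simps\<close>)
    show "i \<le> real k \<and> j + l = - real m" if "(c, i, l, j, k) \<in> set (kterms a m)" for c i l j k
      using kterms_exponents[OF that] by simp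
  qed
  then have lim: "((\<lambda>x. kval a ((1 + fst x * p) / 2) (kterms a m) (snd x) * snd x powr ((1 + fst x * p) / 2 + 1 / 2) * exp ((a + real m) * snd x))
      \<longlongrightarrow> kder_lim n m) ?F" by (simp add: kder_lim_def a_def)
  show ?thesis
  proof (rule Lim_transform_eventually[OF lim])
    have "eventually (\<lambda>x. snd x > 0) ?F"
      using filterlim_at_top_dense[of snd ?F] snd by blast
    then show "eventually (\<lambda>x. kval a ((1 + fst x * p) / 2) (kterms a m) (snd x) * snd x powr ((1 + fst x * p) / 2 + 1 / 2) * exp ((a + real m) * snd x)
      = (case x of (s, r) \<Rightarrow> kder n p m s r * r powr (1 + s * p / 2) * exp (((real n - 1) / 2 + real m) * r))) ?F"
    proof eventually_elim
      case (elim x)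
      have "(1 + fst x * p) / 2 + 1 / 2 = 1 + fst x * p / 2" by (simp add: field_simps)
      then show ?case using elim kder_eq[OF n, of "snd x" p m "fst x"]
        by (simp add: a_def[symmetric] case_prod_beta)
    qed
  qed
qed

section \<open>Integrals of the kernel\<close>

lemma powr_tail_integral:
  fixes R q :: real
  assumes "R > 0" "q > 0"
  shows "set_integrable lborel {R<..} (\<lambda>r. r powr (- 1 - q))"
    "(LBINT r:{R<..}. r powr (- 1 - q)) = R powr (- q) / q"
proof -
  let ?F = "\<lambda>r. - (r powr (- q)) / q"
  have d: "(?F has_real_derivative r powr (- 1 - q)) (at r)" if "R < r" for r
    using that assms by (auto intro!: derivative_eq_intros simp: minus_diff_commute)
  have c: "isCont (\<lambda>r. r powr (- 1 - q)) r" if "R < r" for r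
    using that assms by (intro continuous_intros) auto
  have A: "(?F \<longlongrightarrow> - (R powr (- q)) / q) (at_right R)"
    by (intro tendsto_intros) (use assms in auto)
  have "((\<lambda>r. r powr (- q)) \<longlongrightarrow> 0) at_top"
    using assms by (intro tendsto_neg_powr filterlim_ident) auto
  from tendsto_divide[OF tendsto_minus[OF this] tendsto_const[of q]] assms
  have B: "(?F \<longlongrightarrow> 0) at_top" by simp
  from set_integral_FTC_Ioi[OF d c _ A B]
  show "set_integrable lborel {R<..} (\<lambda>r. r powr (- 1 - q))"
    "(LBINT r:{R<..}. r powr (- 1 - q)) = R powr (- q) / q" by auto
qed

lemma eventually_prod_at_right_at_top:
  fixes P :: "real \<Rightarrow> real \<Rightarrow> bool"
  assumes "eventually (\<lambda>(s, r). P s r) (at_right 0 \<times>\<^sub>F at_top)"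
  shows "\<exists>s0>0. \<exists>R. \<forall>s r. 0 < s \<and> s < s0 \<and> R \<le> r \<longrightarrow> P s r"
proof -
  from assms obtain P1 P2 where "eventually P1 (at_right 0)" "eventually P2 at_top"
    and P: "\<And>s r. P1 s \<Longrightarrow> P2 r \<Longrightarrow> P s r"
    unfolding eventually_prod_filter by auto
  then show ?thesis
    unfolding eventually_at_right_field eventually_at_top_linorder by blast
qed

text \<open>An Abelian argument. If \<open>H\<close> is replaced by \<open>L\<close>, the value is
  exactly \<open>2 * L / p * R powr (- (s * p / 2))\<close>. By the joint limit \<open>H\<close>
  differs from \<open>L\<close> by at most \<open>\<epsilon>\<close> beyond some \<open>R1\<close>,
  uniformly in small \<open>s\<close>; on the bounded rest the error is bounded, and the prefactor
  \<open>s\<close> removes it.\<close>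

lemma tail_limit:
  fixes H :: "real \<Rightarrow> real \<Rightarrow> real"
  assumes p: "p > 0" and R: "R > 0"
    and lim: "((\<lambda>(s, r). H s r) \<longlongrightarrow> L) (at_right 0 \<times>\<^sub>F at_top)"
    and loc: "\<And>R1. \<exists>C. \<exists>s0>0. \<forall>s r. 0 < s \<and> s < s0 \<and> R < r \<and> r \<le> R1 \<longrightarrow> \<bar>H s r\<bar> \<le> C"
    and meas: "\<And>s. set_borel_measurable lborel {R<..} (H s)"
  shows "eventually (\<lambda>s. set_integrable lborel {R<..} (\<lambda>r. r powr (- 1 - s * p / 2) * H s r)) (at_right 0)"
    and "((\<lambda>s. s * (LBINT r:{R<..}. r powr (- 1 - s * p / 2) * H s r)) \<longlongrightarrow> 2 * L / p) (at_right 0)"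
proof -
  have approx: "\<exists>s0>0. \<exists>C\<ge>0. \<exists>R1>R. \<forall>s r. 0 < s \<and> s < s0 \<and> R < r \<longrightarrow> \<bar>H s r - L\<bar> \<le> \<epsilon> + C * indicator {R<..R1} r"
    if "\<epsilon> > 0" for \<epsilon>
  proof -
    have "eventually (\<lambda>(s, r). \<bar>H s r - L\<bar> \<le> \<epsilon>) (at_right 0 \<times>\<^sub>F at_top)"
      using tendstoD[OF lim that] by eventually_elim (auto simp: dist_real_def)
    then obtain s1 R0 where 1: "s1 > 0" "\<And>s r. 0 < s \<Longrightarrow> s < s1 \<Longrightarrow> R0 \<le> r \<Longrightarrow> \<bar>H s r - L\<bar> \<le> \<epsilon>"
      by (blast dest: eventually_prod_at_right_at_top)
    define R1 where "R1 = max R0 (R + 1)"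
    obtain C s2 where 2: "s2 > 0" "\<And>s r. 0 < s \<Longrightarrow> s < s2 \<Longrightarrow> R < r \<Longrightarrow> r \<le> R1 \<Longrightarrow> \<bar>H s r\<bar> \<le> C"
      using loc[of R1] by blast
    show ?thesis
    proof (intro exI conjI allI impI; (elim conjE)?)
      show "min s1 s2 > 0" using 1 2 by simp
      show "\<bar>C\<bar> + \<bar>L\<bar> \<ge> 0" by simp
      show "R1 > R" by (simp add: R1_def)
      fix s r assume s: "0 < s" "s < min s1 s2" and r: "R < r"
      show "\<bar>H s r - L\<bar> \<le> \<epsilon> + (\<bar>C\<bar> + \<bar>L\<bar>) * indicator {R<..R1} r"
      proof (cases "r \<le> R1")
        case True
        then have "\<bar>H s r\<bar> \<le> \<bar>C\<bar>" using 2(2)[of s r] s r by auto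
        then show ?thesis using True r that by auto
      next
        case False
        then show ?thesis using 1(2)[of s r] s by (auto simp: R1_def)
      qed
    qed
  qed
  \<comment> \<open>\<open>D\<close> bounds \<open>r powr (- 1 - q)\<close> for \<open>r > R\<close>
    and \<open>0 < q < 1\<close>; the maximum with 1 covers small and large \<open>R\<close>
    alike.\<close>
  define D where "D = max 1 (1 / R) ^ 2"
  have D: "r powr (- 1 - q) \<le> D" if "R < r" "0 < q" "q < 1" for r q
  proof -
    have "r powr (- 1 - q) \<le> R powr (- 1 - q)" using that R by (intro powr_mono2') auto
    also have "\<dots> = (1 / R) powr (1 + q)" using R by (simp add: powr_divide powr_minus_divide[symmetric])
    also have "\<dots> \<le> max 1 (1 / R) powr (1 + q)" using R that by (intro powr_mono2) auto
    also have "\<dots> \<le> max 1 (1 / R) powr 2" using that by (intro powr_mono) auto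
    finally show ?thesis by (simp add: D_def)
  qed
  define I where "I = (\<lambda>s. LBINT r:{R<..}. r powr (- 1 - s * p / 2) * H s r)"
  have main: "\<exists>s0>0. \<exists>C\<ge>0. \<forall>s. 0 < s \<and> s < s0 \<longrightarrow>
      set_integrable lborel {R<..} (\<lambda>r. r powr (- 1 - s * p / 2) * H s r) \<and>
      \<bar>s * I s - 2 * L / p * R powr (- (s * p / 2))\<bar> \<le> \<epsilon> * (2 / p) * R powr (- (s * p / 2)) + s * C"
    if \<epsilon>: "\<epsilon> > 0" for \<epsilon>
  proof -
    obtain s0 C R1 where s0: "s0 > 0" "C \<ge> 0" "R1 > R"
      "\<And>s r. 0 < s \<Longrightarrow> s < s0 \<Longrightarrow> R < r \<Longrightarrow> \<bar>H s r - L\<bar> \<le> \<epsilon> + C * indicator {R<..R1} r"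
      using approx[OF \<epsilon>] by blast
    show ?thesis
    proof (intro exI conjI allI impI; (elim conjE)?)
      show "min s0 (1 / p) > 0" "C * D * (R1 - R) \<ge> 0" using s0 p by (auto simp: D_def)
      fix s assume s: "0 < s" "s < min s0 (1 / p)"
      define q where "q = s * p / 2"
      have "s * p < 1" using s p by (simp add: field_simps)
      then have q: "0 < q" "q < 1" using s p by (auto simp: q_def)
      note T = powr_tail_integral[OF R q(1)]
      let ?B = "\<lambda>r. \<epsilon> * r powr (- 1 - q) + C * D * indicator {R<..R1} r"
      have i1: "set_integrable lborel {R<..} (\<lambda>r. C * D * indicator {R<..R1} r)"
      proof (intro set_integrable_mult_right)
        show "set_integrable lborel {R<..} (indicator {R<..R1} :: real \<Rightarrow> real)"
          using integrable_mult_indicator[of "{R<..}" lborel "indicator {R<..R1} :: real \<Rightarrow> real"]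
            integrable_real_indicator[of "{R<..R1}" lborel] s0(3)
          by (simp add: set_integrable_def)
      qed
      have iB: "set_integrable lborel {R<..} ?B" by (intro set_integral_add set_integrable_mult_right T i1)
      have m: "set_borel_measurable lborel {R<..} (\<lambda>r. r powr (- 1 - q) * (H s r - L))"
        using meas[of s] unfolding set_borel_measurable_def
      proof -
        assume "(\<lambda>x. indicat_real {R<..} x *\<^sub>R H s x) \<in> borel_measurable lborel"
        then have "(\<lambda>r. r powr (- 1 - q) * (indicat_real {R<..} r *\<^sub>R H s r - indicat_real {R<..} r * L)) \<in> borel_measurable lborel"
          by measurable
        then show "(\<lambda>x. indicat_real {R<..} x *\<^sub>R (x powr (- 1 - q) * (H s x - L))) \<in> borel_measurable lborel"
          by (rule back_subst[of "\<lambda>f. f \<in> borel_measurable lborel"]) (auto simp: algebra_simps)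
      qed
      have bnd: "\<bar>r powr (- 1 - q) * (H s r - L)\<bar> \<le> ?B r" if r: "R < r" for r
      proof -
        have "\<bar>r powr (- 1 - q) * (H s r - L)\<bar> \<le> r powr (- 1 - q) * (\<epsilon> + C * indicator {R<..R1} r)"
          unfolding abs_mult using s0(4)[of s r] s r by (simp add: mult_left_mono)
        also have "\<dots> = \<epsilon> * r powr (- 1 - q) + C * indicator {R<..R1} r * r powr (- 1 - q)"
          by (simp add: algebra_simps)
        also have "\<dots> \<le> \<epsilon> * r powr (- 1 - q) + C * indicator {R<..R1} r * D"
          using D[OF r q] s0(2) by (intro add_left_mono mult_left_mono) auto
        finally show ?thesis by (simp add: mult.commute mult.left_commute)
      qed
      have iHL: "set_integrable lborel {R<..} (\<lambda>r. r powr (- 1 - q) * (H s r - L))"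
      proof (rule set_integrable_bound[OF iB m], intro AE_I2 impI)
        fix r assume "r \<in> {R<..}"
        then show "norm (r powr (- 1 - q) * (H s r - L)) \<le> norm (?B r)" using bnd[of r] by simp
      qed
      have e: "r powr (- 1 - q) * H s r = r powr (- 1 - q) * (H s r - L) + L * r powr (- 1 - q)" for r
        by (simp add: algebra_simps)
      have iL: "set_integrable lborel {R<..} (\<lambda>r. L * r powr (- 1 - q))" by (intro set_integrable_mult_right T)
      show "set_integrable lborel {R<..} (\<lambda>r. r powr (- 1 - s * p / 2) * H s r)"
        unfolding q_def[symmetric] e by (intro set_integral_add iHL iL)
      have "I s = (LBINT r:{R<..}. r powr (- 1 - q) * (H s r - L)) + L * (R powr (- q) / q)"
        unfolding I_def q_def[symmetric] e by (subst set_integral_add(2)[OF iHL iL]) (simp add: T(2))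
      then have "s * I s - 2 * L / p * R powr (- q) = s * (LBINT r:{R<..}. r powr (- 1 - q) * (H s r - L))"
        using s p by (simp add: q_def field_simps)
      then have "\<bar>s * I s - 2 * L / p * R powr (- q)\<bar> = s * \<bar>LBINT r:{R<..}. r powr (- 1 - q) * (H s r - L)\<bar>"
        using s by (simp add: abs_mult)
      also have "\<bar>LBINT r:{R<..}. r powr (- 1 - q) * (H s r - L)\<bar> \<le> (LBINT r:{R<..}. norm (r powr (- 1 - q) * (H s r - L)))"
        using set_integral_norm_bound[OF iHL] by simp
      also have "\<dots> \<le> (LBINT r:{R<..}. ?B r)"
        by (rule set_integral_mono[OF set_integrable_norm[OF iHL] iB]) (use bnd in simp)
      also have "(LBINT r:{R<..}. ?B r) = \<epsilon> * (R powr (- q) / q) + C * D * (R1 - R)"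
      proof -
        have "(LBINT r:{R<..}. indicator {R<..R1} r) = (LINT r|lborel. indicator {R<..R1} r :: real)"
          unfolding set_lebesgue_integral_def by (rule Bochner_Integration.integral_cong) (auto simp: indicator_def)
        then have "(LBINT r:{R<..}. C * D * indicator {R<..R1} r) = C * D * (R1 - R)" using s0 by simp
        moreover have "(LBINT r:{R<..}. ?B r) = (LBINT r:{R<..}. \<epsilon> * r powr (- 1 - q)) + (LBINT r:{R<..}. C * D * indicator {R<..R1} r)"
          by (rule set_integral_add(2)[OF set_integrable_mult_right[OF T(1)] i1])
        ultimately show ?thesis by (simp add: T(2))
      qed
      finally have "\<bar>s * I s - 2 * L / p * R powr (- q)\<bar> \<le> s * (\<epsilon> * (R powr (- q) / q) + C * D * (R1 - R))"
        using s by (simp add: mult_left_mono)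
      also have "\<dots> = \<epsilon> * (2 / p) * R powr (- q) + s * (C * D * (R1 - R))"
        using s p by (simp add: q_def field_simps)
      finally show "\<bar>s * I s - 2 * L / p * R powr (- (s * p / 2))\<bar> \<le> \<epsilon> * (2 / p) * R powr (- (s * p / 2)) + s * (C * D * (R1 - R))"
        by (simp add: q_def)
    qed
  qed
  show "eventually (\<lambda>s. set_integrable lborel {R<..} (\<lambda>r. r powr (- 1 - s * p / 2) * H s r)) (at_right 0)"
    using main[of 1] unfolding eventually_at_right_field by auto
  have Rlim: "((\<lambda>s. R powr (- (s * p / 2))) \<longlongrightarrow> 1) (at_right 0)"
  proof -
    have "((\<lambda>s. R powr (- (s * p / 2))) \<longlongrightarrow> R powr (- (0 * p / 2))) (at_right 0)"
      using R by (intro tendsto_intros) auto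
    then show ?thesis using R by simp
  qed
  have "((\<lambda>s. s * I s - 2 * L / p * R powr (- (s * p / 2))) \<longlongrightarrow> 0) (at_right 0)"
  proof (rule tendstoI)
    fix e :: real assume e: "e > 0"
    \<comment> \<open>With this choice the limiting error \<open>\<epsilon> * (2 / p)\<close> equals
      \<open>e / 2\<close>.\<close>
    define \<epsilon> where "\<epsilon> = e * p / 4"
    have "\<epsilon> > 0" using e p by (simp add: \<epsilon>_def)
    from main[OF this] obtain s0 C where s0: "s0 > 0" "\<And>s. 0 < s \<Longrightarrow> s < s0 \<Longrightarrow>
      \<bar>s * I s - 2 * L / p * R powr (- (s * p / 2))\<bar> \<le> \<epsilon> * (2 / p) * R powr (- (s * p / 2)) + s * C" by blast
    have "((\<lambda>s. \<epsilon> * (2 / p) * R powr (- (s * p / 2)) + s * C) \<longlongrightarrow> \<epsilon> * (2 / p) * 1 + 0 * C) (at_right 0)"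
      by (intro tendsto_intros Rlim)
    moreover have "\<epsilon> * (2 / p) * 1 + 0 * C < e" using e p by (simp add: \<epsilon>_def)
    ultimately have "eventually (\<lambda>s. \<epsilon> * (2 / p) * R powr (- (s * p / 2)) + s * C < e) (at_right 0)"
      by (rule order_tendstoD)
    moreover have "eventually (\<lambda>s. 0 < s \<and> s < s0) (at_right 0)"
      using s0(1) unfolding eventually_at_right_field by auto
    ultimately show "eventually (\<lambda>s. dist (s * I s - 2 * L / p * R powr (- (s * p / 2))) 0 < e) (at_right 0)"
      by eventually_elim (use s0(2) in \<open>force simp: dist_real_def\<close>)
  qed
  from tendsto_add[OF this tendsto_mult[OF tendsto_const[of "2 * L / p"] Rlim]]
  show "((\<lambda>s. s * (LBINT r:{R<..}. r powr (- 1 - s * p / 2) * H s r)) \<longlongrightarrow> 2 * L / p) (at_right 0)"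
    by (simp add: I_def)
qed

lemma kder_measurable: "n \<ge> 2 \<Longrightarrow> set_borel_measurable lborel {0<..} (kder n p m s)"
  by (intro set_borel_measurable_continuous_lborel kder_continuous_on) auto

text \<open>The exponential decay of \<open>kder\<close> is paired with the growth of
  \<open>w\<close>, and the power \<open>r powr (1 + s * p / 2)\<close> is split off, so that
  \<open>tail_limit\<close> applies to a function \<open>H\<close> with a finite joint limit. The
  weight is \<open>sinh r ^ (n - 1)\<close> for odd \<open>n\<close> and the integrated Weyl weight
  for even \<open>n\<close>.\<close>

lemma kder_tail:
  fixes w :: "real \<Rightarrow> real"
  assumes n: "n \<ge> 2" and p: "p > 0" and R: "R > 0"
    and meas: "set_borel_measurable lborel {R<..} w"
    and lim: "((\<lambda>r. w r * exp (- (((real n - 1) / 2 + real m) * r))) \<longlongrightarrow> \<omega>) at_top"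
    and loc: "\<And>R1. \<exists>C. \<forall>r. R < r \<and> r \<le> R1 \<longrightarrow> \<bar>w r\<bar> \<le> C"
  shows "eventually (\<lambda>s. set_integrable lborel {R<..} (\<lambda>r. kder n p m s r * w r)) (at_right 0)"
    and "((\<lambda>s. s * (LBINT r:{R<..}. kder n p m s r * w r)) \<longlongrightarrow> 2 * (kder_lim n m * \<omega>) / p) (at_right 0)"
proof -
  define b where "b = (real n - 1) / 2 + real m"
  have b: "b > 0" using n by (simp add: b_def add_pos_nonneg)
  define H where "H = (\<lambda>s r. (kder n p m s r * r powr (1 + s * p / 2) * exp (b * r)) * (w r * exp (- (b * r))))"
  have eq: "r powr (- 1 - s * p / 2) * H s r = kder n p m s r * w r" if "r > 0" for r s
  proof -
    have "r powr (- 1 - s * p / 2) * r powr (1 + s * p / 2) = 1" using that by (simp add: powr_add[symmetric])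
    then have "r powr (- 1 - s * p / 2) * r powr (1 + s * p / 2) * (exp (b * r) * exp (- (b * r))) = 1"
      by (simp add: exp_add[symmetric])
    moreover have "r powr (- 1 - s * p / 2) * H s r = (r powr (- 1 - s * p / 2) * r powr (1 + s * p / 2) * (exp (b * r) * exp (- (b * r)))) * (kder n p m s r * w r)"
      by (simp add: H_def)
    ultimately show ?thesis by simp
  qed
  have Hlim: "((\<lambda>(s, r). H s r) \<longlongrightarrow> kder_lim n m * \<omega>) (at_right 0 \<times>\<^sub>F at_top)"
    using tendsto_mult[OF kder_asymp[OF n p, of m] filterlim_compose[OF lim filterlim_snd, of "at_right 0"]]
    by (simp add: H_def b_def case_prod_unfold)
  have Hloc: "\<exists>C. \<exists>s0>0. \<forall>s r. 0 < s \<and> s < s0 \<and> R < r \<and> r \<le> R1 \<longrightarrow> \<bar>H s r\<bar> \<le> C" for R1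
  proof -
    obtain C s0 where C: "C \<ge> 0" "s0 > 0" "\<And>s r. 0 < s \<Longrightarrow> s < s0 \<Longrightarrow> 0 < r \<Longrightarrow> r \<le> R1 \<Longrightarrow> \<bar>kder n p m s r\<bar> \<le> C * r powr (- 1 - 2 * real m - 1)"
      using kder_bound[OF n p, of 1 R1 m] by auto
    obtain W where W: "\<And>r. R < r \<Longrightarrow> r \<le> R1 \<Longrightarrow> \<bar>w r\<bar> \<le> W" using loc[of R1] by blast
    define K where "K = (C * R powr (- 1 - 2 * real m - 1)) * max 1 R1 powr 2 * exp (b * R1) * W"
    have "\<bar>H s r\<bar> \<le> K" if s: "0 < s" "s < min s0 (1 / p)" and r: "R < r" "r \<le> R1" for s r
    proof -
      have sp: "s * p < 1" using s p by (simp add: field_simps)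
      have r0: "r > 0" using r R by simp
      have 1: "\<bar>kder n p m s r\<bar> \<le> C * R powr (- 1 - 2 * real m - 1)"
      proof -
        have "\<bar>kder n p m s r\<bar> \<le> C * r powr (- 1 - 2 * real m - 1)" using C(3)[of s r] s r r0 by simp
        also have "r powr (- 1 - 2 * real m - 1) \<le> R powr (- 1 - 2 * real m - 1)"
          using r R by (intro powr_mono2') auto
        finally show ?thesis using C(1) by (simp add: mult_left_mono)
      qed
      have 2: "r powr (1 + s * p / 2) \<le> max 1 R1 powr 2"
      proof -
        have "r powr (1 + s * p / 2) \<le> max 1 R1 powr (1 + s * p / 2)" using r r0 s p by (intro powr_mono2) auto
        also have "\<dots> \<le> max 1 R1 powr 2" using sp by (intro powr_mono) auto
        finally show ?thesis .
      qed
      have 3: "exp (b * r) \<le> exp (b * R1)" using b r by simp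
      have 4: "\<bar>w r\<bar> * exp (- (b * r)) \<le> W * 1"
        using W[OF r] b r0 by (intro mult_mono) auto
      have "\<bar>H s r\<bar> = \<bar>kder n p m s r\<bar> * r powr (1 + s * p / 2) * exp (b * r) * (\<bar>w r\<bar> * exp (- (b * r)))"
        by (simp add: H_def abs_mult)
      also have "\<dots> \<le> (C * R powr (- 1 - 2 * real m - 1)) * max 1 R1 powr 2 * exp (b * R1) * (W * 1)"
        by (intro mult_mono 1 2 3 4) (use C(1) in auto)
      finally show ?thesis by (simp add: K_def)
    qed
    moreover have "min s0 (1 / p) > 0" using C p by simp
    ultimately show ?thesis by blast
  qed
  have Hmeas: "set_borel_measurable lborel {R<..} (H s)" for s
  proof -
    have "(\<lambda>r. (indicat_real {0<..} r *\<^sub>R kder n p m s r) * r powr (1 + s * p / 2) * exp (b * r) * ((indicat_real {R<..} r *\<^sub>R w r) * exp (- (b * r)))) \<in> borel_measurable lborel"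
      using kder_measurable[OF n, of p m s] meas unfolding set_borel_measurable_def by measurable
    moreover have "(\<lambda>r. (indicat_real {0<..} r *\<^sub>R kder n p m s r) * r powr (1 + s * p / 2) * exp (b * r) * ((indicat_real {R<..} r *\<^sub>R w r) * exp (- (b * r))))
       = (\<lambda>r. indicat_real {R<..} r *\<^sub>R H s r)"
      using R by (auto simp: fun_eq_iff H_def indicator_def)
    ultimately show ?thesis by (simp add: set_borel_measurable_def)
  qed
  have c1: "set_integrable lborel {R<..} (\<lambda>r. r powr (- 1 - s * p / 2) * H s r) = set_integrable lborel {R<..} (\<lambda>r. kder n p m s r * w r)" for s
    by (rule set_integrable_cong) (use eq R in auto)
  have c2: "(LBINT r:{R<..}. r powr (- 1 - s * p / 2) * H s r) = (LBINT r:{R<..}. kder n p m s r * w r)" for s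
    by (rule set_lebesgue_integral_cong) (use eq R in auto)
  note T = tail_limit[OF p R Hlim Hloc Hmeas, unfolded c1 c2]
  show "eventually (\<lambda>s. set_integrable lborel {R<..} (\<lambda>r. kder n p m s r * w r)) (at_right 0)" by (rule T(1))
  show "((\<lambda>s. s * (LBINT r:{R<..}. kder n p m s r * w r)) \<longlongrightarrow> 2 * (kder_lim n m * \<omega>) / p) (at_right 0)" by (rule T(2))
qed

section \<open>Bounds for integrals up to the singularity, uniform in small s\<close>

lemma set_integrable_nn_finite:
  fixes f :: "real \<Rightarrow> real"
  assumes "set_integrable lborel A f"
  shows "(\<integral>\<^sup>+r. ennreal \<bar>f r\<bar> * indicator A r \<partial>lborel) < \<infinity>"
proof -
  have "(\<integral>\<^sup>+r. ennreal (norm (indicator A r *\<^sub>R f r)) \<partial>lborel) < \<infinity>"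
    using assms by (simp add: set_integrable_def integrable_iff_bounded)
  also have "(\<integral>\<^sup>+r. ennreal (norm (indicator A r *\<^sub>R f r)) \<partial>lborel) = (\<integral>\<^sup>+r. ennreal \<bar>f r\<bar> * indicator A r \<partial>lborel)"
    by (intro nn_integral_cong) (auto simp: indicator_def)
  finally show ?thesis .
qed

text \<open>At 0 the weight gains \<open>\<gamma>\<close> over the singularity of
  \<open>kder\<close>, of which \<open>kder_bound\<close> with loss \<open>\<gamma> / 2\<close>
  leaves the integrable power \<open>\<gamma> / 2 - 1\<close>. At infinity the weight grows more
  slowly than \<open>kder\<close> decays; this matters for even \<open>n\<close>, where the
  integration variable is unbounded even when the distance is not. There the weight is itself a
  nonnegative integral, hence its type.\<close>

lemma kder_near:
  fixes w :: "real \<Rightarrow> ennreal"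
  assumes n: "n \<ge> 2" and p: "p > 0" and \<gamma>: "\<gamma> > 0" and W: "W \<ge> 0" and q: "q < (real n - 1) / 2 + real m"
    and w1: "\<And>r. 0 < r \<Longrightarrow> r \<le> 1 \<Longrightarrow> w r \<le> ennreal (W * r powr (2 * real m + \<gamma>))"
    and w2: "\<And>r. 1 \<le> r \<Longrightarrow> w r \<le> ennreal (W * exp (q * r))"
  shows "\<exists>C<\<infinity>. \<exists>s0>0. \<forall>s. 0 < s \<and> s < s0 \<longrightarrow>
     (\<integral>\<^sup>+r. ennreal \<bar>kder n p m s r\<bar> * w r * indicator {0<..} r \<partial>lborel) \<le> C"
proof -
  define b where "b = (real n - 1) / 2 + real m"
  have "eventually (\<lambda>(s, r). \<bar>kder n p m s r * r powr (1 + s * p / 2) * exp (b * r)\<bar> \<le> kder_lim n m + 1) (at_right 0 \<times>\<^sub>F at_top)"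
    using tendstoD[OF kder_asymp[OF n p, of m] zero_less_one]
    by eventually_elim (use kder_lim_pos[OF n, of m] in \<open>auto simp: dist_real_def b_def\<close>)
  then obtain s1 R0 where 1: "s1 > 0" "\<And>s r. 0 < s \<Longrightarrow> s < s1 \<Longrightarrow> R0 \<le> r \<Longrightarrow>
      \<bar>kder n p m s r * r powr (1 + s * p / 2) * exp (b * r)\<bar> \<le> kder_lim n m + 1"
    by (blast dest: eventually_prod_at_right_at_top)
  define R1 where "R1 = max R0 1"
  define L where "L = kder_lim n m + 1"
  have L0: "L \<ge> 0" using kder_lim_pos[OF n, of m] by (simp add: L_def)
  obtain C s2 where C: "C \<ge> 0" "s2 > 0" "\<And>s r. 0 < s \<Longrightarrow> s < s2 \<Longrightarrow> 0 < r \<Longrightarrow> r \<le> R1 \<Longrightarrow>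
      \<bar>kder n p m s r\<bar> \<le> C * r powr (- 1 - 2 * real m - \<gamma> / 2)"
    using kder_bound[OF n p, of "\<gamma> / 2" R1 m] \<gamma> by auto
  \<comment> \<open>One majorant for all small \<open>s\<close>: the singularity on
    \<open>(0, 1)\<close>, the local bound up to \<open>R1\<close>, and the joint asymptotics
    beyond.\<close>
  define D where "D = (\<lambda>r::real. ennreal \<bar>C * W * r powr (\<gamma> / 2 - 1)\<bar> * indicator {0<..<1} r
     + ennreal (C * W * exp (\<bar>q\<bar> * R1)) * indicator {1..R1} r
     + ennreal \<bar>L * W * exp (- ((b - q) * r))\<bar> * indicator {R1<..} r)"
  have i1: "set_integrable lborel {0<..<1::real} (\<lambda>r. C * W * r powr (\<gamma> / 2 - 1))"
  proof (intro set_integrable_mult_right)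
    show "set_integrable lborel {0<..<1::real} (\<lambda>r. r powr (\<gamma> / 2 - 1))"
    proof (rule set_integral_FTC_Ioo)
      show "((\<lambda>r. r powr (\<gamma> / 2) / (\<gamma> / 2)) has_real_derivative r powr (\<gamma> / 2 - 1)) (at r)" if "0 < r" for r
        using that \<gamma> by (auto intro!: derivative_eq_intros)
      have "((\<lambda>r. r powr (\<gamma> / 2) / (\<gamma> / 2)) \<longlongrightarrow> 0 powr (\<gamma> / 2) / (\<gamma> / 2)) (at_right 0)"
        using \<gamma> by (intro tendsto_intros tendsto_powr2) (auto simp: eventually_at_right_less eventually_at_filter)
      then show "((\<lambda>r. r powr (\<gamma> / 2) / (\<gamma> / 2)) \<longlongrightarrow> 0) (at_right 0)" by simp
      show "((\<lambda>r. r powr (\<gamma> / 2) / (\<gamma> / 2)) \<longlongrightarrow> 1 powr (\<gamma> / 2) / (\<gamma> / 2)) (at_left 1)"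
        using \<gamma> by (intro tendsto_intros) auto
    qed (use \<gamma> in \<open>auto intro!: continuous_intros\<close>)
  qed
  have i3: "set_integrable lborel {R1<..} (\<lambda>r. L * W * exp (- ((b - q) * r)))"
    using q by (intro set_integrable_mult_right set_integral_exp_decay) (simp add: b_def)
  have "(\<integral>\<^sup>+r. D r \<partial>lborel) = (\<integral>\<^sup>+r. ennreal \<bar>C * W * r powr (\<gamma> / 2 - 1)\<bar> * indicator {0<..<1} r \<partial>lborel)
     + (\<integral>\<^sup>+r. ennreal (C * W * exp (\<bar>q\<bar> * R1)) * indicator {1..R1} r \<partial>lborel)
     + (\<integral>\<^sup>+r. ennreal \<bar>L * W * exp (- ((b - q) * r))\<bar> * indicator {R1<..} r \<partial>lborel)"
    unfolding D_def by (simp add: nn_integral_add)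
  also have "\<dots> < \<infinity>"
    using set_integrable_nn_finite[OF i1] set_integrable_nn_finite[OF i3]
    by (simp add: nn_integral_cmult_indicator ennreal_mult_less_top R1_def)
  finally have fin: "(\<integral>\<^sup>+r. D r \<partial>lborel) < \<infinity>" .
  have "(\<integral>\<^sup>+r. ennreal \<bar>kder n p m s r\<bar> * w r * indicator {0<..} r \<partial>lborel) \<le> (\<integral>\<^sup>+r. D r \<partial>lborel)"
    if s: "0 < s" "s < min s1 s2" for s
  proof (rule nn_integral_mono)
    fix r :: real
    consider "r \<le> 0" | "0 < r" "r < 1" | "1 \<le> r" "r \<le> R1" | "r > R1" by linarith
    then show "ennreal \<bar>kder n p m s r\<bar> * w r * indicator {0<..} r \<le> D r"
    proof cases
      case 2
      then have k: "\<bar>kder n p m s r\<bar> \<le> C * r powr (- 1 - 2 * real m - \<gamma> / 2)"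
        using s by (intro C(3)) (auto simp: R1_def)
      have "ennreal \<bar>kder n p m s r\<bar> * w r \<le> ennreal (C * r powr (- 1 - 2 * real m - \<gamma> / 2)) * ennreal (W * r powr (2 * real m + \<gamma>))"
        using 2 by (intro mult_mono ennreal_leI k w1) auto
      also have "\<dots> = ennreal ((C * W) * (r powr (- 1 - 2 * real m - \<gamma> / 2) * r powr (2 * real m + \<gamma>)))"
        using C(1) W by (simp add: ennreal_mult'[symmetric] mult_ac)
      also have "r powr (- 1 - 2 * real m - \<gamma> / 2) * r powr (2 * real m + \<gamma>) = r powr (\<gamma> / 2 - 1)"
        by (simp add: powr_add[symmetric])
      finally show ?thesis using 2 C(1) W by (simp add: D_def R1_def)
    next
      case 3
      then have "\<bar>kder n p m s r\<bar> \<le> C * r powr (- 1 - 2 * real m - \<gamma> / 2)"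
        using s by (intro C(3)) (auto simp: R1_def)
      also have "r powr (- 1 - 2 * real m - \<gamma> / 2) \<le> 1 powr (- 1 - 2 * real m - \<gamma> / 2)"
        using 3 \<gamma> by (intro powr_mono2') auto
      finally have k: "\<bar>kder n p m s r\<bar> \<le> C" using C(1) by (simp add: mult_left_mono)
      have "q * r \<le> \<bar>q\<bar> * R1" using 3 by (intro mult_mono) auto
      then have e: "W * exp (q * r) \<le> W * exp (\<bar>q\<bar> * R1)" using W by (simp add: mult_left_mono)
      have "ennreal \<bar>kder n p m s r\<bar> * w r \<le> ennreal C * ennreal (W * exp (\<bar>q\<bar> * R1))"
        using order_trans[OF w2[OF 3(1)] ennreal_leI[OF e]] by (intro mult_mono ennreal_leI k) auto
      also have "\<dots> = ennreal (C * W * exp (\<bar>q\<bar> * R1))"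
        using C(1) W by (simp add: ennreal_mult'[symmetric] mult_ac)
      finally show ?thesis using 3 by (simp add: D_def)
    next
      case 4
      then have r1: "r \<ge> 1" "R0 \<le> r" by (auto simp: R1_def)
      have "1 \<le> r powr (1 + s * p / 2)" using r1 s p by (intro ge_one_powr_ge_zero) auto
      then have "\<bar>kder n p m s r\<bar> * exp (b * r) * 1 \<le> \<bar>kder n p m s r\<bar> * exp (b * r) * r powr (1 + s * p / 2)"
        by (intro mult_left_mono) auto
      also have "\<dots> \<le> L" using 1(2)[of s r] s r1 by (simp add: abs_mult L_def mult_ac)
      finally have k: "\<bar>kder n p m s r\<bar> \<le> L * exp (- (b * r))" by (simp add: exp_minus field_simps)
      have "ennreal \<bar>kder n p m s r\<bar> * w r \<le> ennreal (L * exp (- (b * r))) * ennreal (W * exp (q * r))"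
        using r1 by (intro mult_mono ennreal_leI k w2) auto
      also have "\<dots> = ennreal ((L * W) * (exp (- (b * r)) * exp (q * r)))"
        using L0 W by (simp add: ennreal_mult'[symmetric] mult_ac)
      also have "exp (- (b * r)) * exp (q * r) = exp (- ((b - q) * r))"
        by (simp add: exp_add[symmetric] algebra_simps)
      finally show ?thesis using 4 r1 L0 W by (simp add: D_def)
    qed auto
  qed
  moreover have "min s1 s2 > 0" using 1 C by simp
  ultimately show ?thesis using fin by blast
qed

section \<open>The kernel constant, and the kernel as a Borel function\<close>

lemma kernel_const_tendsto:
  assumes "n \<ge> 2" "p > 0"
  shows "((\<lambda>s. kernel_const n s p) \<longlongrightarrow> kernel_const n 0 p) (at_right 0)"
  unfolding kernel_const_def
  by (intro tendsto_intros tendsto_powr) (use assms in \<open>auto simp: Gamma_eq_zero_iff nonpos_Ints_def\<close>)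

lemma kernel_const_pos:
  assumes "n \<ge> 2" "p > 0" "s < 1"
  shows "kernel_const n s p > 0"
  unfolding kernel_const_def using assms by (intro divide_pos_pos mult_pos_pos Gamma_real_pos) auto

text \<open>
  Only \<open>0 < \<rho> < r\<close> matters: \<open>sqrt\<close> of a negative number is negative, and \<open>x / 0 = 0\<close>.
\<close>

definition weyl :: "real \<Rightarrow> real \<Rightarrow> real" where
  "weyl r \<rho> = sinh r / sqrt (cosh r - cosh \<rho>)"

lemma weyl_measurable [measurable (raw)]:
  "f \<in> borel_measurable M \<Longrightarrow> g \<in> borel_measurable M \<Longrightarrow> (\<lambda>x. weyl (f x) (g x)) \<in> borel_measurable M"
  unfolding weyl_def
  by (intro borel_measurable_divide borel_measurable_sinh borel_measurable_diff borel_measurable_cosh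
      measurable_compose[OF _ borel_measurable_sqrt])

lemma frac_kernel_odd:
  "odd n \<Longrightarrow> frac_kernel n s p \<rho> = s * kernel_const n s p * kder n p ((n - 1) div 2) s \<rho>"
  by (simp add: frac_kernel_def kder_def)

text \<open>For \<open>\<rho> \<ge> 0\<close> the indicator of the positive axis leaves the integral
  unchanged, but it makes the last factor a Borel function on the whole line.\<close>

lemma frac_kernel_even:
  assumes "even n" "\<rho> \<ge> 0"
  shows "frac_kernel n s p \<rho> = s * kernel_const n s p / sqrt pi *
    (LINT r|lborel. indicator {\<rho><..} r * weyl r \<rho> * (indicator {0<..} r *\<^sub>R kder n p (n div 2) s r))"
proof -
  have "(LBINT r:{\<rho><..}. sinh r / sqrt (cosh r - cosh \<rho>) * (sinh_deriv ^^ (n div 2)) (kernel_profile n s p) r) =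
    (LINT r|lborel. indicator {\<rho><..} r * weyl r \<rho> * (indicator {0<..} r *\<^sub>R kder n p (n div 2) s r))"
    unfolding set_lebesgue_integral_def
    by (rule Bochner_Integration.integral_cong) (use assms in \<open>auto simp: indicator_def weyl_def kder_def\<close>)
  then show ?thesis using assms by (simp add: frac_kernel_def)
qed

lemma kder_borel [measurable]:
  "n \<ge> 2 \<Longrightarrow> (\<lambda>r. indicator {0<..} r *\<^sub>R kder n p m s r) \<in> borel_measurable borel"
  using kder_measurable[of n p m s] by (simp add: set_borel_measurable_def)

lemma frac_kernel_measurable:
  assumes n: "n \<ge> 2"
  shows "(\<lambda>\<rho>. indicator {0<..} \<rho> * frac_kernel n s p \<rho>) \<in> borel_measurable borel"
proof (cases "odd n")
  case True
  have "(\<lambda>\<rho>. s * kernel_const n s p * (indicator {0<..} \<rho> *\<^sub>R kder n p ((n - 1) div 2) s \<rho>)) \<in> borel_measurable borel"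
    using kder_borel[OF n] by measurable
  then show ?thesis using True by (simp add: frac_kernel_odd mult.left_commute)
next
  case False
  define g where "g = (\<lambda>r. indicator {0<..} r *\<^sub>R kder n p (n div 2) s r)"
  have [measurable]: "g \<in> borel_measurable borel" unfolding g_def by (rule kder_borel[OF n])
  have "(\<lambda>\<rho>. indicator {0<..} \<rho> * (s * kernel_const n s p / sqrt pi *
     (LINT r|lborel. indicator {x. \<rho> < x} r * weyl r \<rho> * g r))) \<in> borel_measurable borel"
    unfolding indicator_def by measurable
  then show ?thesis
  proof (rule back_subst[of "\<lambda>f. f \<in> borel_measurable borel"], intro ext)
    fix \<rho> :: real
    show "indicator {0<..} \<rho> * (s * kernel_const n s p / sqrt pi *
      (LINT r|lborel. indicator {x. \<rho> < x} r * weyl r \<rho> * g r)) = indicator {0<..} \<rho> * frac_kernel n s p \<rho>"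
      using False by (cases "\<rho> > 0") (simp_all add: frac_kernel_even g_def greaterThan_def)
  qed
qed

section \<open>The inverse square root weight of even dimensions\<close>

text \<open>The primitive \<open>- 2 * sqrt (cosh r - cosh \<rho>)\<close> is continuous up to
  \<open>\<rho> = r\<close>, so the case \<open>u = r\<close> with its singular endpoint is
  included.\<close>

lemma sinh_weyl_integral:
  assumes "0 \<le> a" "a < u" "u \<le> r"
  shows "set_integrable lborel {a<..<u} (\<lambda>\<rho>. sinh \<rho> / sqrt (cosh r - cosh \<rho>))"
    "(LBINT \<rho>:{a<..<u}. sinh \<rho> / sqrt (cosh r - cosh \<rho>)) = 2 * sqrt (cosh r - cosh a) - 2 * sqrt (cosh r - cosh u)"
proof -
  have lt: "cosh \<rho> < cosh r" if "a < \<rho>" "\<rho> < u" for \<rho>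
    using that assms by (simp add: cosh_real_nonneg_less_iff)
  have d: "((\<lambda>\<rho>. - 2 * sqrt (cosh r - cosh \<rho>)) has_real_derivative sinh \<rho> / sqrt (cosh r - cosh \<rho>)) (at \<rho>)"
    if "a < \<rho>" "\<rho> < u" for \<rho>
    using lt[OF that] by (auto intro!: derivative_eq_intros simp: field_simps)
  have c: "isCont (\<lambda>\<rho>. sinh \<rho> / sqrt (cosh r - cosh \<rho>)) \<rho>" if "a < \<rho>" "\<rho> < u" for \<rho>
    using lt[OF that] by (intro continuous_intros) (auto simp del: cosh_real_eq_iff)
  have pos: "0 \<le> sinh \<rho> / sqrt (cosh r - cosh \<rho>)" if "a < \<rho>" "\<rho> < u" for \<rho>
    using lt[OF that] that assms by (intro divide_nonneg_nonneg) auto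
  have A: "((\<lambda>\<rho>. - 2 * sqrt (cosh r - cosh \<rho>)) \<longlongrightarrow> - 2 * sqrt (cosh r - cosh a)) (at_right a)"
    and B: "((\<lambda>\<rho>. - 2 * sqrt (cosh r - cosh \<rho>)) \<longlongrightarrow> - 2 * sqrt (cosh r - cosh u)) (at_left u)"
    by (intro tendsto_intros)+
  from set_integral_FTC_Ioo[OF assms(2) d c pos A B]
  show "set_integrable lborel {a<..<u} (\<lambda>\<rho>. sinh \<rho> / sqrt (cosh r - cosh \<rho>))"
    "(LBINT \<rho>:{a<..<u}. sinh \<rho> / sqrt (cosh r - cosh \<rho>)) = 2 * sqrt (cosh r - cosh a) - 2 * sqrt (cosh r - cosh u)"
    by auto
qed

text \<open>One factor \<open>sinh \<rho>\<close> is set aside as the numerator for which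
  \<open>sinh_weyl_integral\<close> knows the primitive.\<close>

lemma weyl_power_eq:
  assumes "n \<ge> 2"
  shows "sinh \<rho> ^ (n - 1) * weyl r \<rho> = sinh r * sinh \<rho> ^ (n - 2) * (sinh \<rho> / sqrt (cosh r - cosh \<rho>))"
proof -
  have "n - 1 = Suc (n - 2)" using assms by simp
  then show ?thesis by (simp add: weyl_def)
qed

text \<open>The remaining powers of \<open>sinh \<rho>\<close> in \<open>weyl_power_eq\<close> are
  bounded by those of \<open>sinh r\<close>, which reduces everything to
  \<open>sinh_weyl_integral\<close>.\<close>

lemma weyl_integrable:
  assumes n: "n \<ge> 2" and "0 \<le> a"
  shows "set_integrable lborel {a<..<r} (\<lambda>\<rho>. sinh \<rho> ^ (n - 1) * weyl r \<rho>)"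
    and "\<lbrakk>a < r\<rbrakk> \<Longrightarrow> (LBINT \<rho>:{a<..<r}. sinh \<rho> ^ (n - 1) * weyl r \<rho>) \<le> sinh r ^ (n - 1) * (2 * sqrt (cosh r))"
    and "0 \<le> (LBINT \<rho>:{a<..<r}. sinh \<rho> ^ (n - 1) * weyl r \<rho>)"
proof -
  have lt: "cosh \<rho> < cosh r" if "a < \<rho>" "\<rho> < r" for \<rho>
    using that assms by (simp add: cosh_real_nonneg_less_iff)
  have pos: "0 \<le> sinh \<rho> / sqrt (cosh r - cosh \<rho>)" if "a < \<rho>" "\<rho> < r" for \<rho>
    using lt[OF that] that assms by (intro divide_nonneg_nonneg) auto
  have nn: "0 \<le> sinh \<rho> ^ (n - 1) * weyl r \<rho>" if "a < \<rho>" "\<rho> < r" for \<rho>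
    using lt[OF that] that assms unfolding weyl_def
    by (intro mult_nonneg_nonneg divide_nonneg_nonneg) auto
  have le: "sinh \<rho> ^ (n - 1) * weyl r \<rho> \<le> sinh r ^ (n - 1) * (sinh \<rho> / sqrt (cosh r - cosh \<rho>))"
    if "a < \<rho>" "\<rho> < r" for \<rho>
  proof -
    have "sinh r ^ (n - 1) = sinh r * sinh r ^ (n - 2)"
      using n by (cases n) (auto simp: Suc_diff_Suc power_eq_if)
    moreover have "sinh r * sinh \<rho> ^ (n - 2) \<le> sinh r * sinh r ^ (n - 2)"
      using that assms by (intro mult_left_mono power_mono) auto
    ultimately show ?thesis unfolding weyl_power_eq[OF n] using pos[OF that] by (intro mult_right_mono) auto
  qed
  show int: "set_integrable lborel {a<..<r} (\<lambda>\<rho>. sinh \<rho> ^ (n - 1) * weyl r \<rho>)"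
  proof (cases "a < r")
    case True
    show ?thesis
    proof (rule set_integrable_bound)
      show "set_integrable lborel {a<..<r} (\<lambda>\<rho>. sinh r ^ (n - 1) * (sinh \<rho> / sqrt (cosh r - cosh \<rho>)))"
        using sinh_weyl_integral(1)[of a r r] True assms by (intro set_integrable_mult_right) auto
      show "set_borel_measurable lborel {a<..<r} (\<lambda>\<rho>. sinh \<rho> ^ (n - 1) * weyl r \<rho>)"
        unfolding set_borel_measurable_def by measurable
      show "AE \<rho> in lborel. \<rho> \<in> {a<..<r} \<longrightarrow> norm (sinh \<rho> ^ (n - 1) * weyl r \<rho>) \<le>
          norm (sinh r ^ (n - 1) * (sinh \<rho> / sqrt (cosh r - cosh \<rho>)))"
      proof (intro AE_I2 impI)
        fix \<rho> assume "\<rho> \<in> {a<..<r}"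
        then have \<rho>: "a < \<rho>" "\<rho> < r" by auto
        show "norm (sinh \<rho> ^ (n - 1) * weyl r \<rho>) \<le> norm (sinh r ^ (n - 1) * (sinh \<rho> / sqrt (cosh r - cosh \<rho>)))"
          using le[OF \<rho>] nn[OF \<rho>] unfolding real_norm_def by linarith
      qed
    qed
  qed (simp add: set_integrable_def)
  show "(LBINT \<rho>:{a<..<r}. sinh \<rho> ^ (n - 1) * weyl r \<rho>) \<le> sinh r ^ (n - 1) * (2 * sqrt (cosh r))" if "a < r"
  proof -
    have "(LBINT \<rho>:{a<..<r}. sinh \<rho> ^ (n - 1) * weyl r \<rho>) \<le>
       (LBINT \<rho>:{a<..<r}. sinh r ^ (n - 1) * (sinh \<rho> / sqrt (cosh r - cosh \<rho>)))"
      using sinh_weyl_integral(1)[of a r r] that assms le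
      by (intro set_integral_mono int set_integrable_mult_right) auto
    also have "\<dots> = sinh r ^ (n - 1) * (2 * sqrt (cosh r - cosh a))"
      unfolding set_integral_mult_right using sinh_weyl_integral(2)[of a r r] that assms by simp
    also have "\<dots> \<le> sinh r ^ (n - 1) * (2 * sqrt (cosh r))"
      using that assms cosh_real_nonneg[of a] by (intro mult_left_mono) auto
    finally show ?thesis .
  qed
  show "0 \<le> (LBINT \<rho>:{a<..<r}. sinh \<rho> ^ (n - 1) * weyl r \<rho>)"
    unfolding set_lebesgue_integral_def
    by (intro integral_nonneg_AE AE_I2) (use nn in \<open>auto simp: indicator_def\<close>)
qed

lemma sinh_le_exp: "sinh x \<le> exp x" for x :: real
proof -
  have "exp x - exp (- x) \<le> 2 * exp x" using exp_gt_zero[of x] exp_gt_zero[of "- x"] by linarith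
  then show ?thesis by (simp add: sinh_field_def)
qed

lemma inv_sqrt_exp_integrable:
  "set_integrable lborel {0<..} (\<lambda>h::real. exp (- h) / sqrt (1 - exp (- h)))"
proof (rule set_integral_FTC_Ioi)
  show "((\<lambda>h. 2 * sqrt (1 - exp (- h))) has_real_derivative exp (- h) / sqrt (1 - exp (- h))) (at h)"
    if "0 < h" for h
    using that by (auto intro!: derivative_eq_intros simp: field_simps)
  show "isCont (\<lambda>h::real. exp (- h) / sqrt (1 - exp (- h))) h" if "0 < h" for h
    using that by (intro continuous_intros) auto
  show "0 \<le> exp (- h) / sqrt (1 - exp (- h))" if "0 < h" for h :: real using that by simp
  have "((\<lambda>h. 2 * sqrt (1 - exp (- h))) \<longlongrightarrow> 2 * sqrt (1 - exp (- 0))) (at_right (0::real))"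
    by (intro tendsto_intros)
  then show "((\<lambda>h. 2 * sqrt (1 - exp (- h))) \<longlongrightarrow> 0) (at_right (0::real))" by simp
  show "((\<lambda>h. 2 * sqrt (1 - exp (- h))) \<longlongrightarrow> 2) (at_top :: real filter)" by real_asymp
qed

text \<open>With \<open>\<rho> = r - h\<close> the mass concentrates at bounded \<open>h\<close>.
  The rate \<open>n - 1 / 2\<close> collects \<open>n - 1\<close> from the volume factor, 1 from
  \<open>sinh r\<close> and \<open>- 1 / 2\<close> from the square root. Dominated convergence in
  \<open>h\<close> uses \<open>inv_sqrt_exp_integrable\<close>, and the limit does not depend on
  \<open>R\<close>.\<close>

lemma weyl_weight_asymp:
  assumes n: "n \<ge> 2" and R: "R > 0"
  defines "\<omega> \<equiv> LINT h|lborel. indicator {0<..} h * ((exp (- h) / 2) ^ (n - 1) * (1 / 2) / sqrt ((1 - exp (- h)) / 2))"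
  shows "((\<lambda>r. (LBINT \<rho>:{R<..<r}. sinh \<rho> ^ (n - 1) * weyl r \<rho>) * exp (- ((real n - 1 / 2) * r))) \<longlongrightarrow> \<omega>) at_top"
    and "\<omega> > 0"
proof -
  let ?f = "\<lambda>h::real. indicator {0<..} h * ((exp (- h) / 2) ^ (n - 1) * (1 / 2) / sqrt ((1 - exp (- h)) / 2))"
  let ?s = "\<lambda>r h::real. indicator {0<..<r - R} h * ((sinh (r - h) * exp (- r)) ^ (n - 1) * (sinh r * exp (- r)) /
      sqrt ((cosh r - cosh (r - h)) * exp (- r)))"
  let ?w = "\<lambda>h::real. indicator {0<..} h * (2 * (exp (- h) / sqrt (1 - exp (- h))))"
  have w: "integrable lborel ?w"
    using set_integrable_mult_right[OF inv_sqrt_exp_integrable, of 2] by (simp add: set_integrable_def)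
  have pw: "((\<lambda>r. ?s r h) \<longlongrightarrow> ?f h) at_top" for h
  proof (cases "h > 0")
    case True
    have 1: "((\<lambda>r::real. sinh (r - h) * exp (- r)) \<longlongrightarrow> exp (- h) / 2) at_top"
      unfolding sinh_field_def by (real_asymp simp: exp_minus field_simps)
    have 2: "((\<lambda>r::real. sinh r * exp (- r)) \<longlongrightarrow> 1 / 2) at_top"
      unfolding sinh_field_def by real_asymp
    have 3: "((\<lambda>r::real. (cosh r - cosh (r - h)) * exp (- r)) \<longlongrightarrow> (1 - exp (- h)) / 2) at_top"
    proof -
      have "((\<lambda>r::real. (1 - exp (- h)) * (1 - exp (h - 2 * r)) / 2) \<longlongrightarrow> (1 - exp (- h)) * (1 - 0) / 2) at_top"
        by (intro tendsto_intros) (real_asymp | simp)+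
      moreover have "(cosh r - cosh (r - h)) * exp (- r) = (1 - exp (- h)) * (1 - exp (h - 2 * r)) / 2" for r
        unfolding cosh_field_def by (simp add: field_simps exp_add[symmetric])
      ultimately show ?thesis by (simp only: diff_zero mult_1_right)
    qed
    have "((\<lambda>r. (sinh (r - h) * exp (- r)) ^ (n - 1) * (sinh r * exp (- r)) /
      sqrt ((cosh r - cosh (r - h)) * exp (- r))) \<longlongrightarrow> (exp (- h) / 2) ^ (n - 1) * (1 / 2) / sqrt ((1 - exp (- h)) / 2)) at_top"
      by (intro tendsto_intros 1 2 3) (use True in auto)
    moreover have "((\<lambda>r. indicator {0<..<r - R} h :: real) \<longlongrightarrow> indicator {0<..} h) at_top"
    proof (rule tendsto_eventually)
      show "eventually (\<lambda>r. indicator {0<..<r - R} h = (indicator {0<..} h :: real)) at_top"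
        using eventually_gt_at_top[of "h + R"] by eventually_elim (use True in auto)
    qed
    ultimately show ?thesis by (intro tendsto_mult)
  next
    case False
    then have e: "(\<lambda>r. ?s r h) = (\<lambda>r. 0)" "?f h = 0" by (auto simp: fun_eq_iff indicator_def)
    show ?thesis unfolding e by (rule tendsto_const)
  qed
  have dom: "norm (?s r h) \<le> ?w h" if r: "r \<ge> 1" for r h
  proof (cases "0 < h \<and> h < r - R")
    case True
    have A: "sinh (r - h) * exp (- r) \<le> exp (- h)"
    proof -
      have "sinh (r - h) \<le> exp (r - h)" by (rule sinh_le_exp)
      then have "sinh (r - h) * exp (- r) \<le> exp (r - h) * exp (- r)" by simp
      then show ?thesis by (simp add: exp_add[symmetric])
    qed
    have A0: "0 \<le> sinh (r - h) * exp (- r)" using True R by simp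
    have A2: "(sinh (r - h) * exp (- r)) ^ (n - 1) \<le> exp (- h)"
    proof -
      have "(sinh (r - h) * exp (- r)) ^ (n - 1) \<le> (sinh (r - h) * exp (- r)) ^ 1"
        using A0 A True n by (intro power_decreasing) (auto intro: order_trans)
      then show ?thesis using A by simp
    qed
    have B: "sinh r * exp (- r) \<le> 1"
    proof -
      have "sinh r \<le> exp r" by (rule sinh_le_exp)
      then have "sinh r * exp (- r) \<le> exp r * exp (- r)" by simp
      then show ?thesis by (simp add: exp_add[symmetric])
    qed
    \<comment> \<open>In the factorisation of the cosh difference the second factor is at least 1/2,
      because \<open>h < r - R\<close> and \<open>r \<ge> 1\<close> give
      \<open>h - 2 * r \<le> - 1\<close>.\<close>
    have D: "(1 - exp (- h)) / 4 \<le> (cosh r - cosh (r - h)) * exp (- r)"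
    proof -
      have "(2::real) \<le> exp 1" using exp_ge_add_one_self[of 1] by simp
      then have "exp (- 1) \<le> (1 / 2 :: real)" by (simp add: exp_minus field_simps)
      moreover have "exp (h - 2 * r) \<le> exp (- 1)" using True R r by simp
      ultimately have "1 / 2 \<le> 1 - exp (h - 2 * r)" by linarith
      then have "(1 - exp (- h)) * (1 / 2) \<le> (1 - exp (- h)) * (1 - exp (h - 2 * r))"
        using True by (intro mult_left_mono) auto
      moreover have "(cosh r - cosh (r - h)) * exp (- r) = (1 - exp (- h)) * (1 - exp (h - 2 * r)) / 2"
        unfolding cosh_field_def by (simp add: field_simps exp_add[symmetric])
      ultimately show ?thesis by simp
    qed
    have P: "0 < (1 - exp (- h)) / 4" using True by simp
    have "?s r h \<le> exp (- h) * 1 / sqrt ((1 - exp (- h)) / 4)"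
    proof -
      have "(sinh (r - h) * exp (- r)) ^ (n - 1) * (sinh r * exp (- r)) \<le> exp (- h) * 1"
        using A2 B r by (intro mult_mono) auto
      moreover have "sqrt ((1 - exp (- h)) / 4) \<le> sqrt ((cosh r - cosh (r - h)) * exp (- r))"
        using D by (rule real_sqrt_le_mono)
      ultimately have "(sinh (r - h) * exp (- r)) ^ (n - 1) * (sinh r * exp (- r)) /
          sqrt ((cosh r - cosh (r - h)) * exp (- r)) \<le> exp (- h) * 1 / sqrt ((1 - exp (- h)) / 4)"
        using P by (intro frac_le) auto
      then show ?thesis using True by simp
    qed
    also have "\<dots> = 2 * (exp (- h) / sqrt (1 - exp (- h)))" by (simp add: real_sqrt_divide)
    finally have "?s r h \<le> ?w h" using True by simp
    moreover have "0 \<le> ?s r h"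
    proof -
      have "0 \<le> sqrt ((cosh r - cosh (r - h)) * exp (- r))"
        by (rule real_sqrt_ge_zero) (use D P in linarith)
      then show ?thesis using A0 r True R by (intro mult_nonneg_nonneg divide_nonneg_nonneg zero_le_power) auto
    qed
    ultimately show ?thesis by simp
  qed (auto simp: indicator_def)
  have L: "((\<lambda>r. LINT h|lborel. ?s r h) \<longlongrightarrow> \<omega>) at_top"
    unfolding \<omega>_def
  proof (rule integral_dominated_convergence_at_top[OF _ _ w])
    show "AE h in lborel. ((\<lambda>r. ?s r h) \<longlongrightarrow> ?f h) at_top" using pw by simp
    show "eventually (\<lambda>r. AE h in lborel. norm (?s r h) \<le> ?w h) at_top"
      using eventually_ge_at_top[of 1] by eventually_elim (use dom in simp)
  qed measurable
  have intf: "integrable lborel ?f"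
  proof (rule Bochner_Integration.integrable_bound[OF w])
    show "AE h in lborel. norm (?f h) \<le> norm (?w h)"
    proof (intro AE_I2)
      fix h :: real
      have "norm (?f h) \<le> ?w h"
      proof (rule tendsto_upperbound)
        show "((\<lambda>r. norm (?s r h)) \<longlongrightarrow> norm (?f h)) at_top" by (intro tendsto_norm pw)
        show "eventually (\<lambda>r. norm (?s r h) \<le> ?w h) at_top"
          using eventually_ge_at_top[of 1] by eventually_elim (rule dom)
      qed simp
      also have "?w h \<le> norm (?w h)" unfolding real_norm_def by (rule abs_ge_self)
      finally show "norm (?f h) \<le> norm (?w h)" .
    qed
  qed measurable
  show "\<omega> > 0"
  proof -
    \<comment> \<open>On \<open>0 < h < 1\<close> the exponential is at least
      \<open>exp (- 1)\<close> and the square root at most 1, so \<open>\<delta>\<close> bounds the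
      integrand from below there.\<close>
    define \<delta> :: real where "\<delta> = (exp (- 1) / 2) ^ (n - 1) * (1 / 2)"
    have "0 < (LINT h|lborel. indicator {0<..<1::real} h * \<delta>)" by (simp add: \<delta>_def)
    also have "\<dots> \<le> \<omega>"
      unfolding \<omega>_def
    proof (rule integral_mono[OF _ intf])
      fix h :: real
      show "indicator {0<..<1} h * \<delta> \<le> ?f h"
      proof (cases "0 < h \<and> h < 1")
        case True
        have "sqrt ((1 - exp (- h)) / 2) \<le> 1" 
        proof -
          have "1 - exp (- h) \<le> 2" using exp_gt_zero[of "- h"] by linarith
          then show ?thesis by simp
        qed
        moreover have "0 < sqrt ((1 - exp (- h)) / 2)" using True by simp
        moreover have "\<delta> \<le> (exp (- h) / 2) ^ (n - 1) * (1 / 2)"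
          unfolding \<delta>_def using True by (intro mult_right_mono power_mono) auto
        ultimately have "\<delta> / 1 \<le> (exp (- h) / 2) ^ (n - 1) * (1 / 2) / sqrt ((1 - exp (- h)) / 2)"
          by (intro frac_le) (auto simp: \<delta>_def)
        then show ?thesis using True by simp
      next
        case False
        then show ?thesis by (auto simp: indicator_def)
      qed
    qed simp
    finally show ?thesis .
  qed
  have "(LBINT \<rho>:{R<..<r}. sinh \<rho> ^ (n - 1) * weyl r \<rho>) * exp (- ((real n - 1 / 2) * r)) = (LINT h|lborel. ?s r h)" for r
  proof -
    have "(LBINT \<rho>:{R<..<r}. sinh \<rho> ^ (n - 1) * weyl r \<rho>) =
       \<bar>- 1\<bar> *\<^sub>R (LINT h|lborel. indicator {R<..<r} (r + - 1 * h) *\<^sub>R (sinh (r + - 1 * h) ^ (n - 1) * weyl r (r + - 1 * h)))"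
      unfolding set_lebesgue_integral_def by (rule lborel_integral_real_affine) simp
    also have "\<dots> = (LINT h|lborel. indicator {0<..<r - R} h * (sinh (r - h) ^ (n - 1) * weyl r (r - h)))"
      by (simp, intro Bochner_Integration.integral_cong) (auto simp: indicator_def)
    finally have "(LBINT \<rho>:{R<..<r}. sinh \<rho> ^ (n - 1) * weyl r \<rho>) * exp (- ((real n - 1 / 2) * r)) =
       (LINT h|lborel. indicator {0<..<r - R} h * (sinh (r - h) ^ (n - 1) * weyl r (r - h)) * exp (- ((real n - 1 / 2) * r)))"
      by simp
    also have "\<dots> = (LINT h|lborel. ?s r h)"
    proof (intro Bochner_Integration.integral_cong refl)
      fix h
      have e: "exp (- ((real n - 1 / 2) * r)) = exp (- r) ^ (n - 1) * exp (- r) / sqrt (exp (- r))"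
      proof -
        have "sqrt (exp (- r)) = exp (- r / 2)"
          by (rule real_sqrt_unique) (auto simp: exp_add[symmetric] power2_eq_square)
        then show ?thesis using n
          by (simp add: exp_of_nat_mult[symmetric] exp_add[symmetric] exp_diff[symmetric] of_nat_diff algebra_simps)
      qed
      show "indicator {0<..<r - R} h * (sinh (r - h) ^ (n - 1) * weyl r (r - h)) * exp (- ((real n - 1 / 2) * r)) = ?s r h"
        unfolding e weyl_def real_sqrt_mult power_mult_distrib by simp
    qed
    finally show ?thesis .
  qed
  with L show "((\<lambda>r. (LBINT \<rho>:{R<..<r}. sinh \<rho> ^ (n - 1) * weyl r \<rho>) * exp (- ((real n - 1 / 2) * r))) \<longlongrightarrow> \<omega>) at_top"
    by simp
qed

section \<open>The contribution of a ball vanishes in the limit\<close>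

lemma frac_kernel_near_aux:
  fixes N :: "real \<Rightarrow> ennreal"
  assumes n: "n \<ge> 2" and p: "p > 0" and C: "C < \<infinity>" and s0: "s0 > 0"
    and N: "\<And>s. 0 < s \<Longrightarrow> s < s0 \<Longrightarrow> N s \<le> ennreal (s * kernel_const n s p) * C"
  shows "(N \<longlongrightarrow> 0) (at_right 0)"
proof -
  obtain c where c: "C = ennreal c" "c \<ge> 0" using C by (cases C) auto
  have lim: "((\<lambda>s. ennreal (s * kernel_const n s p * c)) \<longlongrightarrow> ennreal (0 * kernel_const n 0 p * c)) (at_right 0)"
    by (intro tendsto_ennrealI tendsto_intros kernel_const_tendsto n p)
  have ev: "eventually (\<lambda>s::real. 0 < s \<and> s < s0) (at_right 0)"
    using s0 unfolding eventually_at_right_field by auto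
  show ?thesis
  proof (rule tendsto_sandwich[OF _ _ tendsto_const])
    show "((\<lambda>s. ennreal (s * kernel_const n s p * c)) \<longlongrightarrow> 0) (at_right 0)" using lim by simp
    show "eventually (\<lambda>s. N s \<le> ennreal (s * kernel_const n s p * c)) (at_right 0)"
      using ev by eventually_elim (use N c in \<open>simp add: ennreal_mult''\<close>)
  qed simp
qed

text \<open>Here \<open>2 * m = n - 1\<close>, so \<open>sinh \<rho> ^ (n - 1)\<close> compensates
  the \<open>m\<close> derivatives at 0 and \<open>\<rho> powr \<gamma>\<close> is the gain demanded
  by \<open>kder_near\<close>. The weight vanishes beyond \<open>R\<close>, hence the growth rate
  0.\<close>

lemma frac_kernel_near_odd:
  assumes n: "n \<ge> 2" "odd n" and p: "p > 0" and \<gamma>: "\<gamma> > 0" and R: "R > 0"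
  shows "((\<lambda>s. \<integral>\<^sup>+\<rho>. ennreal (\<rho> powr \<gamma> * sinh \<rho> ^ (n - 1) * \<bar>frac_kernel n s p \<rho>\<bar>) * indicator {0<..R} \<rho> \<partial>lborel) \<longlongrightarrow> 0) (at_right 0)"
proof -
  define m where "m = (n - 1) div 2"
  have m: "2 * real m = real n - 1" "2 * m = n - 1" using n by (auto simp: m_def elim!: oddE)
  define w where "w = (\<lambda>r. ennreal (r powr \<gamma> * sinh r ^ (n - 1)) * indicator {0<..R} r)"
  define W where "W = cosh 1 ^ (n - 1) + R powr \<gamma> * sinh R ^ (n - 1)"
  have W1: "cosh 1 ^ (n - 1) \<le> W" "R powr \<gamma> * sinh R ^ (n - 1) \<le> W" "0 \<le> W" using R by (auto simp: W_def)
  have "\<exists>C<\<infinity>. \<exists>s0>0. \<forall>s. 0 < s \<and> s < s0 \<longrightarrow>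
     (\<integral>\<^sup>+r. ennreal \<bar>kder n p m s r\<bar> * w r * indicator {0<..} r \<partial>lborel) \<le> C"
  proof (rule kder_near[OF n(1) p \<gamma> W1(3)])
    show "0 < (real n - 1) / 2 + real m" using n by (simp add: add_pos_nonneg)
    show "w r \<le> ennreal (W * r powr (2 * real m + \<gamma>))" if r: "0 < r" "r \<le> 1" for r
    proof -
      have "sinh r \<le> r * cosh r" using r by (intro sinh_le_mult_cosh) auto
      also have "\<dots> \<le> r * cosh 1" using r by (intro mult_left_mono) (auto simp: cosh_real_nonneg_le_iff)
      finally have "sinh r ^ (n - 1) \<le> (r * cosh 1) ^ (n - 1)" using r by (intro power_mono) auto
      also have "\<dots> \<le> W * r ^ (n - 1)" unfolding power_mult_distrib using W1(1) r by (simp add: mult.commute mult_right_mono)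
      finally have "r powr \<gamma> * sinh r ^ (n - 1) \<le> r powr \<gamma> * (W * r ^ (n - 1))" by (intro mult_left_mono) auto
      also have "r ^ (n - 1) = r powr (2 * real m)" using r unfolding m(2)[symmetric] by (simp add: powr_realpow[symmetric])
      finally have "r powr \<gamma> * sinh r ^ (n - 1) \<le> W * r powr (2 * real m + \<gamma>)" by (simp add: powr_add mult_ac)
      then show ?thesis using W1(3) by (auto simp: w_def indicator_def intro!: ennreal_leI)
    qed
    show "w r \<le> ennreal (W * exp (0 * r))" if "1 \<le> r" for r
    proof (cases "r \<le> R")
      case True
      have "r powr \<gamma> * sinh r ^ (n - 1) \<le> R powr \<gamma> * sinh R ^ (n - 1)"
        using True that \<gamma> by (intro mult_mono powr_mono2 power_mono) auto
      then have "r powr \<gamma> * sinh r ^ (n - 1) \<le> W" using W1(2) by linarith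
      then show ?thesis using W1(3) by (auto simp: w_def indicator_def intro!: ennreal_leI)
    qed (auto simp: w_def)
  qed
  then obtain C s0 where C: "C < \<infinity>" "s0 > 0" "\<And>s. 0 < s \<Longrightarrow> s < s0 \<Longrightarrow>
     (\<integral>\<^sup>+r. ennreal \<bar>kder n p m s r\<bar> * w r * indicator {0<..} r \<partial>lborel) \<le> C" by blast
  show ?thesis
  proof (rule frac_kernel_near_aux[OF n(1) p C(1)])
    show "min s0 1 > 0" using C by simp
    fix s assume s: "0 < s" "s < min s0 1"
    have k: "s * kernel_const n s p \<ge> 0" using s kernel_const_pos[OF n(1) p, of s] by simp
    have "(\<integral>\<^sup>+\<rho>. ennreal (\<rho> powr \<gamma> * sinh \<rho> ^ (n - 1) * \<bar>frac_kernel n s p \<rho>\<bar>) * indicator {0<..R} \<rho> \<partial>lborel)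
      = (\<integral>\<^sup>+r. ennreal (s * kernel_const n s p) * (ennreal \<bar>indicator {0<..} r *\<^sub>R kder n p m s r\<bar> * w r * indicator {0<..} r) \<partial>lborel)"
    proof (rule nn_integral_cong)
      fix r :: real
      show "ennreal (r powr \<gamma> * sinh r ^ (n - 1) * \<bar>frac_kernel n s p r\<bar>) * indicator {0<..R} r =
        ennreal (s * kernel_const n s p) * (ennreal \<bar>indicator {0<..} r *\<^sub>R kder n p m s r\<bar> * w r * indicator {0<..} r)"
      proof (cases "0 < r \<and> r \<le> R")
        case True
        have "\<bar>frac_kernel n s p r\<bar> = (s * kernel_const n s p) * \<bar>kder n p m s r\<bar>"
          using k by (simp add: frac_kernel_odd[OF n(2)] m_def abs_mult[of "s * kernel_const n s p"])
        then have "ennreal (r powr \<gamma> * sinh r ^ (n - 1) * \<bar>frac_kernel n s p r\<bar>) =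
           ennreal ((s * kernel_const n s p) * (\<bar>kder n p m s r\<bar> * (r powr \<gamma> * sinh r ^ (n - 1))))" by (simp add: mult_ac)
        also have "\<dots> = ennreal (s * kernel_const n s p) * (ennreal \<bar>kder n p m s r\<bar> * ennreal (r powr \<gamma> * sinh r ^ (n - 1)))"
          using k True by (simp add: ennreal_mult'[symmetric] mult_ac)
        finally show ?thesis using True by (simp add: w_def)
      qed (auto simp: w_def indicator_def)
    qed
    also have "\<dots> = ennreal (s * kernel_const n s p) * (\<integral>\<^sup>+r. ennreal \<bar>indicator {0<..} r *\<^sub>R kder n p m s r\<bar> * w r * indicator {0<..} r \<partial>lborel)"
      using kder_borel[OF n(1), of p m s] by (intro nn_integral_cmult) (simp add: w_def)
    also have "(\<integral>\<^sup>+r. ennreal \<bar>indicator {0<..} r *\<^sub>R kder n p m s r\<bar> * w r * indicator {0<..} r \<partial>lborel) =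
       (\<integral>\<^sup>+r. ennreal \<bar>kder n p m s r\<bar> * w r * indicator {0<..} r \<partial>lborel)"
      by (intro nn_integral_cong) (auto simp: indicator_def)
    also have "\<dots> \<le> C" using C(3)[of s] s by simp
    finally show "(\<integral>\<^sup>+\<rho>. ennreal (\<rho> powr \<gamma> * sinh \<rho> ^ (n - 1) * \<bar>frac_kernel n s p \<rho>\<bar>) * indicator {0<..R} \<rho> \<partial>lborel)
      \<le> ennreal (s * kernel_const n s p) * C" by (simp add: mult_left_mono)
  qed
qed

lemma sqrt_diff_le:
  fixes A B :: real assumes "0 \<le> B" "B \<le> A" shows "sqrt A - sqrt B \<le> sqrt (A - B)"
proof -
  have "A \<le> (sqrt B + sqrt (A - B))\<^sup>2" using assms by (simp add: power2_sum)
  then have "sqrt A \<le> sqrt B + sqrt (A - B)" using assms by (intro real_le_lsqrt) auto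
  then show ?thesis by simp
qed

lemma sinh_weyl_nn_integral:
  assumes r: "0 < r" and R: "0 < R"
  shows "(\<integral>\<^sup>+\<rho>. ennreal (sinh \<rho> / sqrt (cosh r - cosh \<rho>)) * indicator {0<..<min r R} \<rho> \<partial>lborel)
     = ennreal (2 * sqrt (cosh r - 1) - 2 * sqrt (cosh r - cosh (min r R)))"
proof -
  let ?f = "\<lambda>\<rho>. sinh \<rho> / sqrt (cosh r - cosh \<rho>)"
  note I = sinh_weyl_integral[of 0 "min r R" r]
  have nn: "0 \<le> indicator {0<..<min r R} \<rho> * ?f \<rho>" for \<rho>
    by (cases "\<rho> \<in> {0<..<min r R}") (auto intro!: divide_nonneg_nonneg simp: cosh_real_nonneg_le_iff)
  have "(\<integral>\<^sup>+\<rho>. ennreal (?f \<rho>) * indicator {0<..<min r R} \<rho> \<partial>lborel) = (\<integral>\<^sup>+\<rho>. ennreal (indicator {0<..<min r R} \<rho> * ?f \<rho>) \<partial>lborel)"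
    by (intro nn_integral_cong) (auto simp: indicator_def)
  also have "\<dots> = ennreal (LBINT \<rho>:{0<..<min r R}. ?f \<rho>)"
    using I(1) r R nn unfolding set_lebesgue_integral_def set_integrable_def
    by (subst nn_integral_eq_integral) auto
  finally show ?thesis using I(2) r R by simp
qed

text \<open>Exchanging the integrals moves the Weyl factor into the weight \<open>w r\<close>, an
  integral over \<open>\<rho> < min r R\<close>. Near 0 it is of order
  \<open>r powr (n + \<gamma>)\<close> with \<open>n = 2 * m\<close>: \<open>n - 1\<close> powers
  come from the \<open>sinh\<close> factors and one from the square root. For large \<open>r\<close>
  it is at most of order \<open>exp r\<close>, below the decay rate
  \<open>n - 1 / 2\<close>.\<close>

lemma frac_kernel_near_even:
  assumes n: "n \<ge> 2" "even n" and p: "p > 0" and \<gamma>: "\<gamma> > 0" and R: "R > 0"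
  shows "((\<lambda>s. \<integral>\<^sup>+\<rho>. ennreal (\<rho> powr \<gamma> * sinh \<rho> ^ (n - 1) * \<bar>frac_kernel n s p \<rho>\<bar>) * indicator {0<..R} \<rho> \<partial>lborel) \<longlongrightarrow> 0) (at_right 0)"
proof -
  define m where "m = n div 2"
  have m: "2 * real m = real n" "2 * m = n" using n by (auto simp: m_def elim!: evenE)
  have n1: "n - 1 = Suc (n - 2)" using n by simp
  define w where "w = (\<lambda>r. \<integral>\<^sup>+\<rho>. ennreal (\<rho> powr \<gamma> * sinh \<rho> ^ (n - 1) * weyl r \<rho>) * indicator {0<..<r} \<rho> * indicator {0<..R} \<rho> \<partial>lborel)"
  have wle: "w r \<le> ennreal (min r R powr \<gamma> * (sinh r * sinh (min r R) ^ (n - 2)) * (2 * sqrt (cosh r - 1) - 2 * sqrt (cosh r - cosh (min r R))))"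
    if r: "r > 0" for r
  proof -
    define u where "u = min r R"
    have u: "u > 0" "u \<le> r" "u \<le> R" using r R by (auto simp: u_def)
    have "w r \<le> (\<integral>\<^sup>+\<rho>. ennreal (u powr \<gamma> * (sinh r * sinh u ^ (n - 2))) * (ennreal (sinh \<rho> / sqrt (cosh r - cosh \<rho>)) * indicator {0<..<u} \<rho>) \<partial>lborel)"
      unfolding w_def
    proof (rule nn_integral_mono_AE)
      have "AE \<rho> in lborel. \<rho> \<noteq> R" by (rule AE_lborel_singleton)
      then show "AE \<rho> in lborel. ennreal (\<rho> powr \<gamma> * sinh \<rho> ^ (n - 1) * weyl r \<rho>) * indicator {0<..<r} \<rho> * indicator {0<..R} \<rho> \<le>
         ennreal (u powr \<gamma> * (sinh r * sinh u ^ (n - 2))) * (ennreal (sinh \<rho> / sqrt (cosh r - cosh \<rho>)) * indicator {0<..<u} \<rho>)"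
      proof eventually_elim
        case (elim \<rho>)
        show ?case
        proof (cases "0 < \<rho> \<and> \<rho> < u")
          case True
          have f0: "0 \<le> sinh \<rho> / sqrt (cosh r - cosh \<rho>)"
            using True u by (intro divide_nonneg_nonneg) (auto simp: cosh_real_nonneg_le_iff)
          have "\<rho> powr \<gamma> * sinh \<rho> ^ (n - 1) * weyl r \<rho> = \<rho> powr \<gamma> * (sinh r * sinh \<rho> ^ (n - 2)) * (sinh \<rho> / sqrt (cosh r - cosh \<rho>))"
            by (simp only: mult.assoc weyl_power_eq[OF n(1)])
          also have "\<dots> \<le> u powr \<gamma> * (sinh r * sinh u ^ (n - 2)) * (sinh \<rho> / sqrt (cosh r - cosh \<rho>))"
            using True u \<gamma> r by (intro mult_right_mono mult_mono powr_mono2 power_mono f0) auto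
          finally have "ennreal (\<rho> powr \<gamma> * sinh \<rho> ^ (n - 1) * weyl r \<rho>) \<le> ennreal (u powr \<gamma> * (sinh r * sinh u ^ (n - 2)) * (sinh \<rho> / sqrt (cosh r - cosh \<rho>)))"
            by (rule ennreal_leI)
          also have "\<dots> = ennreal (u powr \<gamma> * (sinh r * sinh u ^ (n - 2))) * ennreal (sinh \<rho> / sqrt (cosh r - cosh \<rho>))"
            using u r f0 by (intro ennreal_mult) auto
          finally show ?thesis using True u by simp
        next
          case False
          then show ?thesis using elim by (auto simp: u_def indicator_def)
        qed
      qed
    qed
    also have "\<dots> = ennreal (u powr \<gamma> * (sinh r * sinh u ^ (n - 2))) * ennreal (2 * sqrt (cosh r - 1) - 2 * sqrt (cosh r - cosh u))"
      using sinh_weyl_nn_integral[OF r R] by (subst nn_integral_cmult) (auto simp: u_def[symmetric] intro!: borel_measurable_sqrt measurable_compose[OF _ borel_measurable_sqrt])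
    also have "\<dots> = ennreal (u powr \<gamma> * (sinh r * sinh u ^ (n - 2)) * (2 * sqrt (cosh r - 1) - 2 * sqrt (cosh r - cosh u)))"
      using u r by (intro ennreal_mult[symmetric]) (auto simp: cosh_real_nonneg_le_iff cosh_real_ge_1)
    finally show ?thesis by (simp add: u_def)
  qed
  define W where "W = cosh 1 ^ (n - 1) * (2 * cosh 1) + R powr \<gamma> * (2 * sqrt (cosh R)) * sinh R ^ (n - 2)"
  have W1: "cosh 1 ^ (n - 1) * (2 * cosh 1) \<le> W" "R powr \<gamma> * (2 * sqrt (cosh R)) * sinh R ^ (n - 2) \<le> W" "0 \<le> W" using R by (auto simp: W_def)
  have "\<exists>C<\<infinity>. \<exists>s0>0. \<forall>s. 0 < s \<and> s < s0 \<longrightarrow>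
     (\<integral>\<^sup>+r. ennreal \<bar>kder n p m s r\<bar> * w r * indicator {0<..} r \<partial>lborel) \<le> C"
  proof (rule kder_near[OF n(1) p \<gamma> W1(3)])
    have "real n \<ge> 2" using n(1) by simp
    then show "1 < (real n - 1) / 2 + real m" using m(1) by (simp add: field_simps)
    show "w r \<le> ennreal (W * r powr (2 * real m + \<gamma>))" if r: "0 < r" "r \<le> 1" for r
    proof -
      have sc: "sinh x \<le> x * cosh 1" if "0 < x" "x \<le> 1" for x :: real
      proof -
        have "sinh x \<le> x * cosh x" using that by (intro sinh_le_mult_cosh) auto
        also have "\<dots> \<le> x * cosh 1" using that by (intro mult_left_mono) (auto simp: cosh_real_nonneg_le_iff)
        finally show ?thesis .
      qed
      have "cosh r - 1 \<le> (2 * sinh (r / 2))\<^sup>2"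
        unfolding cosh_minus_one_eq by (simp add: power_mult_distrib)
      then have "sqrt (cosh r - 1) \<le> 2 * sinh (r / 2)" using r by (intro real_le_lsqrt) auto
      also have "\<dots> \<le> r * cosh 1" using sc[of "r / 2"] r by simp
      finally have q0: "sqrt (cosh r - 1) \<le> r * cosh 1" .
      have q: "2 * sqrt (cosh r - 1) - 2 * sqrt (cosh r - cosh (min r R)) \<le> r * (2 * cosh 1)"
      proof -
        have "0 \<le> sqrt (cosh r - cosh (min r R))"
          using r R by (intro real_sqrt_ge_zero) (auto simp: cosh_real_nonneg_le_iff)
        moreover have "r * (2 * cosh 1) = 2 * (r * cosh 1)" by simp
        ultimately show ?thesis using q0 by linarith
      qed
      have a: "min r R powr \<gamma> \<le> r powr \<gamma>" using r R \<gamma> by (intro powr_mono2) auto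
      have b: "sinh r * sinh (min r R) ^ (n - 2) \<le> r ^ (n - 1) * cosh 1 ^ (n - 1)"
      proof -
        have "sinh r * sinh (min r R) ^ (n - 2) \<le> sinh r * sinh r ^ (n - 2)"
          using r R by (intro mult_left_mono power_mono) auto
        also have "\<dots> = sinh r ^ (n - 1)" unfolding n1 by simp
        also have "\<dots> \<le> (r * cosh 1) ^ (n - 1)" using r sc[of r] by (intro power_mono) auto
        finally show ?thesis by (simp add: power_mult_distrib)
      qed
      have "min r R powr \<gamma> * (sinh r * sinh (min r R) ^ (n - 2)) * (2 * sqrt (cosh r - 1) - 2 * sqrt (cosh r - cosh (min r R)))
         \<le> r powr \<gamma> * (r ^ (n - 1) * cosh 1 ^ (n - 1)) * (r * (2 * cosh 1))"
        using r R by (intro mult_mono a b q) (auto simp: cosh_real_nonneg_le_iff cosh_real_ge_1)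
      also have "\<dots> = (cosh 1 ^ (n - 1) * (2 * cosh 1)) * (r powr \<gamma> * (r ^ (n - 1) * r))" by simp
      also have "r ^ (n - 1) * r = r ^ n" using n by (simp add: power_eq_if)
      also have "r ^ n = r powr (2 * real m)" using r unfolding m(1) by (simp add: powr_realpow)
      also have "(cosh 1 ^ (n - 1) * (2 * cosh 1)) * (r powr \<gamma> * r powr (2 * real m)) \<le> W * (r powr \<gamma> * r powr (2 * real m))"
        by (intro mult_right_mono W1) auto
      also have "\<dots> = W * r powr (2 * real m + \<gamma>)" by (simp add: powr_add mult_ac)
      finally show ?thesis using order_trans[OF wle[OF r(1)] ennreal_leI] by blast
    qed
    show "w r \<le> ennreal (W * exp (1 * r))" if r: "1 \<le> r" for r
    proof -
      have a: "min r R powr \<gamma> \<le> R powr \<gamma>" using r R \<gamma> by (intro powr_mono2) auto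
      have "sinh r \<le> exp r" by (rule sinh_le_exp)
      then have b: "sinh r * sinh (min r R) ^ (n - 2) \<le> exp r * sinh R ^ (n - 2)"
        using r R by (intro mult_mono power_mono) auto
      have q: "2 * sqrt (cosh r - 1) - 2 * sqrt (cosh r - cosh (min r R)) \<le> 2 * sqrt (cosh R)"
      proof -
        \<comment> \<open>Each root grows with \<open>r\<close>; bounding their difference by the
          root of the difference cancels \<open>cosh r\<close> and leaves a quantity depending only
          on \<open>R\<close>.\<close>
        have "sqrt (cosh r - 1) - sqrt (cosh r - cosh (min r R)) \<le> sqrt ((cosh r - 1) - (cosh r - cosh (min r R)))"
          using r R by (intro sqrt_diff_le) (auto simp: cosh_real_nonneg_le_iff cosh_real_ge_1)
        also have "\<dots> \<le> sqrt (cosh R)"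
          using r R by (intro real_sqrt_le_mono) (smt (verit) cosh_real_nonneg_le_iff)
        finally show ?thesis by simp
      qed
      have "min r R powr \<gamma> * (sinh r * sinh (min r R) ^ (n - 2)) * (2 * sqrt (cosh r - 1) - 2 * sqrt (cosh r - cosh (min r R)))
         \<le> R powr \<gamma> * (exp r * sinh R ^ (n - 2)) * (2 * sqrt (cosh R))"
        using r R by (intro mult_mono a b q) (auto simp: cosh_real_nonneg_le_iff cosh_real_ge_1)
      also have "\<dots> = (R powr \<gamma> * (2 * sqrt (cosh R)) * sinh R ^ (n - 2)) * exp r" by simp
      also have "\<dots> \<le> W * exp r" by (intro mult_right_mono W1) auto
      finally have "w r \<le> ennreal (W * exp r)" using order_trans[OF wle[of r] ennreal_leI] r by simp
      then show ?thesis by simp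
    qed
  qed
  then obtain C s0 where C: "C < \<infinity>" "s0 > 0" "\<And>s. 0 < s \<Longrightarrow> s < s0 \<Longrightarrow>
     (\<integral>\<^sup>+r. ennreal \<bar>kder n p m s r\<bar> * w r * indicator {0<..} r \<partial>lborel) \<le> C" by blast
  show ?thesis
  proof (rule frac_kernel_near_aux[OF n(1) p C(1)])
    show "min s0 1 > 0" using C by simp
    fix s assume s: "0 < s" "s < min s0 1"
    define k where "k = s * kernel_const n s p / sqrt pi"
    have sk: "s * kernel_const n s p \<ge> 0" using s kernel_const_pos[OF n(1) p, of s] by simp
    then have k: "k \<ge> 0" by (simp add: k_def)
    define g where "g = (\<lambda>r. indicator {0<..} r *\<^sub>R kder n p m s r)"
    have g_meas [measurable]: "g \<in> borel_measurable borel" unfolding g_def by (rule kder_borel[OF n(1)])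
    let ?h = "\<lambda>\<rho> r. ennreal (\<rho> powr \<gamma> * sinh \<rho> ^ (n - 1)) * indicator {0<..R} \<rho> * (indicator {x. fst x < snd x} (\<rho>, r) * ennreal \<bar>weyl r \<rho> * g r\<bar>)"
    have ptw: "ennreal (\<rho> powr \<gamma> * sinh \<rho> ^ (n - 1) * \<bar>frac_kernel n s p \<rho>\<bar>) * indicator {0<..R} \<rho> \<le> ennreal k * (\<integral>\<^sup>+r. ?h \<rho> r \<partial>lborel)" for \<rho>
    proof (cases "0 < \<rho> \<and> \<rho> \<le> R")
      case True
      let ?I = "LINT r|lborel. indicator {\<rho><..} r * weyl r \<rho> * g r"
      \<comment> \<open>A Bochner integral that does not exist has the value 0, so the estimate
        holds before any integrability is known.\<close>
      have "ennreal \<bar>?I\<bar> \<le> (\<integral>\<^sup>+r. ennreal (norm (indicator {\<rho><..} r * weyl r \<rho> * g r)) \<partial>lborel)"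
      proof (cases "integrable lborel (\<lambda>r. indicator {\<rho><..} r * weyl r \<rho> * g r)")
        case True
        from integral_norm_bound_ennreal[OF this] show ?thesis by simp
      qed (simp add: not_integrable_integral_eq)
      also have "\<dots> = (\<integral>\<^sup>+r. indicator {x. fst x < snd x} (\<rho>, r) * ennreal \<bar>weyl r \<rho> * g r\<bar> \<partial>lborel)"
        by (intro nn_integral_cong) (auto simp: indicator_def)
      finally have I: "ennreal \<bar>?I\<bar> \<le> \<dots>" .
      have "frac_kernel n s p \<rho> = k * ?I"
        unfolding k_def g_def m_def using True by (intro frac_kernel_even n) simp
      then have "\<bar>frac_kernel n s p \<rho>\<bar> = k * \<bar>?I\<bar>"
        by (simp only: abs_mult abs_of_nonneg[OF k])
      then have "ennreal (\<rho> powr \<gamma> * sinh \<rho> ^ (n - 1) * \<bar>frac_kernel n s p \<rho>\<bar>) = ennreal (k * (\<rho> powr \<gamma> * sinh \<rho> ^ (n - 1) * \<bar>?I\<bar>))"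
        by (simp add: mult_ac)
      also have "\<dots> = ennreal k * (ennreal (\<rho> powr \<gamma> * sinh \<rho> ^ (n - 1)) * ennreal \<bar>?I\<bar>)"
        using k True by (simp add: ennreal_mult'[symmetric])
      also have "\<dots> \<le> ennreal k * (ennreal (\<rho> powr \<gamma> * sinh \<rho> ^ (n - 1)) * (\<integral>\<^sup>+r. indicator {x. fst x < snd x} (\<rho>, r) * ennreal \<bar>weyl r \<rho> * g r\<bar> \<partial>lborel))"
        by (intro mult_left_mono I) auto
      also have "ennreal (\<rho> powr \<gamma> * sinh \<rho> ^ (n - 1)) * (\<integral>\<^sup>+r. indicator {x. fst x < snd x} (\<rho>, r) * ennreal \<bar>weyl r \<rho> * g r\<bar> \<partial>lborel) =
         (\<integral>\<^sup>+r. ?h \<rho> r \<partial>lborel)"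
        using True by (subst nn_integral_cmult[symmetric]) auto
      finally show ?thesis using True by simp
    qed simp
    have h_meas: "(\<lambda>(\<rho>, r). ?h \<rho> r) \<in> borel_measurable (lborel \<Otimes>\<^sub>M lborel)"
      unfolding case_prod_beta by measurable
    have "(\<integral>\<^sup>+\<rho>. ennreal (\<rho> powr \<gamma> * sinh \<rho> ^ (n - 1) * \<bar>frac_kernel n s p \<rho>\<bar>) * indicator {0<..R} \<rho> \<partial>lborel)
      \<le> (\<integral>\<^sup>+\<rho>. ennreal k * (\<integral>\<^sup>+r. ?h \<rho> r \<partial>lborel) \<partial>lborel)"
      by (intro nn_integral_mono ptw)
    also have "\<dots> = ennreal k * (\<integral>\<^sup>+\<rho>. \<integral>\<^sup>+r. ?h \<rho> r \<partial>lborel \<partial>lborel)"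
      using h_meas by (intro nn_integral_cmult lborel.borel_measurable_nn_integral) simp
    also have "(\<integral>\<^sup>+\<rho>. \<integral>\<^sup>+r. ?h \<rho> r \<partial>lborel \<partial>lborel) = (\<integral>\<^sup>+r. \<integral>\<^sup>+\<rho>. ?h \<rho> r \<partial>lborel \<partial>lborel)"
      using lborel_pair.Fubini'[OF h_meas] by simp
    also have "\<dots> = (\<integral>\<^sup>+r. ennreal \<bar>kder n p m s r\<bar> * w r * indicator {0<..} r \<partial>lborel)"
    proof (rule nn_integral_cong)
      fix r :: real
      have "(\<integral>\<^sup>+\<rho>. ?h \<rho> r \<partial>lborel) = (\<integral>\<^sup>+\<rho>. ennreal \<bar>g r\<bar> * (ennreal (\<rho> powr \<gamma> * sinh \<rho> ^ (n - 1) * weyl r \<rho>) * indicator {0<..<r} \<rho> * indicator {0<..R} \<rho>) \<partial>lborel)"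
      proof (rule nn_integral_cong)
        fix \<rho> :: real
        show "?h \<rho> r = ennreal \<bar>g r\<bar> * (ennreal (\<rho> powr \<gamma> * sinh \<rho> ^ (n - 1) * weyl r \<rho>) * indicator {0<..<r} \<rho> * indicator {0<..R} \<rho>)"
        proof (cases "0 < \<rho> \<and> \<rho> < r \<and> \<rho> \<le> R")
          case True
          then have w0: "weyl r \<rho> \<ge> 0" unfolding weyl_def by (intro divide_nonneg_nonneg) (auto simp: cosh_real_nonneg_le_iff)
          have "ennreal (\<rho> powr \<gamma> * sinh \<rho> ^ (n - 1)) * ennreal \<bar>weyl r \<rho> * g r\<bar> =
             ennreal \<bar>g r\<bar> * ennreal (\<rho> powr \<gamma> * sinh \<rho> ^ (n - 1) * weyl r \<rho>)"
            using True w0 by (simp add: ennreal_mult'[symmetric] abs_mult mult_ac)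
          then show ?thesis using True by simp
        qed (auto simp: indicator_def)
      qed
      also have "\<dots> = ennreal \<bar>g r\<bar> * w r" unfolding w_def by (rule nn_integral_cmult) measurable
      finally show "(\<integral>\<^sup>+\<rho>. ?h \<rho> r \<partial>lborel) = ennreal \<bar>kder n p m s r\<bar> * w r * indicator {0<..} r"
        by (auto simp: g_def indicator_def)
    qed
    also have "\<dots> \<le> C" using C(3)[of s] s by simp
    also have "ennreal k * C \<le> ennreal (s * kernel_const n s p) * C"
    proof (intro mult_right_mono ennreal_leI)
      have "1 \<le> sqrt pi" using pi_gt3 by simp
      then have "s * kernel_const n s p / sqrt pi \<le> s * kernel_const n s p / 1"
        using sk by (intro divide_left_mono) auto
      then show "k \<le> s * kernel_const n s p" by (simp add: k_def)
    qed simp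
    finally show "(\<integral>\<^sup>+\<rho>. ennreal (\<rho> powr \<gamma> * sinh \<rho> ^ (n - 1) * \<bar>frac_kernel n s p \<rho>\<bar>) * indicator {0<..R} \<rho> \<partial>lborel)
      \<le> ennreal (s * kernel_const n s p) * C" by (simp add: mult_left_mono)
  qed
qed

section \<open>The mass of the kernel outside a ball\<close>

text \<open>Since \<open>(n - 1) / 2 + m = n - 1\<close>, the decay of \<open>kder\<close> exactly
  absorbs the growth of the volume, with limiting ratio \<open>(1 / 2) ^ (n - 1)\<close>. The
  constant is chosen before \<open>R\<close> because \<open>R\<close> will depend on
  \<open>f\<close> and \<open>x\<close>.\<close>

lemma frac_kernel_tail_odd:
  assumes n: "n \<ge> 2" "odd n" and p: "p > 0"
  shows "\<exists>A>0. \<forall>R>0. eventually (\<lambda>s. set_integrable lborel {R<..} (\<lambda>\<rho>. frac_kernel n s p \<rho> * sinh \<rho> ^ (n - 1))) (at_right 0) \<and>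
     ((\<lambda>s. LBINT \<rho>:{R<..}. frac_kernel n s p \<rho> * sinh \<rho> ^ (n - 1)) \<longlongrightarrow> A) (at_right 0)"
proof (intro exI conjI allI impI)
  define m where "m = (n - 1) div 2"
  have m: "(real n - 1) / 2 + real m = real (n - 1)" using n by (auto simp: m_def elim!: oddE)
  define L where "L = kder_lim n m * (1 / 2) ^ (n - 1)"
  have "L > 0" using kder_lim_pos[OF n(1), of m] by (simp add: L_def)
  then show "kernel_const n 0 p * (2 * L / p) > 0"
    using kernel_const_pos[OF n(1) p, of 0] p by simp
  fix R :: real assume R: "R > 0"
  have "((\<lambda>r::real. (sinh r * exp (- r)) ^ (n - 1)) \<longlongrightarrow> (1 / 2) ^ (n - 1)) at_top"
    unfolding sinh_field_def by (intro tendsto_power) real_asymp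
  then have lim: "((\<lambda>r. sinh r ^ (n - 1) * exp (- (((real n - 1) / 2 + real m) * r))) \<longlongrightarrow> (1 / 2) ^ (n - 1)) at_top"
    unfolding m power_mult_distrib by (simp only: exp_of_nat_mult[symmetric] mult_minus_right)
  have loc: "\<exists>C. \<forall>r. R < r \<and> r \<le> R1 \<longrightarrow> \<bar>sinh r ^ (n - 1)\<bar> \<le> C" for R1
  proof (intro exI allI impI)
    fix r assume "R < r \<and> r \<le> R1"
    then show "\<bar>sinh r ^ (n - 1)\<bar> \<le> sinh R1 ^ (n - 1)" using R by (auto simp: power_abs[symmetric] intro!: power_mono)
  qed
  have meas: "set_borel_measurable lborel {R<..} (\<lambda>r. sinh r ^ (n - 1))"
    by (intro set_borel_measurable_continuous_lborel continuous_intros) auto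
  note T = kder_tail[OF n(1) p R meas lim loc]
  have e: "frac_kernel n s p \<rho> * sinh \<rho> ^ (n - 1) = (s * kernel_const n s p) * (kder n p m s \<rho> * sinh \<rho> ^ (n - 1))" for s \<rho>
    by (simp add: frac_kernel_odd[OF n(2)] m_def)
  show "eventually (\<lambda>s. set_integrable lborel {R<..} (\<lambda>\<rho>. frac_kernel n s p \<rho> * sinh \<rho> ^ (n - 1))) (at_right 0)"
    using T(1) unfolding e by eventually_elim (rule set_integrable_mult_right)
  have "((\<lambda>s. kernel_const n s p * (s * (LBINT r:{R<..}. kder n p m s r * sinh r ^ (n - 1)))) \<longlongrightarrow> kernel_const n 0 p * (2 * L / p)) (at_right 0)"
    unfolding L_def by (intro tendsto_mult kernel_const_tendsto n p T(2))
  then show "((\<lambda>s. LBINT \<rho>:{R<..}. frac_kernel n s p \<rho> * sinh \<rho> ^ (n - 1)) \<longlongrightarrow> kernel_const n 0 p * (2 * L / p)) (at_right 0)"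
    unfolding e set_integral_mult_right by (simp only: mult_ac)
qed

text \<open>On the triangle \<open>R < \<rho> < r\<close> the Weyl factor is nonnegative, so
  integrating the norm over \<open>\<rho>\<close> gives exactly \<open>norm (g r * w r)\<close>. The
  assumed integrability is therefore the one that Fubini's theorem demands.\<close>

lemma weyl_Fubini:
  fixes g :: "real \<Rightarrow> real"
  assumes n: "n \<ge> 2" and R: "R > 0" and [measurable]: "g \<in> borel_measurable borel"
  defines "w \<equiv> \<lambda>r. LBINT \<rho>:{R<..<r}. sinh \<rho> ^ (n - 1) * weyl r \<rho>"
  assumes int: "set_integrable lborel {R<..} (\<lambda>r. g r * w r)"
  shows "set_integrable lborel {R<..} (\<lambda>\<rho>. (LINT r|lborel. indicator {\<rho><..} r * weyl r \<rho> * g r) * sinh \<rho> ^ (n - 1))"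
    and "(LBINT \<rho>:{R<..}. (LINT r|lborel. indicator {\<rho><..} r * weyl r \<rho> * g r) * sinh \<rho> ^ (n - 1)) = (LBINT r:{R<..}. g r * w r)"
proof -
  let ?F = "\<lambda>r \<rho>. g r * (indicator {x. R < snd x \<and> snd x < fst x} (r, \<rho>) * (sinh \<rho> ^ (n - 1) * weyl r \<rho>))"
  have F: "?F r \<rho> = g r * (indicator {R<..<r} \<rho> *\<^sub>R (sinh \<rho> ^ (n - 1) * weyl r \<rho>))" for r \<rho>
    by (auto simp: indicator_def)
  have Fm: "(\<lambda>(r, \<rho>). ?F r \<rho>) \<in> borel_measurable (lborel \<Otimes>\<^sub>M lborel)"
    unfolding case_prod_beta by measurable
  have nn: "0 \<le> indicator {R<..<r} \<rho> *\<^sub>R (sinh \<rho> ^ (n - 1) * weyl r \<rho>)" for r \<rho>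
    using R by (auto simp: indicator_def weyl_def cosh_real_nonneg_le_iff intro!: mult_nonneg_nonneg divide_nonneg_nonneg)
  have w0: "w r = 0" if "r \<le> R" for r using that by (simp add: w_def set_lebesgue_integral_def)
  have iF: "integrable lborel (\<lambda>\<rho>. ?F r \<rho>)" for r
    unfolding F using weyl_integrable(1)[OF n, of R r] R by (intro integrable_mult_right) (simp add: set_integrable_def)
  have inF: "(LINT \<rho>|lborel. ?F r \<rho>) = indicator {R<..} r *\<^sub>R (g r * w r)" for r
    unfolding F using w0[of r] by (auto simp: w_def set_lebesgue_integral_def indicator_def[of "{R<..}"])
  have nF: "(LINT \<rho>|lborel. norm (?F r \<rho>)) = norm (indicator {R<..} r *\<^sub>R (g r * w r))" for r
  proof -
    have "(LINT \<rho>|lborel. norm (?F r \<rho>)) = (LINT \<rho>|lborel. \<bar>g r\<bar> * (indicator {R<..<r} \<rho> *\<^sub>R (sinh \<rho> ^ (n - 1) * weyl r \<rho>)))"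
      unfolding F norm_mult by (simp only: real_norm_def abs_of_nonneg[OF nn])
    also have "\<dots> = \<bar>g r\<bar> * w r" by (simp add: w_def set_lebesgue_integral_def)
    also have "\<dots> = norm (indicator {R<..} r *\<^sub>R (g r * w r))"
      using w0[of r] weyl_integrable(3)[OF n, of R r] R by (cases "r > R") (auto simp: abs_mult w_def)
    finally show ?thesis .
  qed
  have "integrable (lborel \<Otimes>\<^sub>M lborel) (\<lambda>(r, \<rho>). ?F r \<rho>)"
  proof (rule lborel_pair.Fubini_integrable[OF Fm])
    show "integrable lborel (\<lambda>x. LINT y|lborel. norm (case (x, y) of (r, \<rho>) \<Rightarrow> ?F r \<rho>))"
      using int unfolding prod.case nF set_integrable_def by (rule integrable_norm)
    show "AE x in lborel. integrable lborel (\<lambda>y. case (x, y) of (r, \<rho>) \<Rightarrow> ?F r \<rho>)" using iF by simp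
  qed
  note I = this
  have sec: "(LINT r|lborel. ?F r \<rho>) = indicator {R<..} \<rho> *\<^sub>R ((LINT r|lborel. indicator {\<rho><..} r * weyl r \<rho> * g r) * sinh \<rho> ^ (n - 1))" for \<rho>
  proof -
    have "(LINT r|lborel. ?F r \<rho>) = (LINT r|lborel. indicator {R<..} \<rho> * ((indicator {\<rho><..} r * weyl r \<rho> * g r) * sinh \<rho> ^ (n - 1)))"
      by (intro Bochner_Integration.integral_cong) (auto simp: indicator_def)
    then show ?thesis by simp
  qed
  show "set_integrable lborel {R<..} (\<lambda>\<rho>. (LINT r|lborel. indicator {\<rho><..} r * weyl r \<rho> * g r) * sinh \<rho> ^ (n - 1))"
    unfolding set_integrable_def sec[symmetric] using lborel_pair.integrable_snd[OF I] by simp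
  have "(LINT \<rho>|lborel. LINT r|lborel. ?F r \<rho>) = (LINT r|lborel. LINT \<rho>|lborel. ?F r \<rho>)"
    by (rule lborel_pair.Fubini_integral[OF I])
  then show "(LBINT \<rho>:{R<..}. (LINT r|lborel. indicator {\<rho><..} r * weyl r \<rho> * g r) * sinh \<rho> ^ (n - 1)) = (LBINT r:{R<..}. g r * w r)"
    unfolding sec inF set_lebesgue_integral_def .
qed

text \<open>After \<open>weyl_Fubini\<close> the weight is that of \<open>weyl_weight_asymp\<close>,
  whose rate \<open>n - 1 / 2\<close> equals \<open>(n - 1) / 2 + m\<close> for
  \<open>m = n div 2\<close>.\<close>

lemma frac_kernel_tail_even:
  assumes n: "n \<ge> 2" "even n" and p: "p > 0"
  shows "\<exists>A>0. \<forall>R>0. eventually (\<lambda>s. set_integrable lborel {R<..} (\<lambda>\<rho>. frac_kernel n s p \<rho> * sinh \<rho> ^ (n - 1))) (at_right 0) \<and>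
     ((\<lambda>s. LBINT \<rho>:{R<..}. frac_kernel n s p \<rho> * sinh \<rho> ^ (n - 1)) \<longlongrightarrow> A) (at_right 0)"
proof -
  define m where "m = n div 2"
  have m: "(real n - 1) / 2 + real m = real n - 1 / 2" using n by (auto simp: m_def elim!: evenE)
  define \<omega> where "\<omega> = (LINT h|lborel. indicator {0<..} h * ((exp (- h) / 2) ^ (n - 1) * (1 / 2) / sqrt ((1 - exp (- h)) / 2 :: real)))"
  \<comment> \<open>The integral \<open>\<omega>\<close> contains no radius, so the lemma may be
    used with radius 1 here and with the actual \<open>R\<close> below.\<close>
  have "\<omega> > 0" using weyl_weight_asymp(2)[OF n(1) zero_less_one] by (simp add: \<omega>_def)
  define A where "A = kernel_const n 0 p / sqrt pi * (2 * (kder_lim n m * \<omega>) / p)"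
  have "A > 0" using kder_lim_pos[OF n(1), of m] kernel_const_pos[OF n(1) p, of 0] p \<open>\<omega> > 0\<close> by (simp add: A_def)
  moreover have "eventually (\<lambda>s. set_integrable lborel {R<..} (\<lambda>\<rho>. frac_kernel n s p \<rho> * sinh \<rho> ^ (n - 1))) (at_right 0) \<and>
     ((\<lambda>s. LBINT \<rho>:{R<..}. frac_kernel n s p \<rho> * sinh \<rho> ^ (n - 1)) \<longlongrightarrow> A) (at_right 0)" if R: "R > 0" for R
  proof -
    define w where "w = (\<lambda>r. LBINT \<rho>:{R<..<r}. sinh \<rho> ^ (n - 1) * weyl r \<rho>)"
    define g where "g = (\<lambda>s r. indicator {0<..} r *\<^sub>R kder n p m s r)"
    have g_meas: "g s \<in> borel_measurable borel" for s unfolding g_def by (rule kder_borel[OF n(1)])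
    have lim: "((\<lambda>r. w r * exp (- (((real n - 1) / 2 + real m) * r))) \<longlongrightarrow> \<omega>) at_top"
      unfolding m w_def \<omega>_def by (rule weyl_weight_asymp(1)[OF n(1) R])
    have loc: "\<exists>C. \<forall>r. R < r \<and> r \<le> R1 \<longrightarrow> \<bar>w r\<bar> \<le> C" for R1
    proof (intro exI allI impI)
      fix r assume r: "R < r \<and> r \<le> R1"
      have "\<bar>w r\<bar> \<le> sinh r ^ (n - 1) * (2 * sqrt (cosh r))"
        using weyl_integrable(2,3)[OF n(1), of R r] R r by (simp add: w_def)
      also have "\<dots> \<le> sinh R1 ^ (n - 1) * (2 * sqrt (cosh R1))"
        using R r by (intro mult_mono power_mono real_sqrt_le_mono) (auto simp: cosh_real_nonneg_le_iff)
      finally show "\<bar>w r\<bar> \<le> sinh R1 ^ (n - 1) * (2 * sqrt (cosh R1))" .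
    qed
    have "(\<lambda>r. LINT \<rho>|lborel. indicator {x. R < x \<and> x < r} \<rho> * (sinh \<rho> ^ (n - 1) * weyl r \<rho>)) \<in> borel_measurable borel"
      unfolding indicator_def by measurable
    then have [measurable]: "w \<in> borel_measurable borel"
      by (simp add: w_def set_lebesgue_integral_def greaterThanLessThan_def greaterThan_def lessThan_def Int_def)
    have meas: "set_borel_measurable lborel {R<..} w" unfolding set_borel_measurable_def by measurable
    note T = kder_tail[OF n(1) p R meas lim loc]
    have c1: "set_integrable lborel {R<..} (\<lambda>r. kder n p m s r * w r) = set_integrable lborel {R<..} (\<lambda>r. g s r * w r)" for s
      by (rule set_integrable_cong) (use R in \<open>auto simp: g_def\<close>)
    have c2: "(LBINT r:{R<..}. kder n p m s r * w r) = (LBINT r:{R<..}. g s r * w r)" for s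
      by (rule set_lebesgue_integral_cong) (use R in \<open>auto simp: g_def\<close>)
    define I where "I = (\<lambda>s \<rho>. LINT r|lborel. indicator {\<rho><..} r * weyl r \<rho> * g s r)"
    have e: "frac_kernel n s p \<rho> * sinh \<rho> ^ (n - 1) = (s * kernel_const n s p / sqrt pi) * (I s \<rho> * sinh \<rho> ^ (n - 1))" if "\<rho> \<in> {R<..}" for s \<rho>
      using frac_kernel_even[OF n(2), of \<rho> s p] that R by (simp add: I_def g_def m_def)
    have e1: "set_integrable lborel {R<..} (\<lambda>\<rho>. frac_kernel n s p \<rho> * sinh \<rho> ^ (n - 1)) =
       set_integrable lborel {R<..} (\<lambda>\<rho>. (s * kernel_const n s p / sqrt pi) * (I s \<rho> * sinh \<rho> ^ (n - 1)))" for s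
      by (rule set_integrable_cong) (use e in auto)
    have e2: "(LBINT \<rho>:{R<..}. frac_kernel n s p \<rho> * sinh \<rho> ^ (n - 1)) =
       (s * kernel_const n s p / sqrt pi) * (LBINT \<rho>:{R<..}. I s \<rho> * sinh \<rho> ^ (n - 1))" for s
      unfolding set_integral_mult_right[symmetric] by (rule set_lebesgue_integral_cong) (use e in auto)
    have F: "set_integrable lborel {R<..} (\<lambda>\<rho>. I s \<rho> * sinh \<rho> ^ (n - 1))"
      "(LBINT \<rho>:{R<..}. I s \<rho> * sinh \<rho> ^ (n - 1)) = (LBINT r:{R<..}. g s r * w r)"
      if "set_integrable lborel {R<..} (\<lambda>r. g s r * w r)" for s
      using weyl_Fubini[OF n(1) R g_meas[of s]] that unfolding w_def I_def by blast+
    have "eventually (\<lambda>s. set_integrable lborel {R<..} (\<lambda>\<rho>. frac_kernel n s p \<rho> * sinh \<rho> ^ (n - 1))) (at_right 0)"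
      using T(1) unfolding c1 e1 by eventually_elim (intro set_integrable_mult_right F(1))
    moreover have "((\<lambda>s. LBINT \<rho>:{R<..}. frac_kernel n s p \<rho> * sinh \<rho> ^ (n - 1)) \<longlongrightarrow> A) (at_right 0)"
    proof (rule Lim_transform_eventually)
      show "((\<lambda>s. kernel_const n s p / sqrt pi * (s * (LBINT r:{R<..}. kder n p m s r * w r))) \<longlongrightarrow> A) (at_right 0)"
        unfolding A_def by (intro tendsto_mult tendsto_divide tendsto_const kernel_const_tendsto n p T(2)) simp
      show "eventually (\<lambda>s. kernel_const n s p / sqrt pi * (s * (LBINT r:{R<..}. kder n p m s r * w r)) =
         (LBINT \<rho>:{R<..}. frac_kernel n s p \<rho> * sinh \<rho> ^ (n - 1))) (at_right 0)"
        using T(1) unfolding c1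
      proof eventually_elim
        case (elim s)
        show ?case unfolding e2 c2 F(2)[OF elim] by simp
      qed
    qed
    ultimately show ?thesis ..
  qed
  ultimately show ?thesis by blast
qed

lemma frac_kernel_tail:
  assumes "n \<ge> 2" "p > 0"
  shows "\<exists>A>0. \<forall>R>0. eventually (\<lambda>s. set_integrable lborel {R<..} (\<lambda>\<rho>. frac_kernel n s p \<rho> * sinh \<rho> ^ (n - 1))) (at_right 0) \<and>
     ((\<lambda>s. LBINT \<rho>:{R<..}. frac_kernel n s p \<rho> * sinh \<rho> ^ (n - 1)) \<longlongrightarrow> A) (at_right 0)"
  using frac_kernel_tail_odd frac_kernel_tail_even assms by (cases "even n") auto

lemma frac_kernel_near:
  assumes "n \<ge> 2" "p > 0" "\<gamma> > 0" "R > 0"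
  shows "((\<lambda>s. \<integral>\<^sup>+\<rho>. ennreal (\<rho> powr \<gamma> * sinh \<rho> ^ (n - 1) * \<bar>frac_kernel n s p \<rho>\<bar>) * indicator {0<..R} \<rho> \<partial>lborel) \<longlongrightarrow> 0) (at_right 0)"
  using frac_kernel_near_odd frac_kernel_near_even assms by (cases "even n") auto

section \<open>Polar coordinates and linear involutions\<close>

lemma nn_set_integral_eq:
  fixes f :: "real \<Rightarrow> real"
  assumes "set_integrable lborel A f" "\<And>x. x \<in> A \<Longrightarrow> 0 \<le> f x"
  shows "(\<integral>\<^sup>+x. ennreal (f x) * indicator A x \<partial>lborel) = ennreal (LBINT x:A. f x)"
proof -
  have "(\<integral>\<^sup>+x. ennreal (f x) * indicator A x \<partial>lborel) = (\<integral>\<^sup>+x. ennreal (indicator A x *\<^sub>R f x) \<partial>lborel)"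
    by (intro nn_integral_cong) (auto simp: indicator_def)
  also have "\<dots> = ennreal (LBINT x:A. f x)"
    using assms unfolding set_lebesgue_integral_def set_integrable_def
    by (subst nn_integral_eq_integral) (auto simp: indicator_def)
  finally show ?thesis .
qed

lemma nn_integral_lborel_scale:
  fixes h :: "'a::euclidean_space \<Rightarrow> ennreal"
  assumes [measurable]: "h \<in> borel_measurable borel" and c: "c \<noteq> 0"
  shows "(\<integral>\<^sup>+x. h x \<partial>lborel) = ennreal (\<bar>c\<bar> ^ DIM('a)) * (\<integral>\<^sup>+x. h (t + c *\<^sub>R x) \<partial>lborel)"
  by (subst lborel_affine[OF c, of t])
    (simp add: nn_integral_density nn_integral_distr nn_integral_cmult)

lemma nn_integral_lborel_shift:
  fixes h :: "'a::euclidean_space \<Rightarrow> ennreal"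
  assumes "h \<in> borel_measurable borel"
  shows "(\<integral>\<^sup>+x. h (t + x) \<partial>lborel) = (\<integral>\<^sup>+x. h x \<partial>lborel)"
  using nn_integral_lborel_scale[OF assms, of 1 t] by simp

lemma nn_integral_lborel_reflect:
  fixes h :: "'a::euclidean_space \<Rightarrow> ennreal"
  assumes "h \<in> borel_measurable borel"
  shows "(\<integral>\<^sup>+x. h (t - x) \<partial>lborel) = (\<integral>\<^sup>+x. h x \<partial>lborel)"
  using nn_integral_lborel_scale[OF assms, of "- 1" t] by simp

text \<open>
  Uniqueness of Haar measure by Fubini: \<open>\<mu>(A) \<lambda>(B) = \<mu>(B) \<lambda>(A)\<close> for \<open>\<mu> = L\<^sub>*\<lambda>\<close>. A set \<open>B\<close> with
  \<open>L\<^sup>-\<^sup>1(B) = B\<close> and \<open>0 < \<lambda>(B) < \<infinity>\<close> then gives \<open>\<mu> = \<lambda>\<close>, without determinants.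
\<close>

lemma lborel_linear_involution:
  fixes L :: "'a::euclidean_space \<Rightarrow> 'a"
  assumes lin: "linear L" and inv: "\<And>x. L (L x) = x"
  shows "distr lborel borel L = lborel"
proof -
  have cont: "continuous_on UNIV L" using lin by (rule linear_continuous_on_compose[OF continuous_on_id, simplified])
  then have [measurable]: "L \<in> borel_measurable borel" by (rule borel_measurable_continuous_onI)
  have swap: "emeasure (distr lborel borel L) A * emeasure lborel B = emeasure (distr lborel borel L) B * emeasure lborel A"
    if [measurable]: "A \<in> sets borel" "B \<in> sets borel" for A B :: "'a set"
  proof -
    let ?one = "\<lambda>A x. indicator A x :: ennreal"
    have \<mu>: "emeasure (distr lborel borel L) A = (\<integral>\<^sup>+x. ?one A (L x) \<partial>lborel)" if "A \<in> sets borel" for A :: "'a set"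
    proof -
      have "emeasure (distr lborel borel L) A = (\<integral>\<^sup>+x. ?one A x \<partial>distr lborel borel L)" using that by simp
      also have "\<dots> = (\<integral>\<^sup>+x. ?one A (L x) \<partial>lborel)" using that by (subst nn_integral_distr) auto
      finally show ?thesis .
    qed
    have "emeasure (distr lborel borel L) A * emeasure lborel B = (\<integral>\<^sup>+x. ?one A (L x) * (\<integral>\<^sup>+y. ?one B y \<partial>lborel) \<partial>lborel)"
      using that by (subst \<mu>) (simp_all add: nn_integral_multc)
    also have "\<dots> = (\<integral>\<^sup>+x. ?one A (L x) * (\<integral>\<^sup>+y. ?one B (L x + y) \<partial>lborel) \<partial>lborel)"
      by (subst nn_integral_lborel_shift) auto
    also have "\<dots> = (\<integral>\<^sup>+x. \<integral>\<^sup>+y. ?one A (L x) * ?one B (L x + y) \<partial>lborel \<partial>lborel)"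
      by (intro nn_integral_cong nn_integral_cmult[symmetric]) measurable
    also have "\<dots> = (\<integral>\<^sup>+y. \<integral>\<^sup>+x. ?one A (L x) * ?one B (L x + y) \<partial>lborel \<partial>lborel)"
      by (rule lborel_pair.Fubini'[symmetric]) measurable
    \<comment> \<open>Translating \<open>x\<close> by \<open>- L y\<close> turns \<open>L x\<close>
      into \<open>L x - y\<close>, because \<open>L\<close> is its own inverse. The free variable
      thereby passes from \<open>B\<close> to \<open>A\<close>.\<close>
    also have "\<dots> = (\<integral>\<^sup>+y. \<integral>\<^sup>+x. ?one A (L (- L y + x)) * ?one B (L (- L y + x) + y) \<partial>lborel \<partial>lborel)"
    proof (rule nn_integral_cong)
      fix y
      show "(\<integral>\<^sup>+x. ?one A (L x) * ?one B (L x + y) \<partial>lborel) = (\<integral>\<^sup>+x. ?one A (L (- L y + x)) * ?one B (L (- L y + x) + y) \<partial>lborel)"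
        by (rule nn_integral_lborel_shift[symmetric, of "\<lambda>x. ?one A (L x) * ?one B (L x + y)"]) measurable
    qed
    also have "\<dots> = (\<integral>\<^sup>+y. \<integral>\<^sup>+x. ?one A (L x - y) * ?one B (L x) \<partial>lborel \<partial>lborel)"
      by (simp add: linear_add[OF lin] linear_diff[OF lin] linear_neg[OF lin] inv add.commute)
    also have "\<dots> = (\<integral>\<^sup>+x. \<integral>\<^sup>+y. ?one A (L x - y) * ?one B (L x) \<partial>lborel \<partial>lborel)"
      by (rule lborel_pair.Fubini') measurable
    also have "\<dots> = (\<integral>\<^sup>+x. (\<integral>\<^sup>+y. ?one A (L x - y) \<partial>lborel) * ?one B (L x) \<partial>lborel)"
      by (intro nn_integral_cong nn_integral_multc) measurable
    also have "\<dots> = (\<integral>\<^sup>+x. emeasure lborel A * ?one B (L x) \<partial>lborel)"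
      by (subst nn_integral_lborel_reflect) auto
    also have "\<dots> = emeasure (distr lborel borel L) B * emeasure lborel A"
      using that by (subst \<mu>) (simp_all add: nn_integral_cmult mult.commute)
    finally show ?thesis .
  qed
  \<comment> \<open>The intersection with the preimage makes the ball invariant; it stays bounded,
    and it is open around 0, hence of positive measure.\<close>
  define B where "B = ball 0 1 \<inter> L -` ball 0 1"
  have "open B" unfolding B_def using cont by (intro open_Int open_vimage) auto
  then have B: "B \<in> sets borel" by simp
  have "0 \<in> B" by (simp add: B_def linear_0[OF lin])
  with \<open>open B\<close> obtain e where "e > 0" "ball 0 e \<subseteq> B" by (auto simp: open_contains_ball)
  then have "emeasure lborel (ball (0::'a) e) \<le> emeasure lborel B" using B by (intro emeasure_mono) auto
  moreover have "emeasure lborel (ball (0::'a) e) > 0"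
    using content_ball_pos[OF \<open>e > 0\<close>, of "0::'a"] by (simp add: measure_def enn2real_positive_iff)
  ultimately have B0: "emeasure lborel B \<noteq> 0" by auto
  have "emeasure lborel B \<le> emeasure lborel (ball (0::'a) 1)" by (intro emeasure_mono) (auto simp: B_def)
  then have B1: "emeasure lborel B \<noteq> \<infinity>" using emeasure_lborel_ball_finite[of "0::'a" 1] by (auto simp: top_unique)
  have "L -` B = B" by (auto simp: B_def inv)
  then have "emeasure (distr lborel borel L) B = emeasure lborel B"
    using B by (subst emeasure_distr) auto
  then have "emeasure (distr lborel borel L) A = emeasure lborel A" if "A \<in> sets borel" for A
    using swap[OF that B] B0 B1 by (simp add: ennreal_mult_cancel_left mult.commute[of _ "emeasure lborel B"])
  then show ?thesis by (intro measure_eqI) auto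
qed

section \<open>Surface measure and Euclidean polar coordinates\<close>

lemma sgn_measurable_euclidean [measurable]: "(sgn :: 'a::euclidean_space \<Rightarrow> 'a) \<in> borel_measurable borel"
  unfolding sgn_div_norm[abs_def] by measurable

lemma ball_density_measurable [measurable]:
  "(\<lambda>z::'a::euclidean_space. c * indicator (ball 0 1) z :: ennreal) \<in> borel_measurable borel"
  by (intro borel_measurable_times_ennreal borel_measurable_const borel_measurable_indicator) auto

lemma nn_integral_sphere:
  fixes \<psi> :: "real ^ 'n::finite \<Rightarrow> ennreal"
  assumes [measurable]: "\<psi> \<in> borel_measurable borel"
  shows "(\<integral>\<^sup>+\<omega>. \<psi> \<omega> \<partial>sphere_measure) = (\<integral>\<^sup>+z. \<psi> (sgn z) * (of_nat CARD('n) * indicator (ball 0 1) z) \<partial>lborel)"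
  unfolding sphere_measure_def
  by (subst nn_integral_distr, measurable, subst nn_integral_density, measurable) (simp add: mult.commute)

lemma sets_sphere_measure [measurable_cong]: "sets (sphere_measure :: (real ^ 'n::finite) measure) = sets borel"
  by (simp add: sphere_measure_def)

lemma emeasure_sphere_measure:
  "emeasure (sphere_measure :: (real ^ 'n::finite) measure) UNIV = ennreal (real CARD('n) * measure lborel (ball (0 :: real ^ 'n) 1))"
proof -
  have "emeasure (sphere_measure :: (real ^ 'n) measure) UNIV = (\<integral>\<^sup>+\<omega>. 1 \<partial>(sphere_measure :: (real ^ 'n) measure))"
    by (simp add: sphere_measure_def)
  also have "\<dots> = of_nat CARD('n) * emeasure lborel (ball (0 :: real ^ 'n) 1)"
    by (subst nn_integral_sphere) (simp_all add: nn_integral_cmult_indicator)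
  also have "emeasure lborel (ball (0 :: real ^ 'n) 1) = ennreal (measure lborel (ball (0 :: real ^ 'n) 1))"
    using emeasure_lborel_ball_finite[of "0 :: real ^ 'n" 1] by (intro emeasure_eq_ennreal_measure) auto
  finally show ?thesis by (simp add: ennreal_mult ennreal_of_nat_eq_real_of_nat)
qed

lemma finite_sphere_measure: "finite_measure (sphere_measure :: (real ^ 'n::finite) measure)"
  by (rule finite_measureI) (use emeasure_sphere_measure[where 'n='n] in \<open>simp add: sphere_measure_def\<close>)

text \<open>\<open>sphere_measure\<close> comes from the solid ball, so a ball variable
  \<open>z\<close> has to be integrated out. Put \<open>r = norm z * t\<close>, then
  \<open>y = t *\<^sub>R z\<close>: the ball condition becomes \<open>t > norm y\<close>, and the
  integral of \<open>n * norm y ^ n * t powr (- 1 - n)\<close> over this range of \<open>t\<close>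
  is 1.\<close>

lemma nn_integral_polar:
  fixes h :: "real ^ 'n::finite \<Rightarrow> ennreal"
  assumes [measurable]: "h \<in> borel_measurable borel"
  shows "(\<integral>\<^sup>+x. h x \<partial>lborel) =
    (\<integral>\<^sup>+r. \<integral>\<^sup>+\<omega>. h (r *\<^sub>R \<omega>) * (ennreal (r ^ (CARD('n) - 1)) * indicator {0<..} r) \<partial>sphere_measure \<partial>lborel)"
proof -
  define n where "n = CARD('n)"
  have n: "n > 0" "n = Suc (n - 1)" by (auto simp: n_def)
  define k :: "real ^ 'n \<Rightarrow> ennreal" where "k = (\<lambda>z. of_nat n * indicator (ball 0 1) z)"
  have [measurable]: "k \<in> borel_measurable borel" unfolding k_def by measurable
  have "(\<integral>\<^sup>+r. \<integral>\<^sup>+\<omega>. h (r *\<^sub>R \<omega>) * (ennreal (r ^ (n - 1)) * indicator {0<..} r) \<partial>sphere_measure \<partial>lborel) =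
     (\<integral>\<^sup>+r. \<integral>\<^sup>+z. h (r *\<^sub>R sgn z) * (ennreal (r ^ (n - 1)) * indicator {0<..} r) * k z \<partial>lborel \<partial>lborel)"
    unfolding k_def n_def by (intro nn_integral_cong nn_integral_sphere) measurable
  also have "\<dots> = (\<integral>\<^sup>+z. \<integral>\<^sup>+r. h (r *\<^sub>R sgn z) * (ennreal (r ^ (n - 1)) * indicator {0<..} r) * k z \<partial>lborel \<partial>lborel)"
    by (rule lborel_pair.Fubini'[symmetric]) measurable
  also have "\<dots> = (\<integral>\<^sup>+z. \<integral>\<^sup>+t. h (t *\<^sub>R z) * (ennreal (norm z ^ n * t ^ (n - 1)) * indicator {0<..} t) * k z \<partial>lborel \<partial>lborel)"
  proof (rule nn_integral_cong_AE)
    have "AE z in lborel. z \<noteq> (0 :: real ^ 'n)" by (rule AE_lborel_singleton)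
    then show "AE z in lborel. (\<integral>\<^sup>+r. h (r *\<^sub>R sgn z) * (ennreal (r ^ (n - 1)) * indicator {0<..} r) * k z \<partial>lborel) =
       (\<integral>\<^sup>+t. h (t *\<^sub>R z) * (ennreal (norm z ^ n * t ^ (n - 1)) * indicator {0<..} t) * k z \<partial>lborel)"
    proof eventually_elim
      case (elim z)
      have "(\<integral>\<^sup>+r. h (r *\<^sub>R sgn z) * (ennreal (r ^ (n - 1)) * indicator {0<..} r) * k z \<partial>lborel) =
        ennreal \<bar>norm z\<bar> * (\<integral>\<^sup>+t. h ((0 + norm z * t) *\<^sub>R sgn z) * (ennreal ((0 + norm z * t) ^ (n - 1)) * indicator {0<..} (0 + norm z * t)) * k z \<partial>lborel)"
        using elim by (intro nn_integral_real_affine) auto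
      also have "\<dots> = (\<integral>\<^sup>+t. ennreal \<bar>norm z\<bar> * (h ((0 + norm z * t) *\<^sub>R sgn z) * (ennreal ((0 + norm z * t) ^ (n - 1)) * indicator {0<..} (0 + norm z * t)) * k z) \<partial>lborel)"
        by (rule nn_integral_cmult[symmetric]) measurable
      also have "\<dots> = (\<integral>\<^sup>+t. h (t *\<^sub>R z) * (ennreal (norm z ^ n * t ^ (n - 1)) * indicator {0<..} t) * k z \<partial>lborel)"
      proof (rule nn_integral_cong)
        fix t :: real
        show "ennreal \<bar>norm z\<bar> * (h ((0 + norm z * t) *\<^sub>R sgn z) * (ennreal ((0 + norm z * t) ^ (n - 1)) * indicator {0<..} (0 + norm z * t)) * k z)
          = h (t *\<^sub>R z) * (ennreal (norm z ^ n * t ^ (n - 1)) * indicator {0<..} t) * k z"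
        proof (cases "t > 0")
          case True
          have "norm z ^ n * t ^ (n - 1) = norm z * (norm z * t) ^ (n - 1)"
            by (subst n(2)) (simp add: power_mult_distrib)
          then have "ennreal (norm z ^ n * t ^ (n - 1)) = ennreal (norm z) * ennreal ((norm z * t) ^ (n - 1))"
            using True by (simp add: ennreal_mult)
          moreover have "(norm z * t) *\<^sub>R sgn z = t *\<^sub>R z" using elim by (simp add: sgn_div_norm)
          ultimately show ?thesis using True elim by (simp add: mult_ac)
        next
          case False
          then have "\<not> norm z * t > 0" by (simp add: not_less mult_nonneg_nonpos)
          with False show ?thesis by simp
        qed
      qed
      finally show ?case .
    qed
  qed
  also have "\<dots> = (\<integral>\<^sup>+t. \<integral>\<^sup>+z. h (t *\<^sub>R z) * (ennreal (norm z ^ n * t ^ (n - 1)) * indicator {0<..} t) * k z \<partial>lborel \<partial>lborel)"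
    by (rule lborel_pair.Fubini'[symmetric]) measurable
  also have "\<dots> = (\<integral>\<^sup>+t. \<integral>\<^sup>+y. h y * (ennreal (real n * norm y ^ n * t powr (- 1 - real n)) * indicator {x. norm (snd x) < fst x} (t, y)) \<partial>lborel \<partial>lborel)"
  proof (rule nn_integral_cong)
    fix t :: real
    show "(\<integral>\<^sup>+z. h (t *\<^sub>R z) * (ennreal (norm z ^ n * t ^ (n - 1)) * indicator {0<..} t) * k z \<partial>lborel) =
       (\<integral>\<^sup>+y. h y * (ennreal (real n * norm y ^ n * t powr (- 1 - real n)) * indicator {x. norm (snd x) < fst x} (t, y)) \<partial>lborel)"
    proof (cases "t > 0")
      case True
      have "(\<integral>\<^sup>+z. h (t *\<^sub>R z) * (ennreal (norm z ^ n * t ^ (n - 1)) * indicator {0<..} t) * k z \<partial>lborel) =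
         ennreal (\<bar>1 / t\<bar> ^ DIM(real ^ 'n)) * (\<integral>\<^sup>+y. h (t *\<^sub>R (0 + (1 / t) *\<^sub>R y)) * (ennreal (norm (0 + (1 / t) *\<^sub>R y) ^ n * t ^ (n - 1)) * indicator {0<..} t) * k (0 + (1 / t) *\<^sub>R y) \<partial>lborel)"
        using True by (intro nn_integral_lborel_scale) auto
      also have "\<dots> = (\<integral>\<^sup>+y. ennreal (\<bar>1 / t\<bar> ^ DIM(real ^ 'n)) * (h (t *\<^sub>R (0 + (1 / t) *\<^sub>R y)) * (ennreal (norm (0 + (1 / t) *\<^sub>R y) ^ n * t ^ (n - 1)) * indicator {0<..} t) * k (0 + (1 / t) *\<^sub>R y)) \<partial>lborel)"
        by (rule nn_integral_cmult[symmetric]) measurable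
      also have "\<dots> = (\<integral>\<^sup>+y. h y * (ennreal (real n * norm y ^ n * t powr (- 1 - real n)) * indicator {x. norm (snd x) < fst x} (t, y)) \<partial>lborel)"
      proof (rule nn_integral_cong)
        fix y :: "real ^ 'n"
        have "t powr (- 1 - real n) = 1 / t ^ n / t"
          using True powr_diff[of t "- real n" 1] by (simp add: powr_minus_divide powr_realpow minus_diff_commute)
        moreover have "t ^ (n - 1) / (t ^ n * t ^ n) = 1 / t ^ n / t"
        proof -
          have "t ^ n = t * t ^ (n - 1)" by (subst n(2)) (rule power_Suc)
          then have "t ^ (n - 1) / (t ^ n * t ^ n) = t ^ (n - 1) / (t ^ n * (t * t ^ (n - 1)))" by simp
          also have "\<dots> = 1 / t ^ n / t" using True by simp
          finally show ?thesis .
        qed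
        moreover have "(1 / t) ^ n * ((norm y / t) ^ n * t ^ (n - 1)) * real n = real n * norm y ^ n * (t ^ (n - 1) / (t ^ n * t ^ n))"
          by (simp add: power_divide)
        ultimately have e0: "(1 / t) ^ n * ((norm y / t) ^ n * t ^ (n - 1)) * real n = real n * norm y ^ n * t powr (- 1 - real n)"
          by simp
        have E: "ennreal (A * B * real n) = ennreal A * (ennreal B * of_nat n)" if "A \<ge> 0" "B \<ge> 0" for A B
          using that by (simp add: ennreal_mult ennreal_of_nat_eq_real_of_nat mult.assoc)
        have e: "ennreal (real n * norm y ^ n * t powr (- 1 - real n)) = ennreal ((1 / t) ^ n) * (ennreal ((norm y / t) ^ n * t ^ (n - 1)) * of_nat n)"
          unfolding e0[symmetric] by (rule E) (use True in auto)
        let ?y = "0 + (1 / t) *\<^sub>R y"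
        have "norm y / t < 1 \<longleftrightarrow> norm y < t" using True by (simp add: divide_less_eq)
        then have "k ?y = of_nat n * indicator {x. norm (snd x) < fst x} (t, y)"
          using True by (simp add: k_def indicator_def)
        moreover have "t *\<^sub>R ?y = y" "norm ?y = norm y / t" "indicator {0<..} t = (1 :: ennreal)"
          "\<bar>1 / t\<bar> ^ DIM(real ^ 'n) = (1 / t) ^ n" using True by (simp_all add: n_def)
        ultimately show "ennreal (\<bar>1 / t\<bar> ^ DIM(real ^ 'n)) * (h (t *\<^sub>R ?y) * (ennreal (norm ?y ^ n * t ^ (n - 1)) * indicator {0<..} t) * k ?y)
          = h y * (ennreal (real n * norm y ^ n * t powr (- 1 - real n)) * indicator {x. norm (snd x) < fst x} (t, y))"
          unfolding e by (simp only: mult_1_right mult_1_left mult_ac)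
      qed
      finally show ?thesis .
    next
      case False
      then have "\<not> norm y < t" for y :: "real ^ 'n" using norm_ge_zero[of y] by linarith
      then show ?thesis using False by simp
    qed
  qed
  also have "\<dots> = (\<integral>\<^sup>+y. \<integral>\<^sup>+t. h y * (ennreal (real n * norm y ^ n * t powr (- 1 - real n)) * indicator {x. norm (snd x) < fst x} (t, y)) \<partial>lborel \<partial>lborel)"
    by (rule lborel_pair.Fubini'[symmetric]) measurable
  also have "\<dots> = (\<integral>\<^sup>+y. h y \<partial>lborel)"
  proof (rule nn_integral_cong_AE)
    have "AE z in lborel. z \<noteq> (0 :: real ^ 'n)" by (rule AE_lborel_singleton)
    then show "AE y in lborel. (\<integral>\<^sup>+t. h y * (ennreal (real n * norm y ^ n * t powr (- 1 - real n)) * indicator {x. norm (snd x) < fst x} (t, y)) \<partial>lborel) = h y"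
    proof eventually_elim
      case (elim y)
      have "(\<integral>\<^sup>+t. h y * (ennreal (real n * norm y ^ n * t powr (- 1 - real n)) * indicator {x. norm (snd x) < fst x} (t, y)) \<partial>lborel)
        = h y * (\<integral>\<^sup>+t. ennreal (real n * norm y ^ n * t powr (- 1 - real n)) * indicator {norm y<..} t \<partial>lborel)"
        by (subst nn_integral_cmult[symmetric]) (auto simp: indicator_def)
      also have "(\<integral>\<^sup>+t. ennreal (real n * norm y ^ n * t powr (- 1 - real n)) * indicator {norm y<..} t \<partial>lborel)
        = ennreal (LBINT t:{norm y<..}. real n * norm y ^ n * t powr (- 1 - real n))"
        using elim n by (intro nn_set_integral_eq set_integrable_mult_right powr_tail_integral) auto
      also have "(LBINT t:{norm y<..}. real n * norm y ^ n * t powr (- 1 - real n)) = real n * norm y ^ n * (norm y powr (- real n) / real n)"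
        using elim n by (subst set_integral_mult_right, subst powr_tail_integral) auto
      also have "\<dots> = 1" using elim n by (simp add: powr_minus powr_realpow)
      finally show ?case by simp
    qed
  qed
  finally show ?thesis unfolding n_def ..
qed

section \<open>The law of the hyperbolic distance\<close>

lemma nn_integral_hyp_volume:
  fixes g :: "real \<times> (real ^ 'n::finite) \<Rightarrow> ennreal"
  assumes [measurable]: "g \<in> borel_measurable borel"
  shows "(\<integral>\<^sup>+y. g y \<partial>hyp_volume) =
    (\<integral>\<^sup>+\<rho>. (\<integral>\<^sup>+\<omega>. g (cosh \<rho>, sinh \<rho> *\<^sub>R \<omega>) \<partial>sphere_measure) * (ennreal (sinh \<rho> ^ (CARD('n) - 1)) * indicator {0<..} \<rho>) \<partial>lborel)"
proof -
  interpret S: finite_measure "sphere_measure :: (real ^ 'n) measure" by (rule finite_sphere_measure)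
  let ?D = "density lborel (\<lambda>\<rho>. ennreal (sinh \<rho> ^ (CARD('n) - 1)) * indicator {0<..} \<rho>)"
  have m: "(\<lambda>(\<rho>, \<omega>). (cosh \<rho>, sinh \<rho> *\<^sub>R \<omega>)) \<in> ?D \<Otimes>\<^sub>M (sphere_measure :: (real ^ 'n) measure) \<rightarrow>\<^sub>M borel"
    unfolding case_prod_beta by measurable
  have "(\<integral>\<^sup>+y. g y \<partial>hyp_volume) = (\<integral>\<^sup>+z. g (case z of (\<rho>, \<omega>) \<Rightarrow> (cosh \<rho>, sinh \<rho> *\<^sub>R \<omega>)) \<partial>(?D \<Otimes>\<^sub>M sphere_measure))"
    unfolding hyp_volume_def by (rule nn_integral_distr[OF m]) simp
  also have "\<dots> = (\<integral>\<^sup>+\<rho>. \<integral>\<^sup>+\<omega>. g (case (\<rho>, \<omega>) of (\<rho>, \<omega>) \<Rightarrow> (cosh \<rho>, sinh \<rho> *\<^sub>R \<omega>)) \<partial>sphere_measure \<partial>?D)"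
    by (rule S.nn_integral_fst[symmetric]) (use m in measurable)
  also have "\<dots> = (\<integral>\<^sup>+\<rho>. (\<integral>\<^sup>+\<omega>. g (cosh \<rho>, sinh \<rho> *\<^sub>R \<omega>) \<partial>sphere_measure) * (ennreal (sinh \<rho> ^ (CARD('n) - 1)) * indicator {0<..} \<rho>) \<partial>lborel)"
    by (subst nn_integral_density) (simp_all add: mult.commute)
  finally show ?thesis .
qed

section \<open>From Lebesgue measure on the cone to hyperbolic volume\<close>

text \<open>Converts the slope \<open>\<tau>\<close> of a ray in the cone into the hyperbolic
  radius. The substitution is made on \<open>[0, k + 1]\<close> and extended by monotone
  convergence; the endpoint 0 is a null set.\<close>

lemma nn_integral_tanh_substitution:
  fixes G :: "real \<Rightarrow> ennreal"
  assumes [measurable]: "G \<in> borel_measurable borel"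
  shows "(\<integral>\<^sup>+\<tau>. G \<tau> * indicator {0<..<1} \<tau> \<partial>lborel) =
    (\<integral>\<^sup>+\<rho>. G (tanh \<rho>) * ennreal (1 - (tanh \<rho>)\<^sup>2) * indicator {0<..} \<rho> \<partial>lborel)"
proof -
  have [measurable]: "(tanh :: real \<Rightarrow> real) \<in> borel_measurable borel"
    by (intro borel_measurable_continuous_onI continuous_intros) auto
  have eq: "(\<integral>\<^sup>+\<tau>. G \<tau> * indicator {tanh 0..tanh (real (Suc k))} \<tau> \<partial>lborel) =
     (\<integral>\<^sup>+\<rho>. G (tanh \<rho>) * ennreal (1 - (tanh \<rho>)\<^sup>2) * indicator {0..real (Suc k)} \<rho> \<partial>lborel)" for k
  proof (rule nn_integral_substitution_aux)
    fix x :: real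
    show "(tanh has_real_derivative 1 - (tanh x)\<^sup>2) (at x)"
      by (auto intro!: derivative_eq_intros)
    show "0 \<le> 1 - (tanh x)\<^sup>2" using tanh_real_bounds[of x] by (auto simp: abs_square_le_1 abs_le_iff)
  qed (auto intro!: continuous_intros)
  have tinc: "tanh (real (Suc i)) \<le> tanh (real (Suc j))" if "i \<le> j" for i j
    using that by simp
  have l1: "(\<lambda>k. \<integral>\<^sup>+\<tau>. G \<tau> * indicator {tanh 0..tanh (real (Suc k))} \<tau> \<partial>lborel) \<longlonglongrightarrow> (\<integral>\<^sup>+\<tau>. G \<tau> * indicator {0..<1} \<tau> \<partial>lborel)"
  proof (rule nn_integral_LIMSEQ)
    show "incseq (\<lambda>k \<tau>. G \<tau> * indicator {tanh 0..tanh (real (Suc k))} \<tau>)"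
    proof (intro incseq_SucI le_funI mult_left_mono)
      fix k \<tau> show "(indicator {tanh 0..tanh (real (Suc k))} \<tau> :: ennreal) \<le> indicator {tanh 0..tanh (real (Suc (Suc k)))} \<tau>"
        using tinc[of k "Suc k"]
        by (auto simp: indicator_def simp del: of_nat_Suc tanh_real_le_iff intro: order_trans)
    qed simp
    show "(\<lambda>k. G \<tau> * indicator {tanh 0..tanh (real (Suc k))} \<tau>) \<longlonglongrightarrow> G \<tau> * indicator {0..<1} \<tau>" for \<tau>
    proof (rule tendsto_eventually)
      show "eventually (\<lambda>k. G \<tau> * indicator {tanh 0..tanh (real (Suc k))} \<tau> = G \<tau> * indicator {0..<1} \<tau>) sequentially"
      proof (cases "0 \<le> \<tau> \<and> \<tau> < 1")
        case True
        have "((\<lambda>k. tanh (real (Suc k))) \<longlonglongrightarrow> 1)" by (rule filterlim_compose[OF tanh_real_at_top]) real_asymp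
        from order_tendstoD(1)[OF this, of \<tau>] True show ?thesis
          by (auto elim!: eventually_mono)
      next
        case False
        then have "\<tau> \<notin> {tanh 0..tanh (real (Suc k))}" for k using tanh_real_lt_1[of "real (Suc k)"] by auto
        then show ?thesis using False by (auto simp: indicator_def)
      qed
    qed
  qed measurable
  have l2: "(\<lambda>k. \<integral>\<^sup>+\<rho>. G (tanh \<rho>) * ennreal (1 - (tanh \<rho>)\<^sup>2) * indicator {0..real (Suc k)} \<rho> \<partial>lborel) \<longlonglongrightarrow>
     (\<integral>\<^sup>+\<rho>. G (tanh \<rho>) * ennreal (1 - (tanh \<rho>)\<^sup>2) * indicator {0..} \<rho> \<partial>lborel)"
  proof (rule nn_integral_LIMSEQ)
    show "incseq (\<lambda>k \<rho>. G (tanh \<rho>) * ennreal (1 - (tanh \<rho>)\<^sup>2) * indicator {0..real (Suc k)} \<rho>)"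
      by (intro incseq_SucI le_funI mult_left_mono) (auto simp: indicator_def)
    show "(\<lambda>k. G (tanh \<rho>) * ennreal (1 - (tanh \<rho>)\<^sup>2) * indicator {0..real (Suc k)} \<rho>) \<longlonglongrightarrow> G (tanh \<rho>) * ennreal (1 - (tanh \<rho>)\<^sup>2) * indicator {0..} \<rho>" for \<rho>
    proof (rule tendsto_eventually)
      have "eventually (\<lambda>k. \<rho> < real (Suc k)) sequentially" by real_asymp
      then show "eventually (\<lambda>k. G (tanh \<rho>) * ennreal (1 - (tanh \<rho>)\<^sup>2) * indicator {0..real (Suc k)} \<rho> = G (tanh \<rho>) * ennreal (1 - (tanh \<rho>)\<^sup>2) * indicator {0..} \<rho>) sequentially"
        by eventually_elim (auto simp: indicator_def)
    qed
  qed measurable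
  have "(\<integral>\<^sup>+\<tau>. G \<tau> * indicator {0..<1} \<tau> \<partial>lborel) = (\<integral>\<^sup>+\<rho>. G (tanh \<rho>) * ennreal (1 - (tanh \<rho>)\<^sup>2) * indicator {0..} \<rho> \<partial>lborel)"
    using l1 l2 unfolding eq by (rule LIMSEQ_unique)
  moreover have "(\<integral>\<^sup>+\<tau>. G \<tau> * indicator {0..<1} \<tau> \<partial>lborel) = (\<integral>\<^sup>+\<tau>. G \<tau> * indicator {0<..<1} \<tau> \<partial>lborel)"
    using AE_lborel_singleton[of 0] by (intro nn_integral_cong_AE) (auto elim!: eventually_mono simp: indicator_def)
  moreover have "(\<integral>\<^sup>+\<rho>. G (tanh \<rho>) * ennreal (1 - (tanh \<rho>)\<^sup>2) * indicator {0..} \<rho> \<partial>lborel) = (\<integral>\<^sup>+\<rho>. G (tanh \<rho>) * ennreal (1 - (tanh \<rho>)\<^sup>2) * indicator {0<..} \<rho> \<partial>lborel)"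
    using AE_lborel_singleton[of 0] by (intro nn_integral_cong_AE) (auto elim!: eventually_mono simp: indicator_def)
  ultimately show ?thesis by simp
qed

lemma AE_sphere_measure: "AE \<omega> in (sphere_measure :: (real ^ 'n::finite) measure). norm \<omega> = 1"
proof -
  have "{x \<in> space borel. norm (x :: real ^ 'n) = 1} \<in> sets borel" by measurable
  then show ?thesis
    unfolding sphere_measure_def
    using AE_lborel_singleton[of "0 :: real ^ 'n"]
    by (subst AE_distr_iff) (auto simp: AE_density norm_sgn elim!: eventually_mono)
qed

definition lorentz :: "real \<times> (real ^ 'n::finite) \<Rightarrow> real \<times> (real ^ 'n) \<Rightarrow> real" where
  "lorentz v w = fst v * fst w - snd v \<bullet> snd w"

text \<open>
  Up to a factor, the hyperbolic volume is the image of Lebesgue measure on this cone under radial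
  projection; hence it inherits the invariance under Lorentz reflections.
\<close>

definition unit_cone :: "(real \<times> (real ^ 'n::finite)) set" where
  "unit_cone = {v. fst v > 0 \<and> 0 < lorentz v v \<and> lorentz v v < 1}"

lemma lorentz_measurable [measurable (raw)]:
  "f \<in> borel_measurable M \<Longrightarrow> g \<in> borel_measurable M \<Longrightarrow> (\<lambda>x. lorentz (f x) (g x)) \<in> borel_measurable M"
  unfolding lorentz_def
  by (intro borel_measurable_diff borel_measurable_times borel_measurable_inner
      measurable_compose[OF _ borel_measurable_continuous_onI[OF continuous_on_fst[OF continuous_on_id]]]
      measurable_compose[OF _ borel_measurable_continuous_onI[OF continuous_on_snd[OF continuous_on_id]]])

lemma open_unit_cone: "open unit_cone"
  unfolding unit_cone_def lorentz_def
  by (intro open_Collect_conj open_Collect_less continuous_intros)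

text \<open>In coordinates \<open>v = (v0, v0 * \<tau> * \<omega>)\<close> the projected point
  depends only on \<open>\<tau>\<close> and \<open>\<omega>\<close>. Integrating
  \<open>v0 ^ n\<close> up to the exit height \<open>c \<tau>\<close> gives
  \<open>c \<tau> ^ (n + 1) / (n + 1)\<close>, and for \<open>\<tau> = tanh \<rho>\<close> the
  factors \<open>tanh \<rho> ^ (n - 1) * cosh \<rho> ^ (n + 1) / (cosh \<rho>)\<^sup>2\<close>
  collapse to \<open>sinh \<rho> ^ (n - 1)\<close>.\<close>

lemma nn_integral_unit_cone:
  fixes \<phi> :: "real \<times> (real ^ 'n::finite) \<Rightarrow> ennreal"
  assumes [measurable]: "\<phi> \<in> borel_measurable borel"
  shows "(\<integral>\<^sup>+v. indicator unit_cone v * \<phi> ((1 / sqrt (lorentz v v)) *\<^sub>R v) \<partial>lborel) =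
     ennreal (1 / (real CARD('n) + 1)) * (\<integral>\<^sup>+y. \<phi> y \<partial>hyp_volume)"
proof -
  interpret S: finite_measure "sphere_measure :: (real ^ 'n) measure" by (rule finite_sphere_measure)
  define n where "n = CARD('n)"
  have n: "n > 0" "n = Suc (n - 1)" by (auto simp: n_def)
  define F where "F = (\<lambda>v :: real \<times> (real ^ 'n). indicator unit_cone v * \<phi> ((1 / sqrt (lorentz v v)) *\<^sub>R v))"
  have sq: "(\<lambda>x. sqrt (f x)) \<in> borel_measurable M" if "f \<in> borel_measurable M" for f :: "_ \<Rightarrow> real" and M :: "'z measure"
    using that by (rule measurable_compose[OF _ borel_measurable_sqrt])
  have Fm [measurable]: "F \<in> borel_measurable borel"
    unfolding F_def
    by (intro borel_measurable_times_ennreal borel_measurable_indicator borel_open open_unit_cone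
        measurable_compose[OF _ assms] borel_measurable_scaleR borel_measurable_divide sq lorentz_measurable) simp_all
  \<comment> \<open>The height at which the ray of slope \<open>\<tau>\<close> meets the
    hyperboloid, since \<open>lorentz v v = v0\<^sup>2 * (1 - \<tau>\<^sup>2)\<close>; for
    \<open>\<tau> = tanh \<rho>\<close> it is \<open>cosh \<rho>\<close>.\<close>
  define c where "c = (\<lambda>\<tau>::real. 1 / sqrt (1 - \<tau>\<^sup>2))"
  have [measurable]: "c \<in> borel_measurable borel"
    unfolding c_def by (intro borel_measurable_divide sq) measurable
  define \<Phi> where "\<Phi> = (\<lambda>\<tau>. \<integral>\<^sup>+\<omega>. \<phi> (c \<tau>, c \<tau> *\<^sub>R \<tau> *\<^sub>R \<omega>) \<partial>sphere_measure)"
  have [measurable]: "\<Phi> \<in> borel_measurable borel"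
    unfolding \<Phi>_def by (rule S.borel_measurable_nn_integral) measurable
  have "(\<integral>\<^sup>+v. F v \<partial>lborel) = (\<integral>\<^sup>+v0. \<integral>\<^sup>+v'. F (v0, v') \<partial>lborel \<partial>lborel)"
    unfolding lborel_prod[symmetric] by (rule lborel.nn_integral_fst[symmetric]) (simp add: lborel_prod)
  also have "\<dots> = (\<integral>\<^sup>+v0. \<integral>\<^sup>+r. \<integral>\<^sup>+\<omega>. F (v0, r *\<^sub>R \<omega>) * (ennreal (r ^ (n - 1)) * indicator {0<..} r) \<partial>sphere_measure \<partial>lborel \<partial>lborel)"
    unfolding n_def by (intro nn_integral_cong nn_integral_polar) measurable
  also have "\<dots> = (\<integral>\<^sup>+v0. \<integral>\<^sup>+\<tau>. \<integral>\<^sup>+\<omega>. F (v0, (v0 * \<tau>) *\<^sub>R \<omega>) * (ennreal (v0 ^ n * \<tau> ^ (n - 1)) * indicator {0<..} \<tau>) \<partial>sphere_measure \<partial>lborel \<partial>lborel)"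
  proof (rule nn_integral_cong)
    fix v0 :: real
    show "(\<integral>\<^sup>+r. \<integral>\<^sup>+\<omega>. F (v0, r *\<^sub>R \<omega>) * (ennreal (r ^ (n - 1)) * indicator {0<..} r) \<partial>sphere_measure \<partial>lborel) =
      (\<integral>\<^sup>+\<tau>. \<integral>\<^sup>+\<omega>. F (v0, (v0 * \<tau>) *\<^sub>R \<omega>) * (ennreal (v0 ^ n * \<tau> ^ (n - 1)) * indicator {0<..} \<tau>) \<partial>sphere_measure \<partial>lborel)"
    proof (cases "v0 > 0")
      case True
      let ?g = "\<lambda>r. \<integral>\<^sup>+\<omega>. F (v0, r *\<^sub>R \<omega>) * (ennreal (r ^ (n - 1)) * indicator {0<..} r) \<partial>sphere_measure"
      have gm: "?g \<in> borel_measurable borel"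
        by (rule S.borel_measurable_nn_integral) measurable
      have "(\<integral>\<^sup>+r. ?g r \<partial>lborel) = ennreal \<bar>v0\<bar> * (\<integral>\<^sup>+\<tau>. ?g (0 + v0 * \<tau>) \<partial>lborel)"
        using True by (intro nn_integral_real_affine gm) auto
      also have "\<dots> = (\<integral>\<^sup>+\<tau>. ennreal \<bar>v0\<bar> * ?g (0 + v0 * \<tau>) \<partial>lborel)"
        by (rule nn_integral_cmult[symmetric]) (use gm in measurable)
      also have "\<dots> = (\<integral>\<^sup>+\<tau>. \<integral>\<^sup>+\<omega>. F (v0, (v0 * \<tau>) *\<^sub>R \<omega>) * (ennreal (v0 ^ n * \<tau> ^ (n - 1)) * indicator {0<..} \<tau>) \<partial>sphere_measure \<partial>lborel)"
      proof (rule nn_integral_cong)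
        fix \<tau> :: real
        have "ennreal \<bar>v0\<bar> * (ennreal ((v0 * \<tau>) ^ (n - 1)) * indicator {0<..} (v0 * \<tau>)) = ennreal (v0 ^ n * \<tau> ^ (n - 1)) * indicator {0<..} \<tau>"
        proof (cases "\<tau> > 0")
          case t: True
          have "v0 ^ n * \<tau> ^ (n - 1) = v0 * (v0 * \<tau>) ^ (n - 1)"
            by (subst n(2)) (simp only: power_Suc power_mult_distrib mult.assoc)
          also have "ennreal \<dots> = ennreal v0 * ennreal ((v0 * \<tau>) ^ (n - 1))"
            using True t by (intro ennreal_mult) auto
          finally show ?thesis using True t by simp
        next
          case False
          then have "\<not> v0 * \<tau> > 0" using True by (simp add: zero_less_mult_iff)
          with False show ?thesis by simp
        qed
        note K = this
        have e: "F (v0, (v0 * \<tau>) *\<^sub>R \<omega>) * (ennreal (v0 ^ n * \<tau> ^ (n - 1)) * indicator {0<..} \<tau>) =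
          ennreal \<bar>v0\<bar> * (F (v0, (0 + v0 * \<tau>) *\<^sub>R \<omega>) * (ennreal ((0 + v0 * \<tau>) ^ (n - 1)) * indicator {0<..} (0 + v0 * \<tau>)))" for \<omega>
          unfolding K[symmetric] add_0 by (rule mult.left_commute)
        show "ennreal \<bar>v0\<bar> * ?g (0 + v0 * \<tau>) = (\<integral>\<^sup>+\<omega>. F (v0, (v0 * \<tau>) *\<^sub>R \<omega>) * (ennreal (v0 ^ n * \<tau> ^ (n - 1)) * indicator {0<..} \<tau>) \<partial>sphere_measure)"
          unfolding e by (rule nn_integral_cmult[symmetric]) measurable
      qed
      finally show ?thesis .
    next
      case False
      then have "F (v0, w) = 0" for w by (simp add: F_def unit_cone_def)
      then show ?thesis by simp
    qed
  qed
  also have "\<dots> = (\<integral>\<^sup>+\<tau>. \<integral>\<^sup>+v0. \<integral>\<^sup>+\<omega>. F (v0, (v0 * \<tau>) *\<^sub>R \<omega>) * (ennreal (v0 ^ n * \<tau> ^ (n - 1)) * indicator {0<..} \<tau>) \<partial>sphere_measure \<partial>lborel \<partial>lborel)"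
  proof (rule lborel_pair.Fubini'[symmetric])
    show "(\<lambda>(v0, \<tau>). \<integral>\<^sup>+\<omega>. F (v0, (v0 * \<tau>) *\<^sub>R \<omega>) * (ennreal (v0 ^ n * \<tau> ^ (n - 1)) * indicator {0<..} \<tau>) \<partial>sphere_measure)
      \<in> borel_measurable (lborel \<Otimes>\<^sub>M lborel)"
      unfolding case_prod_beta by (rule S.borel_measurable_nn_integral) measurable
  qed
  also have "\<dots> = (\<integral>\<^sup>+\<tau>. ennreal (1 / (real n + 1)) * (\<Phi> \<tau> * ennreal (\<tau> ^ (n - 1) * c \<tau> ^ (n + 1)) * indicator {0<..<1} \<tau>) \<partial>lborel)"
  proof (rule nn_integral_cong)
    fix \<tau> :: real
    show "(\<integral>\<^sup>+v0. \<integral>\<^sup>+\<omega>. F (v0, (v0 * \<tau>) *\<^sub>R \<omega>) * (ennreal (v0 ^ n * \<tau> ^ (n - 1)) * indicator {0<..} \<tau>) \<partial>sphere_measure \<partial>lborel) =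
      ennreal (1 / (real n + 1)) * (\<Phi> \<tau> * ennreal (\<tau> ^ (n - 1) * c \<tau> ^ (n + 1)) * indicator {0<..<1} \<tau>)"
    proof (cases "0 < \<tau> \<and> \<tau> < 1")
      case True
      then have t1: "\<tau>\<^sup>2 < 1" by (simp add: power_less_one_iff abs_square_less_1)
      have cp: "c \<tau> > 0" using t1 by (simp add: c_def)
      have c2: "(1 - \<tau>\<^sup>2) * (c \<tau>)\<^sup>2 = 1" using t1 by (simp add: c_def power_divide)
      have inner: "(\<integral>\<^sup>+\<omega>. F (v0, (v0 * \<tau>) *\<^sub>R \<omega>) * (ennreal (v0 ^ n * \<tau> ^ (n - 1)) * indicator {0<..} \<tau>) \<partial>sphere_measure) =
         (\<Phi> \<tau> * ennreal (\<tau> ^ (n - 1))) * (ennreal (v0 ^ n) * indicator {0<..<c \<tau>} v0)" for v0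
      proof (cases "v0 > 0")
        case v: True
        have "(\<integral>\<^sup>+\<omega>. F (v0, (v0 * \<tau>) *\<^sub>R \<omega>) * (ennreal (v0 ^ n * \<tau> ^ (n - 1)) * indicator {0<..} \<tau>) \<partial>sphere_measure) =
          (\<integral>\<^sup>+\<omega>. \<phi> (c \<tau>, c \<tau> *\<^sub>R \<tau> *\<^sub>R \<omega>) * (ennreal (\<tau> ^ (n - 1)) * (ennreal (v0 ^ n) * indicator {0<..<c \<tau>} v0)) \<partial>sphere_measure)"
        proof (rule nn_integral_cong_AE)
          show "AE \<omega> in sphere_measure. F (v0, (v0 * \<tau>) *\<^sub>R \<omega>) * (ennreal (v0 ^ n * \<tau> ^ (n - 1)) * indicator {0<..} \<tau>) =
            \<phi> (c \<tau>, c \<tau> *\<^sub>R \<tau> *\<^sub>R \<omega>) * (ennreal (\<tau> ^ (n - 1)) * (ennreal (v0 ^ n) * indicator {0<..<c \<tau>} v0))"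
            using AE_sphere_measure
          proof eventually_elim
            case (elim \<omega>)
            let ?v = "(v0, (v0 * \<tau>) *\<^sub>R \<omega>)"
            have q: "lorentz ?v ?v = v0\<^sup>2 * (1 - \<tau>\<^sup>2)"
              using elim by (simp add: lorentz_def dot_square_norm power2_eq_square algebra_simps)
            have "sqrt (lorentz ?v ?v) = v0 / c \<tau>"
              unfolding q using v by (simp add: real_sqrt_mult c_def)
            then have N: "(1 / sqrt (lorentz ?v ?v)) *\<^sub>R ?v = (c \<tau>, c \<tau> *\<^sub>R \<tau> *\<^sub>R \<omega>)"
              using v cp by simp
            have U: "?v \<in> unit_cone \<longleftrightarrow> v0 < c \<tau>"
            proof -
              have "0 < v0\<^sup>2 * (1 - \<tau>\<^sup>2)" using v t1 by simp
              moreover have "v0\<^sup>2 * (1 - \<tau>\<^sup>2) < 1 \<longleftrightarrow> v0\<^sup>2 * (1 - \<tau>\<^sup>2) < (c \<tau>)\<^sup>2 * (1 - \<tau>\<^sup>2)"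
                using c2 by (simp add: mult.commute)
              moreover have "\<dots> \<longleftrightarrow> v0\<^sup>2 < (c \<tau>)\<^sup>2" using t1 by simp
              moreover have "\<dots> \<longleftrightarrow> v0 < c \<tau>" using v cp
                by (auto intro: power2_less_imp_less power_strict_mono less_imp_le)
              ultimately show ?thesis using v by (simp add: unit_cone_def q)
            qed
            have "F ?v = indicator {0<..<c \<tau>} v0 * \<phi> (c \<tau>, c \<tau> *\<^sub>R \<tau> *\<^sub>R \<omega>)"
              unfolding F_def N using v U by (simp add: indicator_def)
            moreover have "ennreal (v0 ^ n * \<tau> ^ (n - 1)) = ennreal (v0 ^ n) * ennreal (\<tau> ^ (n - 1))"
              using v True by (intro ennreal_mult) auto
            ultimately show ?case using True by (simp add: mult_ac)
          qed
        qed
        also have "\<dots> = \<Phi> \<tau> * (ennreal (\<tau> ^ (n - 1)) * (ennreal (v0 ^ n) * indicator {0<..<c \<tau>} v0))"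
          unfolding \<Phi>_def by (rule nn_integral_multc) measurable
        finally show ?thesis by (simp only: mult.assoc)
      next
        case False
        then have "F (v0, w) = 0" for w by (simp add: F_def unit_cone_def)
        then show ?thesis using False by simp
      qed
      have I: "(\<integral>\<^sup>+v0. ennreal (v0 ^ n) * indicator {0<..<c \<tau>} v0 \<partial>lborel) = ennreal (c \<tau> ^ (n + 1) / (real n + 1))"
      proof -
        have d: "((\<lambda>x. x ^ (n + 1) / (real n + 1)) has_real_derivative x ^ n) (at x)" for x
          by (rule DERIV_cong[OF DERIV_cdivide[OF DERIV_pow]]) (simp add: add.commute)
        have "((\<lambda>x. x ^ (n + 1) / (real n + 1)) \<longlongrightarrow> 0 ^ (n + 1) / (real n + 1)) (at_right 0)"
          by (intro tendsto_intros) auto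
        then have A: "((\<lambda>x. x ^ (n + 1) / (real n + 1)) \<longlongrightarrow> 0) (at_right 0)" by simp
        have B: "((\<lambda>x. x ^ (n + 1) / (real n + 1)) \<longlongrightarrow> c \<tau> ^ (n + 1) / (real n + 1)) (at_left (c \<tau>))"
          by (intro tendsto_intros) auto
        have "set_integrable lborel {0<..<c \<tau>} (\<lambda>x. x ^ n)" "(LBINT x:{0<..<c \<tau>}. x ^ n) = c \<tau> ^ (n + 1) / (real n + 1) - 0"
          using set_integral_FTC_Ioo[OF cp d _ _ A B] by auto
        then show ?thesis by (subst nn_set_integral_eq) auto
      qed
      have "(\<integral>\<^sup>+v0. (\<Phi> \<tau> * ennreal (\<tau> ^ (n - 1))) * (ennreal (v0 ^ n) * indicator {0<..<c \<tau>} v0) \<partial>lborel) =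
         (\<Phi> \<tau> * ennreal (\<tau> ^ (n - 1))) * ennreal (c \<tau> ^ (n + 1) / (real n + 1))"
        by (subst nn_integral_cmult) (simp_all only: I, measurable)
      also have "\<dots> = ennreal (1 / (real n + 1)) * (\<Phi> \<tau> * ennreal (\<tau> ^ (n - 1) * c \<tau> ^ (n + 1)) * indicator {0<..<1} \<tau>)"
      proof -
        have "ennreal (c \<tau> ^ (n + 1) / (real n + 1)) = ennreal (1 / (real n + 1)) * ennreal (c \<tau> ^ (n + 1))"
          using cp by (subst ennreal_mult[symmetric]) auto
        moreover have "ennreal (\<tau> ^ (n - 1) * c \<tau> ^ (n + 1)) = ennreal (\<tau> ^ (n - 1)) * ennreal (c \<tau> ^ (n + 1))"
          using True cp by (intro ennreal_mult) auto
        moreover have "indicator {0<..<1} \<tau> = (1 :: ennreal)" using True by simp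
        ultimately show ?thesis by (simp only: mult_ac mult_1_left mult_1_right)
      qed
      finally show ?thesis unfolding inner .
    next
      case False
      have "(\<integral>\<^sup>+\<omega>. F (v0, (v0 * \<tau>) *\<^sub>R \<omega>) * (ennreal (v0 ^ n * \<tau> ^ (n - 1)) * indicator {0<..} \<tau>) \<partial>sphere_measure) = (\<integral>\<^sup>+\<omega>. 0 \<partial>(sphere_measure :: (real ^ 'n) measure))" for v0
      proof (rule nn_integral_cong_AE)
        show "AE \<omega> in sphere_measure. F (v0, (v0 * \<tau>) *\<^sub>R \<omega>) * (ennreal (v0 ^ n * \<tau> ^ (n - 1)) * indicator {0<..} \<tau>) = 0"
          using AE_sphere_measure
        proof eventually_elim
          case (elim \<omega>)
          let ?v = "(v0, (v0 * \<tau>) *\<^sub>R \<omega>)"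
          have q: "lorentz ?v ?v = v0\<^sup>2 * (1 - \<tau>\<^sup>2)"
            using elim by (simp add: lorentz_def dot_square_norm power2_eq_square algebra_simps)
          show ?case
          proof (cases "\<tau> > 0")
            case True
            then have "1 \<le> \<tau>\<^sup>2" using False by (simp add: one_le_power)
            then have "lorentz ?v ?v \<le> 0" unfolding q by (simp add: mult_nonneg_nonpos)
            then show ?thesis by (simp add: F_def unit_cone_def)
          qed simp
        qed
      qed
      then show ?thesis using False by simp
    qed
  qed
  also have "\<dots> = ennreal (1 / (real n + 1)) * (\<integral>\<^sup>+\<tau>. \<Phi> \<tau> * ennreal (\<tau> ^ (n - 1) * c \<tau> ^ (n + 1)) * indicator {0<..<1} \<tau> \<partial>lborel)"
    by (rule nn_integral_cmult) measurable
  also have "(\<integral>\<^sup>+\<tau>. \<Phi> \<tau> * ennreal (\<tau> ^ (n - 1) * c \<tau> ^ (n + 1)) * indicator {0<..<1} \<tau> \<partial>lborel) =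
     (\<integral>\<^sup>+\<rho>. \<Phi> (tanh \<rho>) * ennreal (tanh \<rho> ^ (n - 1) * c (tanh \<rho>) ^ (n + 1)) * ennreal (1 - (tanh \<rho>)\<^sup>2) * indicator {0<..} \<rho> \<partial>lborel)"
    by (rule nn_integral_tanh_substitution) measurable
  also have "\<dots> = (\<integral>\<^sup>+y. \<phi> y \<partial>hyp_volume)"
    unfolding nn_integral_hyp_volume[OF assms] n_def[symmetric]
  proof (rule nn_integral_cong)
    fix \<rho> :: real
    show "\<Phi> (tanh \<rho>) * ennreal (tanh \<rho> ^ (n - 1) * c (tanh \<rho>) ^ (n + 1)) * ennreal (1 - (tanh \<rho>)\<^sup>2) * indicator {0<..} \<rho> =
      (\<integral>\<^sup>+\<omega>. \<phi> (cosh \<rho>, sinh \<rho> *\<^sub>R \<omega>) \<partial>sphere_measure) * (ennreal (sinh \<rho> ^ (n - 1)) * indicator {0<..} \<rho>)"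
    proof (cases "\<rho> > 0")
      case True
      have ch: "cosh \<rho> > 0" by simp
      have t: "1 - (tanh \<rho>)\<^sup>2 = 1 / (cosh \<rho>)\<^sup>2"
      proof -
        have "1 - (tanh \<rho>)\<^sup>2 = ((cosh \<rho>)\<^sup>2 - (sinh \<rho>)\<^sup>2) / (cosh \<rho>)\<^sup>2"
          using ch by (simp add: tanh_def power_divide diff_divide_distrib)
        then show ?thesis by (simp only: hyperbolic_pythagoras)
      qed
      have ct: "c (tanh \<rho>) = cosh \<rho>" unfolding c_def t using ch by (simp add: real_sqrt_divide)
      have ts: "cosh \<rho> * tanh \<rho> = sinh \<rho>" using ch by (simp add: tanh_def)
      have "tanh \<rho> ^ (n - 1) * cosh \<rho> ^ (n + 1) * (1 / (cosh \<rho>)\<^sup>2) = tanh \<rho> ^ (n - 1) * cosh \<rho> ^ (n - 1)"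
      proof -
        have "n + 1 = (n - 1) + 2" using n by simp
        then have "cosh \<rho> ^ (n + 1) = cosh \<rho> ^ (n - 1) * (cosh \<rho>)\<^sup>2" by (simp only: power_add)
        then show ?thesis using ch by simp
      qed
      also have "\<dots> = sinh \<rho> ^ (n - 1)" unfolding ts[symmetric] power_mult_distrib by simp
      finally have "ennreal (tanh \<rho> ^ (n - 1) * cosh \<rho> ^ (n + 1)) * ennreal (1 / (cosh \<rho>)\<^sup>2) = ennreal (sinh \<rho> ^ (n - 1))"
        using True by (subst ennreal_mult[symmetric]) auto
      moreover have "\<Phi> (tanh \<rho>) = (\<integral>\<^sup>+\<omega>. \<phi> (cosh \<rho>, sinh \<rho> *\<^sub>R \<omega>) \<partial>sphere_measure)"
        unfolding \<Phi>_def ct by (simp add: ts)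
      ultimately show ?thesis unfolding ct t by (simp only: mult.assoc)
    qed simp
  qed
  finally show ?thesis by (simp add: F_def n_def)
qed

section \<open>The Lorentz form and its reflections\<close>

lemma lorentz_commute: "lorentz v w = lorentz w v"
  by (simp add: lorentz_def inner_commute mult.commute)

lemma lorentz_linear [simp]:
  "lorentz (v + w) z = lorentz v z + lorentz w z" "lorentz z (v + w) = lorentz z v + lorentz z w"
  "lorentz (v - w) z = lorentz v z - lorentz w z" "lorentz z (v - w) = lorentz z v - lorentz z w"
  "lorentz (c *\<^sub>R v) z = c * lorentz v z" "lorentz z (c *\<^sub>R v) = c * lorentz z v"
  by (simp_all add: lorentz_def inner_simps algebra_simps)

lemma hyperbolic_space_iff: "x \<in> hyperbolic_space \<longleftrightarrow> lorentz x x = 1 \<and> fst x > 0"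
  by (cases x) (auto simp: hyperbolic_space_def lorentz_def inner_vec_def power2_eq_square)

lemma lorentz_self: "lorentz v v = (fst v)\<^sup>2 - (norm (snd v))\<^sup>2"
  by (simp add: lorentz_def power2_norm_eq_inner power2_eq_square[of "fst v"])

lemma hyp_dist_lorentz: "hyp_dist x y = arcosh (lorentz x y)"
  by (simp add: hyp_dist_def lorentz_def inner_vec_def)

text \<open>For such vectors the time component exceeds the norm of the space part, and
  Cauchy-Schwarz concludes. It shows that the reflection keeps the upper half of the cone.\<close>

lemma lorentz_pos:
  fixes v w :: "real \<times> (real ^ 'n::finite)"
  assumes "fst v > 0" "lorentz v v > 0" "fst w > 0" "lorentz w w > 0"
  shows "lorentz v w > 0"
proof -
  have less: "norm (snd v) < fst v" if "fst v > 0" "lorentz v v > 0" for v :: "real \<times> (real ^ 'n)"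
    by (rule power2_less_imp_less) (use that in \<open>auto simp: lorentz_self\<close>)
  have "snd v \<bullet> snd w \<le> norm (snd v) * norm (snd w)" by (rule norm_cauchy_schwarz)
  also have "\<dots> < fst v * fst w" using less[OF assms(1,2)] less[OF assms(3,4)] by (rule mult_strict_mono') auto
  finally show ?thesis by (simp add: lorentz_def)
qed

text \<open>The reversed Cauchy-Schwarz inequality on the hyperboloid, via
  \<open>(1 + a * b)\<^sup>2 \<le> (1 + a\<^sup>2) * (1 + b\<^sup>2)\<close>; it places the argument
  of \<open>arcosh\<close> in its proper range.\<close>

lemma lorentz_ge_1:
  assumes "x \<in> hyperbolic_space" "y \<in> hyperbolic_space"
  shows "lorentz x y \<ge> 1"
proof -
  define a b where "a = norm (snd x)" and "b = norm (snd y)"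
  have x: "(fst x)\<^sup>2 = 1 + a\<^sup>2" "fst x > 0" and y: "(fst y)\<^sup>2 = 1 + b\<^sup>2" "fst y > 0"
    using assms by (auto simp: hyperbolic_space_iff lorentz_self a_def b_def)
  have "(1 + a * b)\<^sup>2 \<le> (1 + a\<^sup>2) * (1 + b\<^sup>2)"
    using zero_le_power2[of "a - b"] by (simp add: power2_eq_square algebra_simps)
  also have "\<dots> = (fst x * fst y)\<^sup>2" using x y by (simp add: power_mult_distrib)
  finally have "1 + a * b \<le> fst x * fst y" by (rule power2_le_imp_le) (use x y in auto)
  moreover have "snd x \<bullet> snd y \<le> a * b" unfolding a_def b_def by (rule norm_cauchy_schwarz)
  ultimately show ?thesis by (simp add: lorentz_def)
qed

text \<open>The reflection along \<open>u = x - (1, 0)\<close>, which exchanges two vectors of equal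
  Lorentz square. It requires \<open>lorentz u u = 2 - 2 * fst x\<close> to be nonzero, which fails
  only for \<open>x = (1, 0)\<close>, where the identity serves.\<close>

lemma lorentz_reflection:
  fixes x :: "real \<times> (real ^ 'n::finite)"
  assumes x: "x \<in> hyperbolic_space"
  obtains L where "linear L" "\<And>v. L (L v) = v" "\<And>v w. lorentz (L v) (L w) = lorentz v w" "L (1, 0) = x"
proof (cases "x = (1, 0)")
  case True
  then show ?thesis using that[of "\<lambda>v. v"] by (simp add: linear_id[unfolded id_def])
next
  case False
  define e :: "real \<times> (real ^ 'n)" where "e = (1, 0)"
  define u where "u = x - e"
  define L where "L = (\<lambda>v. v - (2 * lorentz v u / lorentz u u) *\<^sub>R u)"
  have xx: "lorentz x x = 1" "fst x > 0" using x by (auto simp: hyperbolic_space_iff)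
  have ee: "lorentz e e = 1" "lorentz e v = fst v" "lorentz v e = fst v" for v by (auto simp: e_def lorentz_def)
  have "fst e = 1" by (simp add: e_def)
  then have uu: "lorentz u u = 2 - 2 * fst x" by (simp add: u_def xx ee)
  have u0: "lorentz u u \<noteq> 0"
  proof
    assume "lorentz u u = 0"
    then have "fst x = 1" by (simp add: uu)
    then have "snd x \<bullet> snd x = 0" using xx by (simp add: lorentz_def)
    then show False using False \<open>fst x = 1\<close> by (simp add: prod_eq_iff)
  qed
  define k where "k = 2 / lorentz u u"
  have L: "L v = v - (k * lorentz v u) *\<^sub>R u" for v by (simp add: L_def k_def)
  have Lu: "lorentz (L v) u = - lorentz v u" for v using u0 by (simp add: L_def)
  show ?thesis
  proof (rule that)
    show "linear L"
    proof (rule linearI)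
      show "L (v + w) = L v + L w" for v w
        unfolding L lorentz_linear distrib_left scaleR_left_distrib by (rule add_diff_add)
      show "L (c *\<^sub>R v) = c *\<^sub>R L v" for c v
        unfolding L lorentz_linear scaleR_right_diff_distrib scaleR_scaleR by (simp only: mult.left_commute)
    qed
    show "L (L v) = v" for v
    proof -
      have "L (L v) = L v - (k * lorentz (L v) u) *\<^sub>R u" by (rule L)
      also have "\<dots> = L v + (k * lorentz v u) *\<^sub>R u" by (simp add: Lu)
      also have "\<dots> = v" by (simp add: L)
      finally show ?thesis .
    qed
    show "lorentz (L v) (L w) = lorentz v w" for v w
    proof -
      have "lorentz (L v) (L w) = lorentz (L v) w - k * lorentz w u * lorentz (L v) u"
        unfolding L[of w] by simp
      also have "\<dots> = lorentz (L v) w + k * lorentz w u * lorentz v u" by (simp add: Lu)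
      also have "lorentz (L v) w = lorentz v w - k * lorentz v u * lorentz w u"
        unfolding L[of v] by (simp add: lorentz_commute[of u w])
      finally show ?thesis by simp
    qed
    have "lorentz e u = fst x - 1" using \<open>fst e = 1\<close> by (simp add: u_def ee)
    then have "k * lorentz e u = - 1" using u0 unfolding k_def uu by (simp add: field_simps)
    then show "L (1, 0) = x" unfolding e_def[symmetric] L by (simp add: u_def)
  qed
qed

section \<open>The distribution of the distance to a fixed point\<close>

text \<open>The total mass of \<open>sphere_measure\<close>; the argument only carries the
  dimension.\<close>

definition sphere_area :: "'n::finite itself \<Rightarrow> real" where
  "sphere_area _ = real CARD('n) * measure lborel (ball (0 :: real ^ 'n) 1)"

lemma sphere_area_pos: "sphere_area TYPE('n::finite) > 0"
  by (simp add: sphere_area_def content_ball_pos)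

lemma arcosh_measurable [measurable]: "(arcosh :: real \<Rightarrow> real) \<in> borel_measurable borel"
  unfolding arcosh_def[abs_def] by measurable

lemma hyp_dist_measurable [measurable]: "hyp_dist x \<in> borel_measurable borel"
proof -
  have "(\<lambda>y. lorentz x y) \<in> borel_measurable borel" by (intro lorentz_measurable) simp_all
  from measurable_compose[OF this arcosh_measurable] show ?thesis by (simp add: hyp_dist_lorentz[abs_def])
qed

lemma sets_hyp_volume [measurable_cong, simp]: "sets (hyp_volume :: (real \<times> (real ^ 'n::finite)) measure) = sets borel"
  by (simp add: hyp_volume_def)

text \<open>Both sides are transported to the cone, where Lebesgue measure is invariant under the
  reflection \<open>L\<close> taking the origin to \<open>x\<close>; the factor \<open>c\<close> is
  common and cancels. At the origin the distance is the polar radius itself.\<close>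

lemma nn_integral_hyp_dist:
  fixes x :: "real \<times> (real ^ 'n::finite)" and \<phi> :: "real \<Rightarrow> ennreal"
  assumes x: "x \<in> hyperbolic_space" and \<phi> [measurable]: "\<phi> \<in> borel_measurable borel"
  shows "(\<integral>\<^sup>+y. \<phi> (hyp_dist x y) \<partial>hyp_volume) =
    (\<integral>\<^sup>+\<rho>. \<phi> \<rho> * (ennreal (sphere_area TYPE('n) * sinh \<rho> ^ (CARD('n) - 1)) * indicator {0<..} \<rho>) \<partial>lborel)"
proof -
  define e :: "real \<times> (real ^ 'n)" where "e = (1, 0)"
  obtain L where L: "linear L" "\<And>v. L (L v) = v" "\<And>v w. lorentz (L v) (L w) = lorentz v w" "L e = x"
    using lorentz_reflection[OF x] unfolding e_def by metis
  have Lm [measurable]: "L \<in> borel_measurable borel"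
    by (intro borel_measurable_continuous_onI linear_continuous_on_compose[OF continuous_on_id L(1), simplified])
  define c where "c = ennreal (1 / (real CARD('n) + 1))"
  have c: "c \<noteq> 0" "c \<noteq> \<infinity>" by (auto simp: c_def)
  have dm: "(\<lambda>y. \<phi> (hyp_dist z y)) \<in> borel_measurable borel" for z :: "real \<times> (real ^ 'n)"
    by measurable
  let ?H = "\<lambda>z v. indicator unit_cone v * \<phi> (hyp_dist z ((1 / sqrt (lorentz v v)) *\<^sub>R v)) :: ennreal"
  have cone: "c * (\<integral>\<^sup>+y. \<phi> (hyp_dist z y) \<partial>hyp_volume) = (\<integral>\<^sup>+v. ?H z v \<partial>lborel)" for z :: "real \<times> (real ^ 'n)"
    unfolding c_def by (rule nn_integral_unit_cone[OF dm, symmetric])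
  have Hm: "?H z \<in> borel_measurable borel" for z :: "real \<times> (real ^ 'n)"
    by (intro borel_measurable_times_ennreal borel_measurable_indicator borel_open open_unit_cone
        measurable_compose[OF _ dm] borel_measurable_scaleR borel_measurable_divide
        measurable_compose[OF _ borel_measurable_sqrt] lorentz_measurable) simp_all
  \<comment> \<open>\<open>L\<close> preserves the form, so only the sign of the time component
    could leave the cone; it equals \<open>lorentz x w\<close>, which is positive by
    \<open>lorentz_pos\<close>.\<close>
  have posL: "fst (L w) > 0" if "w \<in> unit_cone" for w
  proof -
    have "fst (L w) = lorentz e (L w)" by (simp add: e_def lorentz_def)
    also have "\<dots> = lorentz x w" using L(3)[of e "L w"] by (simp add: L)
    finally show ?thesis using that x by (simp add: unit_cone_def hyperbolic_space_iff lorentz_pos)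
  qed
  have Lcone: "L w \<in> unit_cone" if "w \<in> unit_cone" for w
    using posL[OF that] that by (simp add: unit_cone_def L(3))
  have HL: "?H x (L w) = ?H e w" for w
  proof -
    have "L w \<in> unit_cone \<longleftrightarrow> w \<in> unit_cone" using Lcone[of w] Lcone[of "L w"] by (auto simp: L(2))
    moreover have "lorentz x (L w) = lorentz e w" using L(3)[of e w] by (simp add: L(4))
    ultimately show ?thesis by (simp add: hyp_dist_lorentz L(3) indicator_def)
  qed
  have "c * (\<integral>\<^sup>+y. \<phi> (hyp_dist x y) \<partial>hyp_volume) = (\<integral>\<^sup>+v. ?H x v \<partial>distr lborel borel L)"
    unfolding lborel_linear_involution[OF L(1,2)] by (rule cone)
  also have "\<dots> = (\<integral>\<^sup>+w. ?H x (L w) \<partial>lborel)" by (rule nn_integral_distr) (use Hm in auto)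
  also have "\<dots> = c * (\<integral>\<^sup>+y. \<phi> (hyp_dist e y) \<partial>hyp_volume)" unfolding HL by (rule cone[symmetric])
  finally have "(\<integral>\<^sup>+y. \<phi> (hyp_dist x y) \<partial>hyp_volume) = (\<integral>\<^sup>+y. \<phi> (hyp_dist e y) \<partial>hyp_volume)"
    using c by (simp add: ennreal_mult_cancel_left)
  also have "\<dots> = (\<integral>\<^sup>+\<rho>. (\<integral>\<^sup>+\<omega>. \<phi> (hyp_dist e (cosh \<rho>, sinh \<rho> *\<^sub>R \<omega>)) \<partial>(sphere_measure :: (real ^ 'n) measure)) *
      (ennreal (sinh \<rho> ^ (CARD('n) - 1)) * indicator {0<..} \<rho>) \<partial>lborel)"
    by (rule nn_integral_hyp_volume) measurable
  also have "\<dots> = (\<integral>\<^sup>+\<rho>. \<phi> \<rho> * (ennreal (sphere_area TYPE('n) * sinh \<rho> ^ (CARD('n) - 1)) * indicator {0<..} \<rho>) \<partial>lborel)"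
  proof (rule nn_integral_cong)
    fix \<rho> :: real
    show "(\<integral>\<^sup>+\<omega>. \<phi> (hyp_dist e (cosh \<rho>, sinh \<rho> *\<^sub>R \<omega>)) \<partial>(sphere_measure :: (real ^ 'n) measure)) *
      (ennreal (sinh \<rho> ^ (CARD('n) - 1)) * indicator {0<..} \<rho>) =
      \<phi> \<rho> * (ennreal (sphere_area TYPE('n) * sinh \<rho> ^ (CARD('n) - 1)) * indicator {0<..} \<rho>)"
    proof (cases "\<rho> > 0")
      case True
      have "hyp_dist e (cosh \<rho>, sinh \<rho> *\<^sub>R \<omega>) = \<rho>" for \<omega> :: "real ^ 'n"
        using True by (simp add: hyp_dist_lorentz e_def lorentz_def arcosh_cosh_real)
      moreover have "emeasure (sphere_measure :: (real ^ 'n) measure) (space sphere_measure) = ennreal (sphere_area TYPE('n))"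
        using emeasure_sphere_measure[where 'n='n] by (simp add: sphere_area_def sphere_measure_def)
      moreover have "ennreal (sphere_area TYPE('n) * sinh \<rho> ^ (CARD('n) - 1)) = ennreal (sphere_area TYPE('n)) * ennreal (sinh \<rho> ^ (CARD('n) - 1))"
        using True sphere_area_pos[where 'n='n] by (intro ennreal_mult) auto
      ultimately show ?thesis by (simp add: mult.assoc)
    qed simp
  qed
  finally show ?thesis .
qed

lemma distr_hyp_dist:
  fixes x :: "real \<times> (real ^ 'n::finite)"
  assumes x: "x \<in> hyperbolic_space"
  shows "distr hyp_volume borel (hyp_dist x) =
    density lborel (\<lambda>\<rho>. ennreal (indicator {0<..} \<rho> * (sphere_area TYPE('n) * sinh \<rho> ^ (CARD('n) - 1))))"
proof (rule measure_eqI)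
  fix A assume "A \<in> sets (distr (hyp_volume :: (real \<times> (real ^ 'n)) measure) borel (hyp_dist x))"
  then have A [measurable]: "A \<in> sets borel" by simp
  have dm: "hyp_dist x \<in> hyp_volume \<rightarrow>\<^sub>M borel" by measurable
  have "emeasure (distr hyp_volume borel (hyp_dist x)) A = (\<integral>\<^sup>+\<rho>. indicator A \<rho> \<partial>distr hyp_volume borel (hyp_dist x))"
    by simp
  also have "\<dots> = (\<integral>\<^sup>+y. indicator A (hyp_dist x y) \<partial>hyp_volume)"
    by (rule nn_integral_distr[OF dm]) simp
  also have "\<dots> = (\<integral>\<^sup>+\<rho>. indicator A \<rho> * (ennreal (sphere_area TYPE('n) * sinh \<rho> ^ (CARD('n) - 1)) * indicator {0<..} \<rho>) \<partial>lborel)"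
    by (rule nn_integral_hyp_dist[OF x]) simp
  also have "\<dots> = (\<integral>\<^sup>+\<rho>. ennreal (indicator {0<..} \<rho> * (sphere_area TYPE('n) * sinh \<rho> ^ (CARD('n) - 1))) * indicator A \<rho> \<partial>lborel)"
    by (intro nn_integral_cong) (auto simp: indicator_def)
  also have "\<dots> = emeasure (density lborel (\<lambda>\<rho>. ennreal (indicator {0<..} \<rho> * (sphere_area TYPE('n) * sinh \<rho> ^ (CARD('n) - 1))))) A"
    by (rule emeasure_density[symmetric]) simp_all
  finally show "emeasure (distr hyp_volume borel (hyp_dist x)) A = emeasure (density lborel (\<lambda>\<rho>. ennreal (indicator {0<..} \<rho> * (sphere_area TYPE('n) * sinh \<rho> ^ (CARD('n) - 1))))) A" .
qed simp

lemma hyp_dist_integral: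
  fixes x :: "real \<times> (real ^ 'n::finite)" and g :: "real \<Rightarrow> real"
  assumes x: "x \<in> hyperbolic_space" and [measurable]: "g \<in> borel_measurable borel"
  shows "integrable hyp_volume (\<lambda>y. g (hyp_dist x y)) \<longleftrightarrow>
      set_integrable lborel {0<..} (\<lambda>\<rho>. g \<rho> * sinh \<rho> ^ (CARD('n) - 1))"
    and "(LINT y|hyp_volume. g (hyp_dist x y)) = sphere_area TYPE('n) * (LBINT \<rho>:{0<..}. g \<rho> * sinh \<rho> ^ (CARD('n) - 1))"
proof -
  let ?w = "\<lambda>\<rho>. indicator {0<..} \<rho> * (sphere_area TYPE('n) * sinh \<rho> ^ (CARD('n) - 1)) :: real"
  have S: "sphere_area TYPE('n) > 0" by (rule sphere_area_pos)
  have dm: "hyp_dist x \<in> hyp_volume \<rightarrow>\<^sub>M borel" by measurable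
  have w0: "AE \<rho> in lborel. 0 \<le> ?w \<rho>" using S by (auto simp: indicator_def)
  have wm: "?w \<in> borel_measurable lborel" by measurable
  have e: "?w \<rho> *\<^sub>R g \<rho> = sphere_area TYPE('n) * (indicator {0<..} \<rho> *\<^sub>R (g \<rho> * sinh \<rho> ^ (CARD('n) - 1)))" for \<rho>
    by simp
  have "integrable hyp_volume (\<lambda>y. g (hyp_dist x y)) \<longleftrightarrow> integrable (distr hyp_volume borel (hyp_dist x)) g"
    by (rule integrable_distr_eq[OF dm, symmetric]) simp
  also have "\<dots> \<longleftrightarrow> integrable lborel (\<lambda>\<rho>. ?w \<rho> *\<^sub>R g \<rho>)"
    unfolding distr_hyp_dist[OF x] by (rule integrable_density[OF _ wm w0]) simp
  also have "\<dots> \<longleftrightarrow> set_integrable lborel {0<..} (\<lambda>\<rho>. g \<rho> * sinh \<rho> ^ (CARD('n) - 1))"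
    unfolding e set_integrable_def using S by (simp only: integrable_mult_left_iff) simp
  finally show "integrable hyp_volume (\<lambda>y. g (hyp_dist x y)) \<longleftrightarrow> set_integrable lborel {0<..} (\<lambda>\<rho>. g \<rho> * sinh \<rho> ^ (CARD('n) - 1))" .
  have "(LINT y|hyp_volume. g (hyp_dist x y)) = (LINT \<rho>|distr hyp_volume borel (hyp_dist x). g \<rho>)"
    by (rule integral_distr[OF dm, symmetric]) simp
  also have "\<dots> = (LINT \<rho>|lborel. ?w \<rho> *\<^sub>R g \<rho>)"
    unfolding distr_hyp_dist[OF x] by (rule integral_density[OF _ wm w0]) simp
  also have "\<dots> = sphere_area TYPE('n) * (LBINT \<rho>:{0<..}. g \<rho> * sinh \<rho> ^ (CARD('n) - 1))"
    unfolding e set_lebesgue_integral_def by simp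
  finally show "(LINT y|hyp_volume. g (hyp_dist x y)) = sphere_area TYPE('n) * (LBINT \<rho>:{0<..}. g \<rho> * sinh \<rho> ^ (CARD('n) - 1))" .
qed

text \<open>On \<open>lorentz x x = 1\<close> the time component cannot vanish, so the strict
  inequality may be replaced by a closed one.\<close>

lemma closed_hyperbolic_space: "closed (hyperbolic_space :: (real \<times> (real ^ 'n::finite)) set)"
proof -
  have "fst x \<noteq> 0" if "lorentz x x = 1" for x :: "real \<times> (real ^ 'n)"
    using inner_ge_zero[of "snd x"] that by (auto simp: lorentz_def simp del: inner_ge_zero)
  then have eq: "(hyperbolic_space :: (real \<times> (real ^ 'n)) set) = {x. lorentz x x = 1} \<inter> {x. fst x \<ge> 0}"
    by (fastforce simp: hyperbolic_space_iff less_le)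
  have "closed {x :: real \<times> (real ^ 'n). lorentz x x = 1}"
    unfolding lorentz_def by (intro closed_Collect_eq continuous_intros)
  moreover have "closed {x :: real \<times> (real ^ 'n). fst x \<ge> 0}"
    by (intro closed_Collect_le continuous_intros)
  ultimately show ?thesis unfolding eq by (rule closed_Int)
qed

lemma AE_hyp_volume: "AE y in (hyp_volume :: (real \<times> (real ^ 'n::finite)) measure). y \<in> hyperbolic_space"
proof -
  have [measurable]: "(hyperbolic_space :: (real \<times> (real ^ 'n)) set) \<in> sets borel"
    using closed_hyperbolic_space by (rule borel_closed)
  have "(\<integral>\<^sup>+y. indicator (- hyperbolic_space) y \<partial>(hyp_volume :: (real \<times> (real ^ 'n)) measure)) = (\<integral>\<^sup>+\<rho>. 0 \<partial>(lborel :: real measure))"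
    unfolding nn_integral_hyp_volume[of "indicator (- hyperbolic_space)", OF borel_measurable_indicator[OF borel_comp[OF borel_closed[OF closed_hyperbolic_space]]]]
  proof (rule nn_integral_cong)
    fix \<rho> :: real
    have "(\<integral>\<^sup>+\<omega>. indicator (- hyperbolic_space) (cosh \<rho>, sinh \<rho> *\<^sub>R \<omega>) \<partial>(sphere_measure :: (real ^ 'n) measure)) =
       (\<integral>\<^sup>+\<omega>. 0 \<partial>(sphere_measure :: (real ^ 'n) measure))"
    proof (rule nn_integral_cong_AE)
      show "AE \<omega> in sphere_measure. indicator (- hyperbolic_space) (cosh \<rho>, sinh \<rho> *\<^sub>R (\<omega> :: real ^ 'n)) = (0 :: ennreal)"
        using AE_sphere_measure
      proof eventually_elim
        case (elim \<omega>)
        have "lorentz (cosh \<rho>, sinh \<rho> *\<^sub>R \<omega>) (cosh \<rho>, sinh \<rho> *\<^sub>R \<omega>) = (cosh \<rho>)\<^sup>2 - (sinh \<rho>)\<^sup>2"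
          using elim by (simp add: lorentz_self power_mult_distrib)
        then have "(cosh \<rho>, sinh \<rho> *\<^sub>R \<omega>) \<in> hyperbolic_space"
          by (simp add: hyperbolic_space_iff hyperbolic_pythagoras)
        then show ?case by simp
      qed
    qed
    then show "(\<integral>\<^sup>+\<omega>. indicator (- hyperbolic_space) (cosh \<rho>, sinh \<rho> *\<^sub>R \<omega>) \<partial>(sphere_measure :: (real ^ 'n) measure)) *
       (ennreal (sinh \<rho> ^ (CARD('n) - 1)) * indicator {0<..} \<rho>) = 0" by simp
  qed
  then have "AE y in (hyp_volume :: (real \<times> (real ^ 'n)) measure). indicator (- hyperbolic_space) y = (0 :: ennreal)"
    by (subst nn_integral_0_iff_AE[symmetric]) simp_all
  then show ?thesis by eventually_elim (simp add: indicator_def split: if_splits)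
qed

section \<open>The limit of the fractional p-Laplacian\<close>

lemma norm_Phi: "norm (Phi p z) = norm z powr (p - 1)"
proof (cases "z = 0")
  case False
  then have "norm z powr (p - 2) * norm z = norm z powr (p - 2) * norm z powr 1" by simp
  also have "\<dots> = norm z powr (p - 1)" by (simp only: powr_add[symmetric]) simp
  finally show ?thesis using False by (simp add: Phi_def norm_mult)
qed (simp add: Phi_def)

lemma Phi_measurable [measurable]: "Phi p \<in> borel_measurable borel"
proof -
  have "Phi p = (\<lambda>z. of_real (norm z powr (p - 2)) * z)" by (auto simp: Phi_def fun_eq_iff)
  then show ?thesis by simp
qed

text \<open>Compactness bounds the Euclidean norm on the support, and
  \<open>lorentz x y \<le> 2 * (norm x * norm y)\<close> turns this into a bound for the hyperbolic
  distance.\<close>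

lemma hyp_Cc_vanishes_outside_ball:
  fixes f :: "real \<times> (real ^ 'n::finite) \<Rightarrow> complex"
  assumes f: "f \<in> hyp_Cc" and x: "x \<in> hyperbolic_space"
  obtains R where "R > 0" "\<And>y. y \<in> hyperbolic_space \<Longrightarrow> hyp_dist x y > R \<Longrightarrow> f y = 0"
proof -
  have "bounded (closure {y \<in> hyperbolic_space. f y \<noteq> 0})" using f by (auto simp: hyp_Cc_def compact_imp_bounded)
  then obtain b where b: "\<And>y. y \<in> hyperbolic_space \<Longrightarrow> f y \<noteq> 0 \<Longrightarrow> norm y \<le> b"
    using closure_subset[of "{y \<in> hyperbolic_space. f y \<noteq> 0}"] unfolding bounded_iff by blast
  \<comment> \<open>The lower bound 2 makes \<open>arcosh T\<close> positive; the other argument is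
    the bound on \<open>lorentz x y\<close> over the support.\<close>
  define T where "T = max 2 (2 * (norm x * b))"
  have T: "T \<ge> 2" "2 * (norm x * b) \<le> T" by (auto simp: T_def)
  show ?thesis
  proof (rule that)
    show "arcosh T > 0" using T by simp
    fix y assume y: "y \<in> hyperbolic_space" "hyp_dist x y > arcosh T"
    show "f y = 0"
    proof (rule ccontr)
      assume "f y \<noteq> 0"
      then have nb: "norm y \<le> b" using b y by auto
      have "\<bar>fst x\<bar> * \<bar>fst y\<bar> \<le> norm x * norm y"
        using norm_fst_le[of "fst x" "snd x"] norm_fst_le[of "fst y" "snd y"] by (intro mult_mono) auto
      moreover have "\<bar>snd x \<bullet> snd y\<bar> \<le> norm x * norm y"
      proof -
        have "\<bar>snd x \<bullet> snd y\<bar> \<le> norm (snd x) * norm (snd y)" by (rule Cauchy_Schwarz_ineq2)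
        also have "\<dots> \<le> norm x * norm y"
          using norm_snd_le[of "snd x" "fst x"] norm_snd_le[of "snd y" "fst y"] by (intro mult_mono) auto
        finally show ?thesis .
      qed
      moreover have "fst x * fst y \<le> \<bar>fst x\<bar> * \<bar>fst y\<bar>" unfolding abs_mult[symmetric] by (rule abs_ge_self)
      ultimately have "lorentz x y \<le> 2 * (norm x * norm y)" unfolding lorentz_def by linarith
      also have "\<dots> \<le> T" using mult_left_mono[OF nb norm_ge_zero[of x]] T(2) by linarith
      finally have "hyp_dist x y \<le> arcosh T"
        using lorentz_ge_1[OF x y(1)] T arcosh_less_iff_real[of T "lorentz x y"]
        unfolding hyp_dist_lorentz by linarith
      then show False using y by simp
    qed
  qed
qed

lemma hyp_Lip_loc_bound:
  fixes f :: "real \<times> (real ^ 'n::finite) \<Rightarrow> complex"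
  assumes f: "f \<in> hyp_Lip_loc \<alpha>" and x: "x \<in> hyperbolic_space" and R: "R > 0"
  obtains C where "C \<ge> 0" "\<And>y. y \<in> hyperbolic_space \<Longrightarrow> 0 < hyp_dist x y \<Longrightarrow> hyp_dist x y \<le> R \<Longrightarrow>
    norm (f x - f y) \<le> C * hyp_dist x y powr \<alpha>"
proof -
  have "bdd_above ((\<lambda>y. norm (f x - f y) / hyp_dist x y powr \<alpha>) ` {y \<in> hyperbolic_space. y \<noteq> x \<and> hyp_dist x y \<le> R})"
    using f x R by (auto simp: hyp_Lip_loc_def)
  then obtain C where C: "\<And>y. y \<in> hyperbolic_space \<Longrightarrow> y \<noteq> x \<Longrightarrow> hyp_dist x y \<le> R \<Longrightarrow>
    norm (f x - f y) / hyp_dist x y powr \<alpha> \<le> C"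
    unfolding bdd_above_def by blast
  have xx: "hyp_dist x x = 0" using x by (simp add: hyp_dist_lorentz hyperbolic_space_iff)
  show ?thesis
  proof (rule that[of "max 0 C"])
    fix y assume y: "y \<in> hyperbolic_space" "0 < hyp_dist x y" "hyp_dist x y \<le> R"
    then have "norm (f x - f y) / hyp_dist x y powr \<alpha> \<le> max 0 C" using C[of y] xx by fastforce
    then show "norm (f x - f y) \<le> max 0 C * hyp_dist x y powr \<alpha>" using y by (simp add: divide_le_eq)
  qed simp
qed

text \<open>Dominated convergence after \<open>\<epsilon> = inverse t\<close>: for an integrable
  function the principal value is the ordinary integral.\<close>

lemma tendsto_indicator_greater:
  fixes Z :: "'a \<Rightarrow> complex" and d :: "'a \<Rightarrow> real"
  assumes Z: "integrable M Z" and d [measurable]: "d \<in> borel_measurable M" and Z0: "\<And>y. d y \<le> 0 \<Longrightarrow> Z y = 0"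
  shows "((\<lambda>\<epsilon>. LINT y|M. indicator {y. \<epsilon> < d y} y *\<^sub>R Z y) \<longlongrightarrow> (LINT y|M. Z y)) (at_right 0)"
  unfolding filterlim_at_right_to_top
proof (rule integral_dominated_convergence_at_top[where w = "\<lambda>y. norm (Z y)"])
  show "(\<lambda>y. indicator {y. inverse t < d y} y *\<^sub>R Z y) \<in> borel_measurable M" for t :: real
    using Z unfolding indicator_def by measurable
  show "AE y in M. ((\<lambda>t. indicator {y. inverse t < d y} y *\<^sub>R Z y) \<longlongrightarrow> Z y) at_top"
  proof (intro AE_I2)
    fix y
    show "((\<lambda>t. indicator {y. inverse t < d y} y *\<^sub>R Z y) \<longlongrightarrow> Z y) at_top"
    proof (cases "d y > 0")
      case True
      have "((\<lambda>t::real. inverse t) \<longlongrightarrow> 0) at_top" by (rule tendsto_inverse_0_at_top) (rule filterlim_ident)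
      from order_tendstoD(2)[OF this True] show ?thesis
        by (intro tendsto_eventually) (auto elim!: eventually_mono)
    next
      case False
      then show ?thesis using Z0[of y] by simp
    qed
  qed
  show "eventually (\<lambda>t. AE y in M. norm (indicator {y. inverse t < d y} y *\<^sub>R Z y) \<le> norm (Z y)) at_top"
    by (intro always_eventually allI AE_I2) (simp add: indicator_def)
qed (use Z in auto)

text \<open>All estimates are absolute, so for small \<open>s\<close> the principal value is an
  ordinary integral; its existence and its value come from the same decomposition
  \<open>Z = Near + Far\<close>.\<close>

lemma frac_p_laplacian_limit:
  fixes f :: "real \<times> (real ^ 'n::finite) \<Rightarrow> complex"
  assumes n: "CARD('n) \<ge> 2" and p: "1 < p" and \<alpha>: "0 < \<alpha>"
    and A: "\<And>R. R > 0 \<Longrightarrow> eventually (\<lambda>s. set_integrable lborel {R<..} (\<lambda>\<rho>. frac_kernel CARD('n) s p \<rho> * sinh \<rho> ^ (CARD('n) - 1))) (at_right 0)"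
      "\<And>R. R > 0 \<Longrightarrow> ((\<lambda>s. LBINT \<rho>:{R<..}. frac_kernel CARD('n) s p \<rho> * sinh \<rho> ^ (CARD('n) - 1)) \<longlongrightarrow> A) (at_right 0)"
    and f: "f \<in> hyp_Cc" "f \<in> hyp_Lip_loc \<alpha>" and x: "x \<in> hyperbolic_space"
  shows "eventually (\<lambda>s. frac_p_laplacian_exists s p f x) (at_right 0)"
    and "((\<lambda>s. frac_p_laplacian s p f x) \<longlongrightarrow> of_real (sphere_area TYPE('n) * A) * Phi p (f x)) (at_right 0)"
proof -
  let ?H = "hyperbolic_space :: (real \<times> (real ^ 'n)) set"
  let ?M = "hyp_volume :: (real \<times> (real ^ 'n)) measure"
  define n where "n = CARD('n)"
  define d where "d = hyp_dist x"
  have d [measurable]: "d \<in> borel_measurable borel" unfolding d_def by (rule hyp_dist_measurable)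
  have H [measurable]: "?H \<in> sets borel" using closed_hyperbolic_space by (rule borel_closed)
  \<comment> \<open>\<open>f\<close> is constrained on hyperbolic space only; extended by 0 it is
    Borel on the ambient space.\<close>
  define F where "F = (\<lambda>y. indicator ?H y *\<^sub>R f y)"
  have F [measurable]: "F \<in> borel_measurable borel"
    unfolding F_def using f by (intro borel_measurable_continuous_on_indicator H) (simp add: hyp_Cc_def)
  define k where "k = (\<lambda>s \<rho>. indicator {0<..} \<rho> * frac_kernel n s p \<rho>)"
  have k [measurable]: "k s \<in> borel_measurable borel" for s
    unfolding k_def n_def by (rule frac_kernel_measurable[OF n])
  obtain R where R: "R > 0" "\<And>y. y \<in> ?H \<Longrightarrow> d y > R \<Longrightarrow> f y = 0"
    using hyp_Cc_vanishes_outside_ball[OF f(1) x] unfolding d_def by blast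
  obtain C where C: "C \<ge> 0" "\<And>y. y \<in> ?H \<Longrightarrow> 0 < d y \<Longrightarrow> d y \<le> R \<Longrightarrow> norm (f x - f y) \<le> C * d y powr \<alpha>"
    using hyp_Lip_loc_bound[OF f(2) x R(1)] unfolding d_def by blast
  \<comment> \<open>The exponent left by the Lipschitz bound, since
    \<open>(C * d powr \<alpha>) powr (p - 1)\<close> contains
    \<open>d powr (\<alpha> * (p - 1))\<close>.\<close>
  define \<gamma> where "\<gamma> = \<alpha> * (p - 1)"
  have \<gamma>: "\<gamma> > 0" using p \<alpha> by (simp add: \<gamma>_def)
  define Z where "Z = (\<lambda>s y. indicator ?H y *\<^sub>R (Phi p (f x - F y) * of_real (k s (d y))))"
  have Zm [measurable]: "Z s \<in> borel_measurable borel" for s unfolding Z_def by measurable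
  define Near where "Near = (\<lambda>s y. indicator {..R} (d y) *\<^sub>R Z s y)"
  define Far where "Far = (\<lambda>s y. indicator {R<..} (d y) *\<^sub>R Z s y)"
  have Nm [measurable]: "Near s \<in> borel_measurable borel" and Fm [measurable]: "Far s \<in> borel_measurable borel" for s
    unfolding Near_def Far_def by measurable
  have ZNF: "Z s y = Near s y + Far s y" for s y by (simp add: Near_def Far_def indicator_def)
  \<comment> \<open>As a nonnegative integral \<open>E s\<close> always makes sense; its convergence
    to 0 yields both the integrability of \<open>Near s\<close> for small \<open>s\<close> and the
    limit of its integral.\<close>
  define E where "E = (\<lambda>s. \<integral>\<^sup>+y. ennreal (norm (Near s y)) \<partial>?M)"
  have E: "(E \<longlongrightarrow> 0) (at_right 0)"
  proof -
    define K where "K = C powr (p - 1) * sphere_area TYPE('n)"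
    have K0: "K \<ge> 0" using sphere_area_pos[where 'n='n] by (simp add: K_def)
    define B where "B = (\<lambda>s. \<integral>\<^sup>+\<rho>. ennreal (\<rho> powr \<gamma> * sinh \<rho> ^ (n - 1) * \<bar>frac_kernel n s p \<rho>\<bar>) * indicator {0<..R} \<rho> \<partial>lborel)"
    have B: "(B \<longlongrightarrow> 0) (at_right 0)"
      unfolding B_def n_def using frac_kernel_near[OF n _ \<gamma> R(1), of p] p by simp
    have le: "E s \<le> ennreal K * B s" for s
    proof -
      let ?\<phi> = "\<lambda>\<rho>. ennreal (C powr (p - 1) * (\<rho> powr \<gamma> * \<bar>k s \<rho>\<bar>)) * indicator {0<..R} \<rho>"
      have "E s \<le> (\<integral>\<^sup>+y. ?\<phi> (d y) \<partial>?M)"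
        unfolding E_def
      proof (rule nn_integral_mono)
        fix y
        show "ennreal (norm (Near s y)) \<le> ?\<phi> (d y)"
        proof (cases "y \<in> ?H \<and> 0 < d y \<and> d y \<le> R")
          case True
          have "norm (Near s y) = norm (f x - f y) powr (p - 1) * \<bar>k s (d y)\<bar>"
            using True by (simp add: Near_def Z_def F_def norm_mult norm_Phi)
          also have "\<dots> \<le> (C * d y powr \<alpha>) powr (p - 1) * \<bar>k s (d y)\<bar>"
            using True C p by (intro mult_right_mono powr_mono2) auto
          also have "\<dots> = C powr (p - 1) * (d y powr \<gamma> * \<bar>k s (d y)\<bar>)"
            using C(1) by (simp add: powr_mult powr_powr \<gamma>_def)
          finally show ?thesis using True by (simp add: ennreal_leI)
        next
          case False
          then have "Near s y = 0" by (auto simp: Near_def Z_def k_def indicator_def)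
          then show ?thesis by simp
        qed
      qed
      also have "\<dots> = (\<integral>\<^sup>+\<rho>. ?\<phi> \<rho> * (ennreal (sphere_area TYPE('n) * sinh \<rho> ^ (CARD('n) - 1)) * indicator {0<..} \<rho>) \<partial>lborel)"
        unfolding d_def by (rule nn_integral_hyp_dist[OF x]) measurable
      also have "\<dots> = (\<integral>\<^sup>+\<rho>. ennreal K * (ennreal (\<rho> powr \<gamma> * sinh \<rho> ^ (n - 1) * \<bar>k s \<rho>\<bar>) * indicator {0<..R} \<rho>) \<partial>lborel)"
      proof (rule nn_integral_cong)
        fix \<rho> :: real
        show "?\<phi> \<rho> * (ennreal (sphere_area TYPE('n) * sinh \<rho> ^ (CARD('n) - 1)) * indicator {0<..} \<rho>) =
          ennreal K * (ennreal (\<rho> powr \<gamma> * sinh \<rho> ^ (n - 1) * \<bar>k s \<rho>\<bar>) * indicator {0<..R} \<rho>)"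
        proof (cases "0 < \<rho> \<and> \<rho> \<le> R")
          case True
          have "ennreal (C powr (p - 1) * (\<rho> powr \<gamma> * \<bar>k s \<rho>\<bar>)) * ennreal (sphere_area TYPE('n) * sinh \<rho> ^ (CARD('n) - 1))
            = ennreal ((C powr (p - 1) * (\<rho> powr \<gamma> * \<bar>k s \<rho>\<bar>)) * (sphere_area TYPE('n) * sinh \<rho> ^ (CARD('n) - 1)))"
            using True sphere_area_pos[where 'n='n] by (intro ennreal_mult[symmetric]) auto
          also have "(C powr (p - 1) * (\<rho> powr \<gamma> * \<bar>k s \<rho>\<bar>)) * (sphere_area TYPE('n) * sinh \<rho> ^ (CARD('n) - 1)) =
            K * (\<rho> powr \<gamma> * sinh \<rho> ^ (n - 1) * \<bar>k s \<rho>\<bar>)" by (simp add: K_def n_def mult_ac)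
          also have "ennreal \<dots> = ennreal K * ennreal (\<rho> powr \<gamma> * sinh \<rho> ^ (n - 1) * \<bar>k s \<rho>\<bar>)"
            using True K0 by (intro ennreal_mult) auto
          finally show ?thesis using True by simp
        qed auto
      qed
      also have "\<dots> = ennreal K * (\<integral>\<^sup>+\<rho>. ennreal (\<rho> powr \<gamma> * sinh \<rho> ^ (n - 1) * \<bar>k s \<rho>\<bar>) * indicator {0<..R} \<rho> \<partial>lborel)"
        by (rule nn_integral_cmult) measurable
      also have "(\<integral>\<^sup>+\<rho>. ennreal (\<rho> powr \<gamma> * sinh \<rho> ^ (n - 1) * \<bar>k s \<rho>\<bar>) * indicator {0<..R} \<rho> \<partial>lborel) = B s"
        unfolding B_def by (intro nn_integral_cong) (auto simp: k_def indicator_def)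
      finally show ?thesis .
    qed
    have "((\<lambda>s. ennreal K * B s) \<longlongrightarrow> ennreal K * 0) (at_right 0)"
      by (intro ennreal_tendsto_cmult B) simp
    then have lim: "((\<lambda>s. ennreal K * B s) \<longlongrightarrow> 0) (at_right 0)" by simp
    show ?thesis
    proof (rule tendsto_sandwich[OF _ _ tendsto_const lim])
      show "eventually (\<lambda>s. E s \<le> ennreal K * B s) (at_right 0)" using le by (intro always_eventually allI)
    qed simp
  qed
  have "eventually (\<lambda>s. E s < \<infinity>) (at_right 0)" using order_tendstoD(2)[OF E, of \<infinity>] by simp
  then have evN: "eventually (\<lambda>s. integrable ?M (Near s)) (at_right 0)"
  proof eventually_elim
    case (elim s)
    have "Near s \<in> borel_measurable ?M" by measurable
    with elim show ?case by (simp add: integrable_iff_bounded E_def)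
  qed
  have limN: "((\<lambda>s. LINT y|?M. Near s y) \<longlongrightarrow> 0) (at_right 0)"
  proof (rule tendsto_norm_zero_cancel, rule tendsto_sandwich[OF _ _ tendsto_const])
    have "((\<lambda>s. enn2real (E s)) \<longlongrightarrow> enn2real 0) (at_right 0)" using E by (intro tendsto_enn2real) simp_all
    then show "((\<lambda>s. enn2real (E s)) \<longlongrightarrow> 0) (at_right 0)" by simp
    show "eventually (\<lambda>s. norm (LINT y|?M. Near s y) \<le> enn2real (E s)) (at_right 0)"
      using evN \<open>eventually (\<lambda>s. E s < \<infinity>) (at_right 0)\<close>
    proof eventually_elim
      case (elim s)
      have "ennreal (norm (LINT y|?M. Near s y)) \<le> E s"
        unfolding E_def by (rule integral_norm_bound_ennreal[OF elim(1)])
      then have "enn2real (ennreal (norm (LINT y|?M. Near s y))) \<le> enn2real (E s)"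
        using elim(2) by (intro enn2real_mono) auto
      then show ?case by simp
    qed
  qed simp
  define g where "g = (\<lambda>s \<rho>. indicator {R<..} \<rho> * k s \<rho>)"
  have g [measurable]: "g s \<in> borel_measurable borel" for s unfolding g_def by measurable
  have FarE: "AE y in ?M. Far s y = of_real (g s (d y)) * Phi p (f x)" for s
    using AE_hyp_volume
  proof eventually_elim
    case (elim y)
    then show ?case using R(2)[of y] by (auto simp: Far_def Z_def F_def g_def indicator_def)
  qed
  have gind: "indicator {0<..} \<rho> *\<^sub>R (g s \<rho> * sinh \<rho> ^ (n - 1)) = indicator {R<..} \<rho> *\<^sub>R (frac_kernel n s p \<rho> * sinh \<rho> ^ (n - 1))" for s \<rho>
    using R(1) by (auto simp: g_def k_def indicator_def)
  have evF: "eventually (\<lambda>s. integrable ?M (\<lambda>y. g s (d y))) (at_right 0)"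
    using A(1)[OF R(1)]
  proof eventually_elim
    case (elim s)
    then show ?case unfolding d_def hyp_dist_integral(1)[OF x g] n_def[symmetric] set_integrable_def gind .
  qed
  have gint: "(LINT y|?M. g s (d y)) = sphere_area TYPE('n) * (LBINT \<rho>:{R<..}. frac_kernel n s p \<rho> * sinh \<rho> ^ (n - 1))" for s
    unfolding d_def hyp_dist_integral(2)[OF x g] n_def[symmetric] set_lebesgue_integral_def gind ..
  have evZ: "eventually (\<lambda>s. integrable ?M (Z s) \<and>
      (LINT y|?M. Z s y) = (LINT y|?M. Near s y) + of_real (LINT y|?M. g s (d y)) * Phi p (f x)) (at_right 0)"
    using evN evF
  proof eventually_elim
    case (elim s)
    have ig: "integrable ?M (\<lambda>y. of_real (g s (d y)) * Phi p (f x))"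
      by (intro integrable_mult_left integrable_of_real elim)
    have iF: "integrable ?M (Far s)"
      using ig by (subst integrable_cong_AE[OF _ _ FarE]) measurable
    have "Z s = (\<lambda>y. Near s y + Far s y)" using ZNF by auto
    moreover have "(LINT y|?M. Far s y) = (LINT y|?M. of_real (g s (d y)) * Phi p (f x))"
      by (rule integral_cong_AE[OF _ _ FarE]) measurable
    moreover have "\<dots> = of_real (LINT y|?M. g s (d y)) * Phi p (f x)"
      by (simp add: integral_complex_of_real)
    ultimately show ?case using elim(1) iF by simp
  qed
  have Z0: "Z s y = 0" if "d y \<le> 0" for s y using that by (simp add: Z_def k_def)
  have trunc: "indicator {y \<in> ?H. d y > \<epsilon>} y *\<^sub>R frac_p_integrand s p f x y = indicator {y. \<epsilon> < d y} y *\<^sub>R Z s y"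
    if "\<epsilon> > 0" for s \<epsilon> y
    using that by (auto simp: frac_p_integrand_def Z_def F_def k_def n_def d_def indicator_def)
  have main: "eventually (\<lambda>s. frac_p_laplacian_exists s p f x \<and>
      frac_p_laplacian s p f x = (LINT y|?M. Near s y) + of_real (LINT y|?M. g s (d y)) * Phi p (f x)) (at_right 0)"
    using evZ
  proof eventually_elim
    case (elim s)
    then have iZ: "integrable ?M (Z s)" by blast
    have dM: "d \<in> borel_measurable ?M" by measurable
    have int: "set_integrable ?M {y \<in> ?H. d y > \<epsilon>} (frac_p_integrand s p f x)" if "\<epsilon> > 0" for \<epsilon>
      unfolding set_integrable_def trunc[OF that]
    proof (rule integrable_mult_indicator[OF _ iZ])
      have "{y \<in> space borel. \<epsilon> < d y} \<in> sets borel" by measurable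
      then show "{y. \<epsilon> < d y} \<in> sets ?M" by simp
    qed
    have "((\<lambda>\<epsilon>. LINT y|?M. indicator {y. \<epsilon> < d y} y *\<^sub>R Z s y) \<longlongrightarrow> (LINT y|?M. Z s y)) (at_right 0)"
      by (rule tendsto_indicator_greater[OF iZ dM Z0])
    moreover have "eventually (\<lambda>\<epsilon>. (LINT y|?M. indicator {y. \<epsilon> < d y} y *\<^sub>R Z s y) = truncated_frac_p_laplacian s p f x \<epsilon>) (at_right 0)"
      using eventually_at_right_less
    proof eventually_elim
      case (elim \<epsilon>)
      show ?case unfolding truncated_frac_p_laplacian_def set_lebesgue_integral_def
        d_def[symmetric] trunc[OF elim] ..
    qed
    ultimately have lim: "(truncated_frac_p_laplacian s p f x \<longlongrightarrow> (LINT y|?M. Z s y)) (at_right 0)"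
      by (rule Lim_transform_eventually)
    then have "frac_p_laplacian s p f x = (LINT y|?M. Z s y)"
      unfolding frac_p_laplacian_def by (intro tendsto_Lim) simp
    moreover have "frac_p_laplacian_exists s p f x"
      unfolding frac_p_laplacian_exists_def using int lim by (auto simp: d_def)
    ultimately show ?case using elim by simp
  qed
  then show "eventually (\<lambda>s. frac_p_laplacian_exists s p f x) (at_right 0)"
    by eventually_elim simp
  have "((\<lambda>s. (LINT y|?M. Near s y) + of_real (LINT y|?M. g s (d y)) * Phi p (f x)) \<longlongrightarrow>
     0 + of_real (sphere_area TYPE('n) * A) * Phi p (f x)) (at_right 0)"
    unfolding gint n_def by (intro tendsto_intros limN A(2) R(1))
  then show "((\<lambda>s. frac_p_laplacian s p f x) \<longlongrightarrow> of_real (sphere_area TYPE('n) * A) * Phi p (f x)) (at_right 0)"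
    by (rule Lim_transform_eventually[OF tendsto_eq_rhs]) (use main in \<open>auto elim!: eventually_mono\<close>)
qed

theorem theorem1p1:
  fixes p :: real
  assumes "CARD('n::finite) \<ge> 2" and "1 < p"
  shows "\<exists>A>0. \<forall>\<alpha>\<in>{0<..<1}. \<forall>f \<in> (hyp_Cc \<inter> hyp_Lip_loc \<alpha> :: (real \<times> (real ^ 'n) \<Rightarrow> complex) set).
           \<forall>x\<in>hyperbolic_space.
             (\<forall>\<^sub>F s in at_right 0. frac_p_laplacian_exists s p f x) \<and>
             ((\<lambda>s. frac_p_laplacian s p f x) \<longlongrightarrow> of_real A * Phi p (f x)) (at_right 0)"
proof -
  \<comment> \<open>\<open>A\<close> is fixed from the dimension and \<open>p\<close> alone, before
    \<open>\<alpha>\<close>, \<open>f\<close> and \<open>x\<close> are introduced; the sphere area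
    then supplies the angular factor.\<close>
  obtain A where A: "A > 0"
    "\<And>R. R > 0 \<Longrightarrow> eventually (\<lambda>s. set_integrable lborel {R<..} (\<lambda>\<rho>. frac_kernel CARD('n) s p \<rho> * sinh \<rho> ^ (CARD('n) - 1))) (at_right 0)"
    "\<And>R. R > 0 \<Longrightarrow> ((\<lambda>s. LBINT \<rho>:{R<..}. frac_kernel CARD('n) s p \<rho> * sinh \<rho> ^ (CARD('n) - 1)) \<longlongrightarrow> A) (at_right 0)"
    using frac_kernel_tail[OF assms(1), of p] assms(2) by auto
  show ?thesis
  proof (intro exI[of _ "sphere_area TYPE('n) * A"] conjI ballI)
    show "sphere_area TYPE('n) * A > 0" using A(1) sphere_area_pos[where 'n='n] by simp
    fix \<alpha> and f :: "real \<times> (real ^ 'n) \<Rightarrow> complex" and x :: "real \<times> (real ^ 'n)"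
    assume "\<alpha> \<in> {0<..<1::real}" "f \<in> hyp_Cc \<inter> hyp_Lip_loc \<alpha>" "x \<in> hyperbolic_space"
    then have "0 < \<alpha>" "f \<in> hyp_Cc" "f \<in> hyp_Lip_loc \<alpha>" "x \<in> hyperbolic_space" by auto
    note fx = this
    show "\<forall>\<^sub>F s in at_right 0. frac_p_laplacian_exists s p f x"
      by (rule frac_p_laplacian_limit(1)[where \<alpha>=\<alpha> and A=A]) (rule A fx assms | assumption)+
    show "((\<lambda>s. frac_p_laplacian s p f x) \<longlongrightarrow> of_real (sphere_area TYPE('n) * A) * Phi p (f x)) (at_right 0)"
      by (rule frac_p_laplacian_limit(2)[where \<alpha>=\<alpha> and A=A]) (rule A fx assms | assumption)+
  qed
qed

end
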